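(* Let $p,q$ be primes with $2<p<q$. Every (left) brace of order $p^2q$ is isomorphic to exactly one of the following braces (pairwise non-isomorphic): (1) in every case: $T^{p,p,q}_{1,1}$, $T^{p^2,q}_{1}$, $B^{p,p,q}_{1,1}$, $B^{p^2,q}_{1}$; (2) additionally, if $p\mid q-1$: $T^{p,p,q}_{\omega,1}$; $T^{p^2,q}_{\omega}$; the three braces $B^{p,p,q}_{1,\omega}$, $B^{p,p,q}_{\omega,1}$, $B^{p,p,q}_{\omega^{\eta},1}$; and the $p-1$ braces $B^{p^2,q}_{\omega^i}$ ($i=1,\dots,p-1$), where $\omega$ is a fixed primitive $p$-th root of unity in $\mathbb{Z}_q^{\times}$ and $\eta$ is a fixed quadratic non-residue in $\mathbb{Z}_p^{\times}$; (3) additionally, if $p^2\mid q-1$: $T^{p^2,q}_{\tilde\omega}$ and the $p-1$ braces $B^{p^2,q}_{\tilde\omega^i}$ ($i=1,\dots,p-1$), where $\tilde\omega$ is a fixed primitive $p^2$-th root of unity in $\mathbb{Z}_q^{\times}$.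
   Context: $\mathbb{Z}_n=\mathbb{Z}/n\mathbb{Z}$ and $C(n,2)=n(n-1)/2$. A (left) brace is a (here finite) abelian group $(A,+)$ with a binary operation $\cdot$ such that for all $a,b,c\in A$: $a\cdot(b+c)=a\cdot b+a\cdot c$; $(a\cdot b+a+b)\cdot c=a\cdot(b\cdot c)+a\cdot c+b\cdot c$; and $x\mapsto a\cdot x+x$ is bijective. Isomorphisms of braces are bijections preserving $+$ and $\cdot$; the order of a brace is its cardinality. For odd $p$, the named braces are the following abelian groups with the following multiplications. $T^{p,p,q}_{\omega,\mu}=\mathbb{Z}_p^2\oplus\mathbb{Z}_q$ (for $\omega,\mu\in\mathbb{Z}_q^\times$ with $\omega^p=\mu^p=1$): $\left(\begin{pmatrix} x_1 \\ y_1 \end{pmatrix},a_1\right)\cdot\left(\begin{pmatrix} x_2 \\ y_2 \end{pmatrix},a_2\right)=\left(\begin{pmatrix} 0 \\ 0 \end{pmatrix},(\omega^{x_1}\mu^{y_1}-1)a_2\right)$. $T^{p^2,q}_{\omega}=\mathbb{Z}_{p^2}\oplus\mathbb{Z}_q$ (for $\omega\in\mathbb{Z}_q^\times$ with $\omega^{p^2}=1$): $(x_1,a_1)\cdot(x_2,a_2)=(0,(\omega^{x_1}-1)a_2)$. $B^{p,p,q}_{\omega,\mu}=\mathbb{Z}_p^2\oplus\mathbb{Z}_q$ (for $\omega,\mu\in\mathbb{Z}_q^\times$ with $\omega^p=\mu^p=1$): $\left(\begin{pmatrix} x_1 \\ y_1 \end{pmatrix},a_1\right)\cdot\left(\begin{pmatrix}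 x_2 \\ y_2 \end{pmatrix},a_2\right)=\left(\begin{pmatrix} y_1y_2 \\ 0 \end{pmatrix},(\omega^{x_1-C(y_1,2)}\mu^{y_1}-1)a_2\right)$. $B^{p^2,q}_{\omega}=\mathbb{Z}_{p^2}\oplus\mathbb{Z}_q$ (for $\omega\in\mathbb{Z}_q^\times$ with $\omega^{p^2}=1$): $(x_1,a_1)\cdot(x_2,a_2)=(px_1x_2,(\omega^{x_1-pC(x_1,2)}-1)a_2)$. *)

theory Defs
  imports "HOL-Algebra.Algebra" "HOL-Number_Theory.Number_Theory"
begin

(* The type of ring records is used only as a container for carrier, (+), 0 and the brace
   multiplication: a brace is in general neither right distributive nor multiplicatively
   associative, and it has no unit. The field "one" is junk, constrained nowhere. *)
locale brace = abelian_group A for A (structure) +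
  assumes finite_carrier: "finite (carrier A)"
    and mult_closed: "\<lbrakk>a \<in> carrier A; b \<in> carrier A\<rbrakk> \<Longrightarrow> a \<otimes> b \<in> carrier A"
    and left_distrib: "\<lbrakk>a \<in> carrier A; b \<in> carrier A; c \<in> carrier A\<rbrakk>
      \<Longrightarrow> a \<otimes> (b \<oplus> c) = a \<otimes> b \<oplus> a \<otimes> c"
    and circle_mult: "\<lbrakk>a \<in> carrier A; b \<in> carrier A; c \<in> carrier A\<rbrakk>
      \<Longrightarrow> (a \<otimes> b \<oplus> a \<oplus> b) \<otimes> c = a \<otimes> (b \<otimes> c) \<oplus> a \<otimes> c \<oplus> b \<otimes> c"
    and lambda_bij: "a \<in> carrier A
      \<Longrightarrow> bij_betw (\<lambda>x. a \<otimes> x \<oplus> x) (carrier A) (carrier A)"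

(* Unlike ring_iso, this ignores the junk field "one". *)
definition brace_iso :: "('a, 'm) ring_scheme \<Rightarrow> ('b, 'n) ring_scheme \<Rightarrow> ('a \<Rightarrow> 'b) set" where
  "brace_iso A B = {h. bij_betw h (carrier A) (carrier B) \<and>
     (\<forall>x\<in>carrier A. \<forall>y\<in>carrier A.
        h (x \<oplus>\<^bsub>A\<^esub> y) = h x \<oplus>\<^bsub>B\<^esub> h y \<and> h (x \<otimes>\<^bsub>A\<^esub> y) = h x \<otimes>\<^bsub>B\<^esub> h y)}"

definition brace_isomorphic :: "('a, 'm) ring_scheme \<Rightarrow> ('b, 'n) ring_scheme \<Rightarrow> bool" where
  "brace_isomorphic A B \<longleftrightarrow> brace_iso A B \<noteq> {}"

definition C2 :: "int \<Rightarrow> int" where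
  "C2 n = n * (n - 1) div 2"

(* Lists serve as tuples, so that the braces on Z_p + Z_p + Z_q and those on Z_{p^2} + Z_q have
   the same HOL type. Residues are the representatives {0..<n}. Powers are integer powers in
   Z_q; negative exponents refer to the inverse of a unit of Z_q. Under the stated conditions on
   \<omega> and \<mu> (and p odd) the results do not depend on the representatives of the exponents. *)

(* intended for units \<omega>, \<mu> of Z_q with \<omega>^p = \<mu>^p = 1 *)
definition T_ppq :: "nat \<Rightarrow> nat \<Rightarrow> int \<Rightarrow> int \<Rightarrow> int list ring" where
  "T_ppq p q \<omega> \<mu> =
     (let Zp = residue_ring (int p); Zq = residue_ring (int q) in
      (RDirProd_list [Zp, Zp, Zq])
        \<lparr>mult := \<lambda>u v. let x1 = u ! 0; y1 = u ! 1; a2 = v ! 2 in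
           [0, 0, (\<omega> [^]\<^bsub>Zq\<^esub> x1 \<otimes>\<^bsub>Zq\<^esub> \<mu> [^]\<^bsub>Zq\<^esub> y1 \<ominus>\<^bsub>Zq\<^esub> \<one>\<^bsub>Zq\<^esub>) \<otimes>\<^bsub>Zq\<^esub> a2]\<rparr>)"

(* intended for units \<omega> of Z_q with \<omega>^(p^2) = 1 *)
definition T_p2q :: "nat \<Rightarrow> nat \<Rightarrow> int \<Rightarrow> int list ring" where
  "T_p2q p q \<omega> =
     (let Zp2 = residue_ring (int (p\<^sup>2)); Zq = residue_ring (int q) in
      (RDirProd_list [Zp2, Zq])
        \<lparr>mult := \<lambda>u v. let x1 = u ! 0; a2 = v ! 1 in
           [0, (\<omega> [^]\<^bsub>Zq\<^esub> x1 \<ominus>\<^bsub>Zq\<^esub> \<one>\<^bsub>Zq\<^esub>) \<otimes>\<^bsub>Zq\<^esub> a2]\<rparr>)"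

(* intended for units \<omega>, \<mu> of Z_q with \<omega>^p = \<mu>^p = 1 *)
definition B_ppq :: "nat \<Rightarrow> nat \<Rightarrow> int \<Rightarrow> int \<Rightarrow> int list ring" where
  "B_ppq p q \<omega> \<mu> =
     (let Zp = residue_ring (int p); Zq = residue_ring (int q) in
      (RDirProd_list [Zp, Zp, Zq])
        \<lparr>mult := \<lambda>u v. let x1 = u ! 0; y1 = u ! 1; y2 = v ! 1; a2 = v ! 2 in
           [y1 \<otimes>\<^bsub>Zp\<^esub> y2, 0,
            (\<omega> [^]\<^bsub>Zq\<^esub> (x1 - C2 y1) \<otimes>\<^bsub>Zq\<^esub> \<mu> [^]\<^bsub>Zq\<^esub> y1 \<ominus>\<^bsub>Zq\<^esub> \<one>\<^bsub>Zq\<^esub>) \<otimes>\<^bsub>Zq\<^esub> a2]\<rparr>)"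

(* intended for units \<omega> of Z_q with \<omega>^(p^2) = 1 *)
definition B_p2q :: "nat \<Rightarrow> nat \<Rightarrow> int \<Rightarrow> int list ring" where
  "B_p2q p q \<omega> =
     (let Zp2 = residue_ring (int (p\<^sup>2)); Zq = residue_ring (int q) in
      (RDirProd_list [Zp2, Zq])
        \<lparr>mult := \<lambda>u v. let x1 = u ! 0; x2 = v ! 0; a2 = v ! 1 in
           [int p \<otimes>\<^bsub>Zp2\<^esub> x1 \<otimes>\<^bsub>Zp2\<^esub> x2,
            (\<omega> [^]\<^bsub>Zq\<^esub> (x1 - int p * C2 x1) \<ominus>\<^bsub>Zq\<^esub> \<one>\<^bsub>Zq\<^esub>) \<otimes>\<^bsub>Zq\<^esub> a2]\<rparr>)"

definition primitive_root_mod :: "nat \<Rightarrow> nat \<Rightarrow> int \<Rightarrow> bool" where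
  "primitive_root_mod n q \<omega> \<longleftrightarrow>
     \<omega> \<in> Units (residue_ring (int q)) \<and> group.ord (units_of (residue_ring (int q))) \<omega> = n"

definition quadratic_nonresidue :: "nat \<Rightarrow> int \<Rightarrow> bool" where
  "quadratic_nonresidue p \<eta> \<longleftrightarrow>
     \<eta> \<in> Units (residue_ring (int p)) \<and> \<not> QuadRes (int p) \<eta>"

definition named_braces :: "nat \<Rightarrow> nat \<Rightarrow> int \<Rightarrow> int \<Rightarrow> int \<Rightarrow> int list ring list" where
  "named_braces p q \<omega> \<eta> \<omega>t =
     (let Zq = residue_ring (int q) in
      [T_ppq p q 1 1, T_p2q p q 1, B_ppq p q 1 1, B_p2q p q 1]
      @ (if p dvd q - 1 then
           [T_ppq p q \<omega> 1, T_p2q p q \<omega>,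
            B_ppq p q 1 \<omega>, B_ppq p q \<omega> 1, B_ppq p q (\<omega> [^]\<^bsub>Zq\<^esub> \<eta>) 1]
           @ map (\<lambda>i. B_p2q p q (\<omega> [^]\<^bsub>Zq\<^esub> i)) [1..<p]
         else [])
      @ (if p\<^sup>2 dvd q - 1 then
           T_p2q p q \<omega>t # map (\<lambda>i. B_p2q p q (\<omega>t [^]\<^bsub>Zq\<^esub> i)) [1..<p]
         else []))"

end

theory Submission
  imports Defs
begin

text \<open>Let \<open>A\<close> be a brace of order \<open>p\<^sup>2 q\<close>. Counting fixed points modulo \<open>q\<close> shows that the Sylow
  \<open>q\<close>-subgroup of \<open>(A, +)\<close> acts trivially by \<open>\<lambda>\<close>, so \<open>A\<close> is determined by the brace \<open>P\<close> on the Sylow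
  \<open>p\<close>-subgroup and the character \<open>\<chi>\<close> of the circle group of \<open>P\<close> describing its action on \<open>Z_q\<close>; two such pairs
  give isomorphic braces iff an isomorphism of the braces \<open>P\<close> matches the characters. For a brace of order
  \<open>p\<^sup>2\<close> the fixed points \<open>F\<close> of \<open>\<lambda>\<close> are nontrivial and the product is a bilinear form on \<open>P/F\<close> with values
  in \<open>F\<close>, which leaves four braces. It remains to find the orbits of their automorphism groups on characters.\<close>

section \<open>Isomorphisms of braces\<close>

text \<open>The circle groups of the braces of order p^2 can be written down explicitly. As p is
  odd, \<open>C2\<close> is well defined modulo p, and as \<open>C2 (m + n)\<close> exceeds
  \<open>C2 m + C2 n\<close> by \<open>m * n\<close>, subtracting a multiple of \<open>C2\<close>
  from a coordinate turns the circle operation into addition. So these groups are Z_{p^2} and Z_p^2,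
  just as for the zero product, and the exponents x - p C2(x) and x - C2(y) of the named braces are
  coordinates on them. A character is then one p^2-th root of unity or a pair of p-th roots. The
  automorphisms explain the list. With zero product every unit, or every invertible matrix, is
  allowed, and only the order of the character survives. On Z_{p^2} with product p x y only units u
  = 1 modulo p remain, so the exponent of the root is an invariant modulo p: p - 1 classes for each
  nontrivial order. On Z_p^2 with product (y y', 0) the matrices have rows (d^2, b) and (0, d): b
  removes the second root whenever the first is nontrivial, and the exponent of the first matters
  only up to squares, whence the nonresidue.\<close>

lemma brace_isoI:
  assumes "bij_betw h (carrier A) (carrier B)"
    and "\<And>x y. \<lbrakk>x \<in> carrier A; y \<in> carrier A\<rbrakk> \<Longrightarrow> h (x \<oplus>\<^bsub>A\<^esub> y) = h x \<oplus>\<^bsub>B\<^esub> h y"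
    and "\<And>x y. \<lbrakk>x \<in> carrier A; y \<in> carrier A\<rbrakk> \<Longrightarrow> h (x \<otimes>\<^bsub>A\<^esub> y) = h x \<otimes>\<^bsub>B\<^esub> h y"
  shows "h \<in> brace_iso A B"
  using assms by (simp add: brace_iso_def)

lemma brace_isoD:
  assumes "h \<in> brace_iso A B"
  shows "bij_betw h (carrier A) (carrier B)"
    and "\<And>x y. \<lbrakk>x \<in> carrier A; y \<in> carrier A\<rbrakk> \<Longrightarrow> h (x \<oplus>\<^bsub>A\<^esub> y) = h x \<oplus>\<^bsub>B\<^esub> h y"
    and "\<And>x y. \<lbrakk>x \<in> carrier A; y \<in> carrier A\<rbrakk> \<Longrightarrow> h (x \<otimes>\<^bsub>A\<^esub> y) = h x \<otimes>\<^bsub>B\<^esub> h y"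
    and "\<And>x. x \<in> carrier A \<Longrightarrow> h x \<in> carrier B"
  using assms by (auto simp: brace_iso_def bij_betw_def)

lemma brace_iso_inv:
  assumes "brace A" "h \<in> brace_iso A B"
  shows "inv_into (carrier A) h \<in> brace_iso B A"
proof -
  interpret A: brace A by fact
  note h = brace_isoD[OF assms(2)]
  let ?g = "inv_into (carrier A) h"
  have inv: "?g (h x) = x" if "x \<in> carrier A" for x
    using h(1) that by (simp add: bij_betw_def)
  have ex: "\<exists>x \<in> carrier A. y = h x" if "y \<in> carrier B" for y
    using h(1) that by (auto simp: bij_betw_def)
  show ?thesis
  proof (rule brace_isoI)
    show "bij_betw ?g (carrier B) (carrier A)" using h(1) by (rule bij_betw_inv_into)
  next
    fix u v assume "u \<in> carrier B" "v \<in> carrier B"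
    then obtain x y where xy: "x \<in> carrier A" "y \<in> carrier A" "u = h x" "v = h y"
      using ex by blast
    show "?g (u \<oplus>\<^bsub>B\<^esub> v) = ?g u \<oplus>\<^bsub>A\<^esub> ?g v"
      using xy by (simp add: inv flip: h(2))
    show "?g (u \<otimes>\<^bsub>B\<^esub> v) = ?g u \<otimes>\<^bsub>A\<^esub> ?g v"
      using xy by (simp add: inv A.mult_closed flip: h(3))
  qed
qed

lemma brace_iso_comp:
  assumes "h \<in> brace_iso A B" "k \<in> brace_iso B C"
  shows "k \<circ> h \<in> brace_iso A C"
  using brace_isoD[OF assms(1)] brace_isoD[OF assms(2)]
  by (intro brace_isoI) (auto intro: bij_betw_trans)

lemma brace_isomorphicI: "h \<in> brace_iso A B \<Longrightarrow> brace_isomorphic A B"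
  by (auto simp: brace_isomorphic_def)

lemma brace_isomorphic_sym: "brace A \<Longrightarrow> brace_isomorphic A B \<Longrightarrow> brace_isomorphic B A"
  using brace_iso_inv by (fastforce simp: brace_isomorphic_def)

lemma brace_isomorphic_trans:
  "brace_isomorphic A B \<Longrightarrow> brace_isomorphic B C \<Longrightarrow> brace_isomorphic A C"
  using brace_iso_comp by (fastforce simp: brace_isomorphic_def)

lemma brace_isomorphic_order: "brace_isomorphic A B \<Longrightarrow> order A = order B"
  by (auto simp: brace_isomorphic_def order_def dest: brace_isoD(1) bij_betw_same_card)

lemma brace_iso_zero:
  assumes "brace A" "brace B" "h \<in> brace_iso A B"
  shows "h \<zero>\<^bsub>A\<^esub> = \<zero>\<^bsub>B\<^esub>"
proof -
  interpret A: brace A by fact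
  interpret B: brace B by fact
  note h = brace_isoD[OF assms(3)]
  have "h \<zero>\<^bsub>A\<^esub> \<oplus>\<^bsub>B\<^esub> h \<zero>\<^bsub>A\<^esub> = h \<zero>\<^bsub>A\<^esub>"
    using h(2)[of "\<zero>\<^bsub>A\<^esub>" "\<zero>\<^bsub>A\<^esub>"] by simp
  then show ?thesis using h(4)[of "\<zero>\<^bsub>A\<^esub>"] B.add.r_cancel_one'[of "h \<zero>\<^bsub>A\<^esub>" "h \<zero>\<^bsub>A\<^esub>"] by simp
qed

text \<open>The named braces inherit their axioms from extensions in this way. Preservation of zero
  is assumed separately: it does not follow from \<open>brace_iso\<close> as long as
  \<open>A\<close> is not known to be a group.\<close>

lemma brace_transport:
  assumes "brace B" "h \<in> brace_iso B A" "h \<zero>\<^bsub>B\<^esub> = \<zero>\<^bsub>A\<^esub>"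
  shows "brace A"
proof -
  interpret B: brace B by fact
  note h = brace_isoD[OF assms(2)]
  have ex: "\<exists>x \<in> carrier B. u = h x" if "u \<in> carrier A" for u
    using h(1) that by (auto simp: bij_betw_def)
  note hs = h(2,3)[symmetric] h(4) B.mult_closed
  have ab: "abelian_group A"
  proof (rule abelian_groupI)
    fix u assume "u \<in> carrier A"
    then obtain x where x: "x \<in> carrier B" "u = h x" using ex by blast
    show "\<exists>v \<in> carrier A. v \<oplus>\<^bsub>A\<^esub> u = \<zero>\<^bsub>A\<^esub>"
      by (rule bexI[of _ "h (\<ominus>\<^bsub>B\<^esub> x)"]) (use x in \<open>simp_all add: hs B.l_neg assms(3)\<close>)
    show "\<zero>\<^bsub>A\<^esub> \<oplus>\<^bsub>A\<^esub> u = u" using x by (simp add: hs flip: assms(3))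
    fix v assume "v \<in> carrier A"
    then obtain y where y: "y \<in> carrier B" "v = h y" using ex by blast
    show "u \<oplus>\<^bsub>A\<^esub> v \<in> carrier A" "u \<oplus>\<^bsub>A\<^esub> v = v \<oplus>\<^bsub>A\<^esub> u"
      using x y by (simp_all add: hs B.a_comm)
    fix w assume "w \<in> carrier A"
    then obtain z where z: "z \<in> carrier B" "w = h z" using ex by blast
    show "u \<oplus>\<^bsub>A\<^esub> v \<oplus>\<^bsub>A\<^esub> w = u \<oplus>\<^bsub>A\<^esub> (v \<oplus>\<^bsub>A\<^esub> w)"
      using x y z by (simp add: hs B.a_assoc)
  qed (use assms(3) h(4)[of "\<zero>\<^bsub>B\<^esub>"] in simp)
  show ?thesis
  proof (intro brace.intro ab brace_axioms.intro)
    show "finite (carrier A)" using h(1) B.finite_carrier by (simp add: bij_betw_finite)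
  next
    fix u assume u: "u \<in> carrier A"
    then obtain x where x: "x \<in> carrier B" "u = h x" using ex by blast
    have "bij_betw (h \<circ> (\<lambda>y. x \<otimes>\<^bsub>B\<^esub> y \<oplus>\<^bsub>B\<^esub> y)) (carrier B) (carrier A)"
      using B.lambda_bij[OF x(1)] h(1) by (rule bij_betw_trans)
    then have "bij_betw ((\<lambda>v. u \<otimes>\<^bsub>A\<^esub> v \<oplus>\<^bsub>A\<^esub> v) \<circ> h) (carrier B) (carrier A)"
      by (rule bij_betw_cong[THEN iffD1, rotated]) (use x in \<open>simp add: hs\<close>)
    then show "bij_betw (\<lambda>v. u \<otimes>\<^bsub>A\<^esub> v \<oplus>\<^bsub>A\<^esub> v) (carrier A) (carrier A)"
      using h(1) bij_betw_comp_iff by blast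
    fix v assume "v \<in> carrier A"
    then obtain y where y: "y \<in> carrier B" "v = h y" using ex by blast
    show "u \<otimes>\<^bsub>A\<^esub> v \<in> carrier A" using x y by (simp add: hs)
    fix w assume "w \<in> carrier A"
    then obtain z where z: "z \<in> carrier B" "w = h z" using ex by blast
    show "u \<otimes>\<^bsub>A\<^esub> (v \<oplus>\<^bsub>A\<^esub> w) = u \<otimes>\<^bsub>A\<^esub> v \<oplus>\<^bsub>A\<^esub> u \<otimes>\<^bsub>A\<^esub> w"
      using x y z by (simp add: hs B.left_distrib)
    show "(u \<otimes>\<^bsub>A\<^esub> v \<oplus>\<^bsub>A\<^esub> u \<oplus>\<^bsub>A\<^esub> v) \<otimes>\<^bsub>A\<^esub> w = u \<otimes>\<^bsub>A\<^esub> (v \<otimes>\<^bsub>A\<^esub> w) \<oplus>\<^bsub>A\<^esub> u \<otimes>\<^bsub>A\<^esub> w \<oplus>\<^bsub>A\<^esub> v \<otimes>\<^bsub>A\<^esub> w"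
      using x y z by (simp add: hs B.circle_mult)
  qed
qed

section \<open>The circle group and its action\<close>

text \<open>The operation of the second group carried by a brace; that group acts on the additive
  group through \<open>lam\<close>.\<close>

definition circle :: "('a, 'm) ring_scheme \<Rightarrow> 'a \<Rightarrow> 'a \<Rightarrow> 'a" where
  "circle A x y = x \<otimes>\<^bsub>A\<^esub> y \<oplus>\<^bsub>A\<^esub> x \<oplus>\<^bsub>A\<^esub> y"

definition lam :: "('a, 'm) ring_scheme \<Rightarrow> 'a \<Rightarrow> 'a \<Rightarrow> 'a" where
  "lam A x y = x \<otimes>\<^bsub>A\<^esub> y \<oplus>\<^bsub>A\<^esub> y"

text \<open>The carrier is a parameter so that a Sylow subgroup can act by itself.\<close>

definition circle_group :: "('a, 'm) ring_scheme \<Rightarrow> 'a set \<Rightarrow> 'a monoid" where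
  "circle_group A H = \<lparr>carrier = H, monoid.mult = circle A, one = \<zero>\<^bsub>A\<^esub>\<rparr>"

context brace
begin

lemma circle_closed: "x \<in> carrier A \<Longrightarrow> y \<in> carrier A \<Longrightarrow> circle A x y \<in> carrier A"
  by (simp add: circle_def mult_closed)

lemma lam_closed: "x \<in> carrier A \<Longrightarrow> y \<in> carrier A \<Longrightarrow> lam A x y \<in> carrier A"
  by (simp add: lam_def mult_closed)

lemma circle_lam: "x \<in> carrier A \<Longrightarrow> y \<in> carrier A \<Longrightarrow> circle A x y = x \<oplus> lam A x y"
  by (simp add: circle_def lam_def mult_closed a_ac)

lemma mult_zero: assumes "x \<in> carrier A" shows "x \<otimes> \<zero> = \<zero>"
proof -
  have "x \<otimes> \<zero> \<oplus> x \<otimes> \<zero> = x \<otimes> \<zero>"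
    using left_distrib[OF assms zero_closed zero_closed] by simp
  then show ?thesis using add.r_cancel_one'[of "x \<otimes> \<zero>" "x \<otimes> \<zero>"] assms by (simp add: mult_closed)
qed

lemma lam_zero: "x \<in> carrier A \<Longrightarrow> lam A x \<zero> = \<zero>"
  by (simp add: lam_def mult_zero)

lemma lam_add:
  "\<lbrakk>x \<in> carrier A; y \<in> carrier A; z \<in> carrier A\<rbrakk> \<Longrightarrow> lam A x (y \<oplus> z) = lam A x y \<oplus> lam A x z"
  by (simp add: lam_def left_distrib mult_closed a_ac)

text \<open>The axiom \<open>circle_mult\<close> in another form: adding the identity to left
  multiplication yields a homomorphism from the circle operation to composition of maps.\<close>

lemma lam_circle:
  assumes "x \<in> carrier A" "y \<in> carrier A" "z \<in> carrier A"
  shows "lam A (circle A x y) z = lam A x (lam A y z)"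
  using assms
  by (simp add: lam_def circle_def circle_mult left_distrib mult_closed) (simp add: mult_closed a_ac)

lemma lam_bij: "x \<in> carrier A \<Longrightarrow> bij_betw (lam A x) (carrier A) (carrier A)"
  using lambda_bij by (simp add: lam_def[abs_def])

lemma lam_inj: "\<lbrakk>lam A x y = lam A x z; x \<in> carrier A; y \<in> carrier A; z \<in> carrier A\<rbrakk> \<Longrightarrow> y = z"
  using lam_bij by (auto simp: bij_betw_def inj_on_def)

text \<open>The circle product of zero with itself is zero, so \<open>lam A \<zero>\<close> is
  idempotent; an injective idempotent map is the identity.\<close>

lemma lam_zero_left: "x \<in> carrier A \<Longrightarrow> lam A \<zero> x = x"
  using lam_circle[of \<zero> \<zero> x] lam_inj[of \<zero> "lam A \<zero> x" x]
  by (simp add: circle_lam lam_zero lam_closed)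

lemma zero_mult: "x \<in> carrier A \<Longrightarrow> \<zero> \<otimes> x = \<zero>"
  using lam_zero_left[of x] add.r_cancel_one[of x "\<zero> \<otimes> x"] by (simp add: lam_def mult_closed)

lemma circle_zero: "x \<in> carrier A \<Longrightarrow> circle A x \<zero> = x" "x \<in> carrier A \<Longrightarrow> circle A \<zero> x = x"
  by (simp_all add: circle_lam lam_zero lam_zero_left)

lemma lam_eq_iff: "\<lbrakk>x \<in> carrier A; y \<in> carrier A\<rbrakk> \<Longrightarrow> lam A x y = y \<longleftrightarrow> x \<otimes> y = \<zero>"
  using add.l_cancel_one[of y "x \<otimes> y"] add.r_cancel_one[of y "x \<otimes> y"] by (simp add: lam_def mult_closed)

lemma circle_assoc:
  assumes "x \<in> carrier A" "y \<in> carrier A" "z \<in> carrier A"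
  shows "circle A (circle A x y) z = circle A x (circle A y z)"
proof -
  have "circle A (circle A x y) z = x \<oplus> lam A x y \<oplus> lam A x (lam A y z)"
    using assms circle_lam[of "circle A x y" z] lam_circle[of x y z]
    by (simp add: circle_lam[of x y] lam_closed)
  also have "\<dots> = circle A x (circle A y z)"
    using assms by (simp add: circle_lam[of x] circle_closed circle_lam[of y] lam_add lam_closed a_assoc)
  finally show ?thesis .
qed

text \<open>A set stable under addition and all \<open>lam A x\<close> with \<open>x\<close> in it is closed under circle inverses
  because the restriction of \<open>lam A x\<close> to a finite set is onto.\<close>

lemma circle_group_subgroup:
  assumes H: "subgroup H (add_monoid A)" and lam: "\<And>x y. \<lbrakk>x \<in> H; y \<in> H\<rbrakk> \<Longrightarrow> lam A x y \<in> H"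
  shows "group (circle_group A H)"
proof -
  interpret H: subgroup H "add_monoid A" by fact
  have HA: "x \<in> carrier A" if "x \<in> H" for x using H.subset that by auto
  have cl: "circle A x y \<in> H" if "x \<in> H" "y \<in> H" for x y
    using that H.m_closed lam by (simp add: circle_lam HA)
  have onto: "lam A x ` H = H" if "x \<in> H" for x
  proof (rule endo_inj_surj)
    show "finite H" using finite_carrier HA by (meson finite_subset subsetI)
    show "inj_on (lam A x) H" using lam_inj HA that by (meson inj_onI)
  qed (use lam that in auto)
  have right: "\<exists>y \<in> H. circle A x y = \<zero>" if x: "x \<in> H" for x
  proof -
    have "\<ominus> x \<in> H" using H.m_inv_closed x by (simp add: a_inv_def)
    then obtain y where y: "y \<in> H" "lam A x y = \<ominus> x" using onto[OF x] by (metis imageE)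
    then show ?thesis using x by (auto simp: circle_lam HA r_neg intro!: bexI[of _ y])
  qed
  have z: "\<zero> \<in> H" using H.one_closed by simp
  show ?thesis
  proof (rule groupI; unfold circle_group_def; simp)
    fix x assume x: "x \<in> H"
    then obtain y where y: "y \<in> H" "circle A x y = \<zero>" using right by blast
    then obtain w where w: "w \<in> H" "circle A y w = \<zero>" using right by blast
    \<comment> \<open>\<open>groupI\<close> asks for a left inverse: the right inverse
      \<open>y\<close> of \<open>x\<close> has itself a right inverse \<open>w\<close>, and
      associativity forces \<open>w = x\<close>.\<close>
    have "x = circle A x (circle A y w)" by (simp only: w(2) circle_zero(1)[OF HA[OF x]])
    also have "\<dots> = w"
      by (simp only: circle_assoc[OF HA[OF x] HA[OF y(1)] HA[OF w(1)], symmetric] y(2) circle_zero(2)[OF HA[OF w(1)]])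
    finally show "\<exists>y \<in> H. circle A y x = \<zero>" using w y by blast
  qed (use z cl in \<open>simp_all add: circle_assoc circle_zero HA\<close>)
qed

lemma circle_group: "group (circle_group A (carrier A))"
  by (rule circle_group_subgroup[OF add.subgroup_self]) (simp add: lam_closed)

lemma lam_group_action:
  assumes H: "subgroup H (add_monoid A)" "\<And>x y. \<lbrakk>x \<in> H; y \<in> H\<rbrakk> \<Longrightarrow> lam A x y \<in> H"
    and Y: "Y \<subseteq> carrier A" "\<And>x y. x \<in> H \<Longrightarrow> y \<in> Y \<Longrightarrow> lam A x y \<in> Y"
  shows "group_action (circle_group A H) Y (\<lambda>x. \<lambda>y\<in>Y. lam A x y)"
proof -
  interpret H: subgroup H "add_monoid A" by fact
  have HA: "x \<in> carrier A" if "x \<in> H" for x using H.subset that by auto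
  have XA: "x \<in> carrier A" if "x \<in> Y" for x using Y that by auto
  \<comment> \<open>The maps are restricted to \<open>Y\<close> because elements of
    \<open>BijGroup\<close> are extensional.\<close>
  have bij: "bij_betw (\<lambda>y\<in>Y. lam A x y) Y Y" if "x \<in> H" for x
  proof -
    have "inj_on (lam A x) Y" using lam_inj HA[OF that] XA by (meson inj_onI)
    moreover have "lam A x ` Y = Y"
      by (rule endo_inj_surj)
         (use that Y finite_carrier calculation in \<open>auto intro: finite_subset\<close>)
    ultimately have "bij_betw (lam A x) Y Y" by (simp add: bij_betw_def)
    then show ?thesis by (rule bij_betw_cong[THEN iffD1, rotated]) simp
  qed
  show ?thesis
    unfolding group_action_def group_hom_def group_hom_axioms_def
  proof (intro conjI circle_group_subgroup[OF H] group_BijGroup homI)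
    fix x assume "x \<in> carrier (circle_group A H)"
    then show "(\<lambda>y\<in>Y. lam A x y) \<in> carrier (BijGroup Y)"
      using bij by (simp add: BijGroup_def Bij_def circle_group_def)
    fix x' assume x': "x' \<in> carrier (circle_group A H)"
    show "(\<lambda>y\<in>Y. lam A (x \<otimes>\<^bsub>circle_group A H\<^esub> x') y) =
       (\<lambda>y\<in>Y. lam A x y) \<otimes>\<^bsub>BijGroup Y\<^esub> (\<lambda>y\<in>Y. lam A x' y)"
      using bij \<open>x \<in> _\<close> x' Y(2)
      by (auto simp: BijGroup_def Bij_def circle_group_def compose_def lam_circle HA XA fun_eq_iff)
  qed
qed

end

text \<open>Class equation: the orbits that are not fixed points have a size divisible by \<open>r\<close>.\<close>

lemma (in group_action) card_fixed_points_cong: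
  assumes r: "Factorial_Ring.prime r" "order G = r ^ n" and fin: "finite E"
  shows "[card {x \<in> E. \<forall>g \<in> carrier G. \<phi> g x = x} = card E] (mod r)"
proof -
  let ?F = "{x \<in> E. \<forall>g \<in> carrier G. \<phi> g x = x}"
  interpret group G using group_hom by (simp add: group_hom_def)
  have sub: "C \<subseteq> E" if "C \<in> orbits G E \<phi>" for C
    using orbit_partition that by (auto simp: partition_def)
  have part: "\<Union> (orbits G E \<phi>) = E"
    by (rule orbits_coverture)
  have disj: "pairwise disjnt (orbits G E \<phi>)"
    using disjoint_union by (fastforce simp: pairwise_def disjnt_def)
  have orb: "orbit G \<phi> x = {x}" if "x \<in> ?F" for x
    using that orbit_refl[of x] by (auto simp: orbit_def)
  have rdvd: "r dvd card C" if C: "C \<in> orbits G E \<phi> - (\<lambda>x. {x}) ` ?F" for C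
  proof -
    obtain x where x: "x \<in> E" "C = orbit G \<phi> x" using C by (auto simp: orbits_def)
    have "card C dvd r ^ n" using orbit_stabilizer_theorem[OF x(1)] x(2) r(2) by (metis dvd_triv_left)
    then obtain k where k: "card C = r ^ k" using r(1) by (auto simp: divides_primepow_nat)
    have "card C \<noteq> 1"
    proof
      assume "card C = 1"
      then obtain c where "C = {c}" by (rule card_1_singletonE)
      moreover have "x \<in> C" using x orbit_refl by simp
      ultimately have "C = {x}" by auto
      then have "x \<in> ?F" using x by (auto simp: orbit_def)
      then show False using C \<open>C = {x}\<close> by auto
    qed
    then show ?thesis using k by (cases k) auto
  qed
  have "card E = (\<Sum>C \<in> orbits G E \<phi>. card C)"
    using card_Union_disjoint[OF disj] part fin sub by (auto intro: finite_subset)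
  also have "finite (orbits G E \<phi>)" using sub fin by (meson Pow_iff finite_Pow_iff finite_subset subsetI)
  then have "(\<Sum>C \<in> orbits G E \<phi>. card C) = (\<Sum>C \<in> orbits G E \<phi> - (\<lambda>x. {x}) ` ?F. card C) + (\<Sum>C \<in> (\<lambda>x. {x}) ` ?F. card C)"
    by (rule sum.subset_diff[rotated]) (use orb in \<open>auto simp: orbits_def\<close>)
  also have "(\<Sum>C \<in> (\<lambda>x. {x}) ` ?F. card C) = card ?F"
    by (subst sum.reindex) (auto simp: inj_on_def)
  finally have "card E = (\<Sum>C \<in> orbits G E \<phi> - (\<lambda>x. {x}) ` ?F. card C) + card ?F" .
  moreover have "r dvd (\<Sum>C \<in> orbits G E \<phi> - (\<lambda>x. {x}) ` ?F. card C)"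
    by (rule dvd_sum) (rule rdvd)
  ultimately show ?thesis by (simp add: cong_iff_dvd_diff cong_sym_eq cong_def mod_add_left_eq[symmetric] del: mod_add_left_eq)
qed

section \<open>Integer multiples and coprime torsion\<close>

lemma add_hom_int_pow:
  fixes n :: int
  assumes "abelian_group A" "abelian_group B" "x \<in> carrier A"
    and "\<And>x. x \<in> carrier A \<Longrightarrow> f x \<in> carrier B"
    and "\<And>x y. \<lbrakk>x \<in> carrier A; y \<in> carrier A\<rbrakk> \<Longrightarrow> f (x \<oplus>\<^bsub>A\<^esub> y) = f x \<oplus>\<^bsub>B\<^esub> f y"
  shows "f ([n] \<cdot>\<^bsub>A\<^esub> x) = [n] \<cdot>\<^bsub>B\<^esub> f x"
  unfolding add_pow_def
  by (rule hom_int_pow)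
     (use assms in \<open>auto intro: homI abelian_group.a_group\<close>)

lemma brace_iso_int_pow:
  fixes n :: int
  assumes "brace A" "brace B" "h \<in> brace_iso A B" "x \<in> carrier A"
  shows "h ([n] \<cdot>\<^bsub>A\<^esub> x) = [n] \<cdot>\<^bsub>B\<^esub> h x"
  using assms by (intro add_hom_int_pow) (auto simp: brace_isoD brace_def)

lemma (in brace) mult_int_pow:
  fixes n :: int
  assumes "x \<in> carrier A" "y \<in> carrier A"
  shows "x \<otimes> ([n] \<cdot> y) = [n] \<cdot> (x \<otimes> y)"
  using assms abelian_group_axioms by (intro add_hom_int_pow) (auto simp: mult_closed left_distrib)

lemma (in brace) lam_int_pow:
  fixes n :: int
  assumes "x \<in> carrier A" "y \<in> carrier A"
  shows "lam A x ([n] \<cdot> y) = [n] \<cdot> lam A x y"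
  using assms abelian_group_axioms by (intro add_hom_int_pow) (auto simp: lam_closed lam_add)

text \<open>Turns two decompositions of one element along two subgroups into an element common to
  both subgroups.\<close>

lemma (in abelian_group) add_eq_swap:
  assumes "a \<oplus> b = c \<oplus> d" "a \<in> carrier G" "b \<in> carrier G" "c \<in> carrier G" "d \<in> carrier G"
  shows "b \<oplus> \<ominus> d = c \<oplus> \<ominus> a"
proof -
  have "b \<oplus> \<ominus> d = \<ominus> a \<oplus> (a \<oplus> b) \<oplus> \<ominus> d"
    by (simp only: r_neg1[OF assms(2,3)])
  also have "\<dots> = \<ominus> a \<oplus> (c \<oplus> d) \<oplus> \<ominus> d" using assms(1) by simp
  also have "\<dots> = \<ominus> a \<oplus> c" using assms by (simp add: a_assoc r_neg)
  finally show ?thesis using assms by (simp add: a_comm)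
qed

lemma (in abelian_group) torsion_coprime:
  fixes m n :: int
  assumes "x \<in> carrier G" "[m] \<cdot> x = \<zero>" "[n] \<cdot> x = \<zero>" "coprime m n"
  shows "x = \<zero>"
proof -
  have "int (add.ord x) dvd m" "int (add.ord x) dvd n"
    using assms(1-3) add.int_pow_eq[of x m 0] add.int_pow_eq[of x n 0]
    by (simp_all add: add_pow_def)
  then have "is_unit (int (add.ord x))" using assms(4) coprime_common_divisor by blast
  then show ?thesis using add.ord_eq_1[OF assms(1)] by simp
qed

section \<open>Extension of a brace by a character\<close>

text \<open>Homomorphisms from the circle group to the units modulo q, with values given as
  representatives; \<open>brace_char_iff_U\<close> restates this in the group of units.\<close>

definition brace_char :: "('a, 'm) ring_scheme \<Rightarrow> nat \<Rightarrow> ('a \<Rightarrow> int) \<Rightarrow> bool" where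
  "brace_char P q \<chi> \<longleftrightarrow> (\<forall>x \<in> carrier P. 0 < \<chi> x \<and> \<chi> x < int q) \<and>
     (\<forall>x \<in> carrier P. \<forall>y \<in> carrier P. \<chi> (circle P x y) = \<chi> x * \<chi> y mod int q)"

text \<open>The factor \<open>\<chi> (fst u) - 1\<close> makes \<open>lam\<close> act on the second
  component as multiplication by \<open>\<chi> (fst u)\<close>. The circle group is therefore a
  semidirect product of Z_q with that of \<open>P\<close>.\<close>

definition brace_ext :: "('a, 'm) ring_scheme \<Rightarrow> nat \<Rightarrow> ('a \<Rightarrow> int) \<Rightarrow> ('a \<times> int) ring" where
  "brace_ext P q \<chi> = \<lparr>carrier = carrier P \<times> {0..<int q},
     monoid.mult = \<lambda>u v. (fst u \<otimes>\<^bsub>P\<^esub> fst v, (\<chi> (fst u) - 1) * snd v mod int q),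
     one = (\<zero>\<^bsub>P\<^esub>, 0), ring.zero = (\<zero>\<^bsub>P\<^esub>, 0),
     ring.add = \<lambda>u v. (fst u \<oplus>\<^bsub>P\<^esub> fst v, (snd u + snd v) mod int q)\<rparr>"

lemma brace_ext_simps [simp]:
  "carrier (brace_ext P q \<chi>) = carrier P \<times> {0..<int q}"
  "(x, a) \<otimes>\<^bsub>brace_ext P q \<chi>\<^esub> (y, b) = (x \<otimes>\<^bsub>P\<^esub> y, (\<chi> x - 1) * b mod int q)"
  "(x, a) \<oplus>\<^bsub>brace_ext P q \<chi>\<^esub> (y, b) = (x \<oplus>\<^bsub>P\<^esub> y, (a + b) mod int q)"
  "\<zero>\<^bsub>brace_ext P q \<chi>\<^esub> = (\<zero>\<^bsub>P\<^esub>, 0)"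
  by (simp_all add: brace_ext_def)

lemma order_brace_ext: "order (brace_ext P q \<chi>) = order P * q"
  by (simp add: order_def card_cartesian_product)

lemma brace_charD:
  assumes "brace_char P q \<chi>" "x \<in> carrier P"
  shows "0 < \<chi> x" "\<chi> x < int q"
    "y \<in> carrier P \<Longrightarrow> \<chi> (circle P x y) = \<chi> x * \<chi> y mod int q"
  using assms by (auto simp: brace_char_def)

lemma prime_coprime_int:
  "Factorial_Ring.prime (q :: nat) \<Longrightarrow> 0 < c \<Longrightarrow> c < int q \<Longrightarrow> coprime c (int q)"
  using prime_imp_coprime[of "int q" c] zdvd_not_zless[of c "int q"] by (auto simp: coprime_commute)

lemma mod_cancel:
  fixes a b c :: int
  assumes "Factorial_Ring.prime q" "0 < c" "c < int q" "c * a mod int q = c * b mod int q"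
    "0 \<le> a" "a < int q" "0 \<le> b" "b < int q"
  shows "a = b"
proof -
  have "[c * a = c * b] (mod int q)" using assms(4) by (simp add: cong_def)
  then have "[a = b] (mod int q)"
    using prime_coprime_int[OF assms(1-3)] by (simp add: cong_mult_lcancel)
  then show ?thesis using assms(5-8) by (simp add: cong_def)
qed

lemma brace_brace_ext:
  assumes P: "brace P" and q: "Factorial_Ring.prime q" and chi: "brace_char P q \<chi>"
  shows "brace (brace_ext P q \<chi>)"
proof -
  interpret P: brace P by fact
  let ?E = "brace_ext P q \<chi>"
  have q0: "0 < int q" using q by (simp add: prime_gt_0_nat)
  note c = brace_charD[OF chi]
  have ab: "abelian_group ?E"
  proof (rule abelian_groupI)
    fix u assume u: "u \<in> carrier ?E"
    show "\<exists>v\<in>carrier ?E. v \<oplus>\<^bsub>?E\<^esub> u = \<zero>\<^bsub>?E\<^esub>"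
      by (rule bexI[of _ "(\<ominus>\<^bsub>P\<^esub> fst u, (- snd u) mod int q)"])
         (use u q0 in \<open>auto simp: P.l_neg mod_simps\<close>)
    fix v assume v: "v \<in> carrier ?E"
    show "u \<oplus>\<^bsub>?E\<^esub> v = v \<oplus>\<^bsub>?E\<^esub> u"
      using u v by (auto simp: P.a_comm add.commute)
  qed (use q0 in \<open>auto simp: P.a_assoc mod_simps add.assoc\<close>)
  show ?thesis
  proof (intro brace.intro ab brace_axioms.intro)
    fix u assume "u \<in> carrier ?E"
    then obtain x a where u: "u = (x, a)" "x \<in> carrier P" by auto
    have lamE: "(\<lambda>v. u \<otimes>\<^bsub>?E\<^esub> v \<oplus>\<^bsub>?E\<^esub> v) = (\<lambda>(y, b). (lam P x y, \<chi> x * b mod int q))"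
      by (auto simp: fun_eq_iff u lam_def mod_simps left_diff_distrib)
    show "bij_betw (\<lambda>v. u \<otimes>\<^bsub>?E\<^esub> v \<oplus>\<^bsub>?E\<^esub> v) (carrier ?E) (carrier ?E)"
      unfolding lamE bij_betw_def
    proof
      show inj: "inj_on (\<lambda>(y, b). (lam P x y, \<chi> x * b mod int q)) (carrier ?E)"
      proof (rule inj_onI; clarsimp)
        fix y b z d assume *: "y \<in> carrier P" "z \<in> carrier P" "0 \<le> b" "b < int q" "0 \<le> d" "d < int q"
          "lam P x y = lam P x z" "\<chi> x * b mod int q = \<chi> x * d mod int q"
        show "y = z \<and> b = d"
          using P.lam_inj[OF *(7) u(2) *(1,2)] mod_cancel[OF q c(1,2)[OF u(2)] *(8) *(3-6)] by simp
      qed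
      show "(\<lambda>(y, b). (lam P x y, \<chi> x * b mod int q)) ` carrier ?E = carrier ?E"
        by (rule endo_inj_surj[OF _ _ inj])
           (use P.finite_carrier P.lam_closed u q0 in auto)
    qed
  next
    fix u v w assume "u \<in> carrier ?E" "v \<in> carrier ?E" "w \<in> carrier ?E"
    then obtain x a y b z d where *: "u = (x, a)" "x \<in> carrier P" "v = (y, b)" "y \<in> carrier P"
      "w = (z, d)" "z \<in> carrier P" by auto
    show "(u \<otimes>\<^bsub>?E\<^esub> v \<oplus>\<^bsub>?E\<^esub> u \<oplus>\<^bsub>?E\<^esub> v) \<otimes>\<^bsub>?E\<^esub> w =
      u \<otimes>\<^bsub>?E\<^esub> (v \<otimes>\<^bsub>?E\<^esub> w) \<oplus>\<^bsub>?E\<^esub> u \<otimes>\<^bsub>?E\<^esub> w \<oplus>\<^bsub>?E\<^esub> v \<otimes>\<^bsub>?E\<^esub> w"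
    proof -
      \<comment> \<open>In the second component the circle axiom is the identity st - 1 = (s - 1)(t
        - 1) + (s - 1) + (t - 1) for the values s, t of the character.\<close>
      have "(\<chi> (circle P x y) - 1) * d mod int q = (\<chi> x * \<chi> y - 1) * d mod int q"
        unfolding c(3)[OF *(2,4)] by (metis mod_diff_left_eq mod_mult_left_eq)
      also have "\<dots> = ((\<chi> x - 1) * ((\<chi> y - 1) * d) + (\<chi> x - 1) * d + (\<chi> y - 1) * d) mod int q"
        by (simp add: algebra_simps)
      finally show ?thesis using * by (simp add: P.circle_mult[folded circle_def] mod_simps flip: circle_def)
    qed
  next
   show "finite (carrier ?E)" using P.finite_carrier by simp
  next
   fix u v assume "u \<in> carrier ?E" "v \<in> carrier ?E" then show "u \<otimes>\<^bsub>?E\<^esub> v \<in> carrier ?E" using q0 by (auto simp: P.mult_closed)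
  next
    fix u v w assume "u \<in> carrier ?E" "v \<in> carrier ?E" "w \<in> carrier ?E"
    then show "u \<otimes>\<^bsub>?E\<^esub> (v \<oplus>\<^bsub>?E\<^esub> w) = u \<otimes>\<^bsub>?E\<^esub> v \<oplus>\<^bsub>?E\<^esub> u \<otimes>\<^bsub>?E\<^esub> w"
      by (auto simp: P.left_distrib mod_simps distrib_left)
  qed
qed

lemma brace_ext_int_pow:
  fixes n :: int
  assumes P: "brace P" and q: "Factorial_Ring.prime q" and chi: "brace_char P q \<chi>"
    and x: "x \<in> carrier P" "0 \<le> a" "a < int q"
  shows "[n] \<cdot>\<^bsub>brace_ext P q \<chi>\<^esub> (x, a) = ([n] \<cdot>\<^bsub>P\<^esub> x, n * a mod int q)"
proof -
  let ?E = "brace_ext P q \<chi>"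
  interpret P: brace P by fact
  interpret E: brace ?E by (rule brace_brace_ext[OF P q chi])
  have xa: "(x, a) \<in> carrier ?E" using x by simp
  show ?thesis
  proof (induction n rule: int_induct[of _ 0])
    case base
    then show ?case by (simp add: add_pow_def)
  next
    case (step1 i)
    then show ?case using x xa by (simp add: P.add.int_pow_mult E.add.int_pow_mult mod_simps algebra_simps)
  next
    case (step2 i)
    have "[(i - 1)] \<cdot>\<^bsub>?E\<^esub> (x, a) \<oplus>\<^bsub>?E\<^esub> (x, a) = [i] \<cdot>\<^bsub>?E\<^esub> (x, a)"
      using E.add.int_pow_mult[OF xa, of "i - 1" 1] xa by simp
    also have "\<dots> = ([(i - 1)] \<cdot>\<^bsub>P\<^esub> x, (i - 1) * a mod int q) \<oplus>\<^bsub>?E\<^esub> (x, a)"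
      using P.add.int_pow_mult[OF x(1), of "i - 1" 1] x(1) step2
      by (simp add: mod_simps algebra_simps)
    finally show ?case
      by (rule E.add.r_cancel)
         (use x xa prime_gt_0_nat[OF q] E.add.int_pow_closed[OF xa] in auto)
  qed
qed

lemma brace_ext_isoI:
  assumes "h \<in> brace_iso P P'" "\<And>x. x \<in> carrier P \<Longrightarrow> \<chi>' (h x) = \<chi> x"
  shows "map_prod h id \<in> brace_iso (brace_ext P q \<chi>) (brace_ext P' q \<chi>')"
  using brace_isoD[OF assms(1)] assms(2)
  by (intro brace_isoI) (auto intro: bij_betw_map_prod)

text \<open>An isomorphism of extensions respects the torsion decomposition; on the summand \<open>Z_q\<close> it is
  multiplication by a unit, which commutes with the action.\<close>

lemma brace_ext_isoE:
  assumes P: "brace P" "brace P'" and q: "Factorial_Ring.prime q" "coprime (order P) q"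
    and chi: "brace_char P q \<chi>" "brace_char P' q \<chi>'" and ord: "order P = order P'"
    and iso: "brace_isomorphic (brace_ext P q \<chi>) (brace_ext P' q \<chi>')"
  obtains h where "h \<in> brace_iso P P'" "\<And>x. x \<in> carrier P \<Longrightarrow> \<chi>' (h x) = \<chi> x"
proof -
  let ?E = "brace_ext P q \<chi>" and ?E' = "brace_ext P' q \<chi>'"
  interpret P: brace P by fact
  interpret P': brace P' by fact
  note E = brace_brace_ext[OF P(1) q(1) chi(1)] brace_brace_ext[OF P(2) q(1) chi(2)]
  interpret E: brace ?E by (rule E)
  interpret E': brace ?E' by (rule E)
  note pw = brace_ext_int_pow[OF P(1) q(1) chi(1)] brace_ext_int_pow[OF P(2) q(1) chi(2)]
  obtain H where H: "H \<in> brace_iso ?E ?E'" using iso by (auto simp: brace_isomorphic_def)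
  note h = brace_isoD[OF H]
  have H0: "H (\<zero>\<^bsub>P\<^esub>, 0) = (\<zero>\<^bsub>P'\<^esub>, 0)" using brace_iso_zero[OF E H] by simp
  note Hpw = brace_iso_int_pow[OF E H]
  have q1: "1 < int q" using q(1) prime_gt_1_nat by simp
  let ?N = "int (order P)"
  have Ntor: "[?N] \<cdot>\<^bsub>P\<^esub> x = \<zero>\<^bsub>P\<^esub>" if "x \<in> carrier P" for x
    using P.add.pow_order_eq_1[OF that] by (simp add: add_pow_def int_pow_int order_def)
  have Ntor': "[?N] \<cdot>\<^bsub>P'\<^esub> x = \<zero>\<^bsub>P'\<^esub>" if "x \<in> carrier P'" for x
    using P'.add.pow_order_eq_1[OF that] unfolding ord by (simp add: add_pow_def int_pow_int order_def)
  define f where "f x = fst (H (x, 0))" for x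
  have f: "H (x, 0) = (f x, 0)" "f x \<in> carrier P'" if x: "x \<in> carrier P" for x
  proof -
    obtain y b where yb: "H (x, 0) = (y, b)" "y \<in> carrier P'" "0 \<le> b" "b < int q"
      using h(4)[of "(x, 0)"] x q1 by (cases "H (x, 0)") auto
    \<comment> \<open>Multiplication by the order of \<open>P\<close> kills \<open>(x, 0)\<close>,
      hence its image; being prime to q, it can kill the component \<open>b\<close> only if
      \<open>b\<close> is zero.\<close>
    have "H ([?N] \<cdot>\<^bsub>?E\<^esub> (x, 0)) = [?N] \<cdot>\<^bsub>?E'\<^esub> (y, b)"
      using x q1 yb by (simp add: Hpw)
    also have "\<dots> = ([?N] \<cdot>\<^bsub>P'\<^esub> y, ?N * b mod int q)"
      using yb by (simp add: pw)
    finally have "H ([?N] \<cdot>\<^bsub>?E\<^esub> (x, 0)) = ([?N] \<cdot>\<^bsub>P'\<^esub> y, ?N * b mod int q)" .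
    then have "?N * b mod int q = 0" using x q1 by (simp add: pw Ntor H0)
    then have "int q dvd b" using q(2)
      by (metis coprime_commute coprime_dvd_mult_right_iff coprime_int_iff dvd_eq_mod_eq_0)
    then have "b = 0" using yb by (metis mod_pos_pos_trivial dvd_imp_mod_0)
    then show "H (x, 0) = (f x, 0)" "f x \<in> carrier P'" using yb by (simp_all add: f_def)
  qed
  obtain c where c: "H (\<zero>\<^bsub>P\<^esub>, 1) = (\<zero>\<^bsub>P'\<^esub>, c)" "0 \<le> c" "c < int q"
  proof -
    obtain y b where yb: "H (\<zero>\<^bsub>P\<^esub>, 1) = (y, b)" "y \<in> carrier P'" "0 \<le> b" "b < int q"
      using h(4)[of "(\<zero>\<^bsub>P\<^esub>, 1)"] q1 by (cases "H (\<zero>\<^bsub>P\<^esub>, 1)") auto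
    \<comment> \<open>Dually, q kills the image of the generator of Z_q, so its component
      \<open>y\<close> is killed by q and by the order of \<open>P'\<close>.\<close>
    have "H ([(int q)] \<cdot>\<^bsub>?E\<^esub> (\<zero>\<^bsub>P\<^esub>, 1)) = [(int q)] \<cdot>\<^bsub>?E'\<^esub> (y, b)"
      using q1 yb by (simp add: Hpw)
    also have "\<dots> = ([(int q)] \<cdot>\<^bsub>P'\<^esub> y, int q * b mod int q)"
      using yb by (simp add: pw)
    finally have "H ([(int q)] \<cdot>\<^bsub>?E\<^esub> (\<zero>\<^bsub>P\<^esub>, 1)) = ([(int q)] \<cdot>\<^bsub>P'\<^esub> y, int q * b mod int q)" .
    then have "[(int q)] \<cdot>\<^bsub>P'\<^esub> y = \<zero>\<^bsub>P'\<^esub>" using q1 by (simp add: pw H0)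
    then have "y = \<zero>\<^bsub>P'\<^esub>"
      using P'.torsion_coprime[OF yb(2), of ?N "int q"] Ntor'[OF yb(2)] q(2) by simp
    then show ?thesis using that yb by blast
  qed
  have inj: "inj_on H (carrier ?E)" using h(1) by (simp add: bij_betw_def)
  have "c \<noteq> 0"
  proof
    assume "c = 0"
    then have "H (\<zero>\<^bsub>P\<^esub>, 1) = H (\<zero>\<^bsub>P\<^esub>, 0)" using c H0 by simp
    then show False using inj_onD[OF inj, of "(\<zero>\<^bsub>P\<^esub>, 1)" "(\<zero>\<^bsub>P\<^esub>, 0)"] q1 by simp
  qed
  then have c0: "0 < c" using c by simp
  have fin: "inj_on f (carrier P)"
  proof (rule inj_onI)
    fix x y assume *: "x \<in> carrier P" "y \<in> carrier P" "f x = f y"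
    then have "H (x, 0) = H (y, 0)" using f by simp
    then show "x = y" using inj_onD[OF inj, of "(x, 0)" "(y, 0)"] * q1 by simp
  qed
  have "f ` carrier P = carrier P'"
    by (rule card_subset_eq)
       (use f(2) P'.finite_carrier ord in \<open>auto simp: card_image[OF fin] order_def\<close>)
  then have "bij_betw f (carrier P) (carrier P')" using fin by (simp add: bij_betw_def)
  moreover have "f (x \<oplus>\<^bsub>P\<^esub> y) = f x \<oplus>\<^bsub>P'\<^esub> f y" "f (x \<otimes>\<^bsub>P\<^esub> y) = f x \<otimes>\<^bsub>P'\<^esub> f y"
    if xy: "x \<in> carrier P" "y \<in> carrier P" for x y
  proof -
    have "H ((x, 0) \<oplus>\<^bsub>?E\<^esub> (y, 0)) = H (x, 0) \<oplus>\<^bsub>?E'\<^esub> H (y, 0)" using xy q1 by (intro h(2)) auto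
    then show "f (x \<oplus>\<^bsub>P\<^esub> y) = f x \<oplus>\<^bsub>P'\<^esub> f y" using xy f by simp
    have "H ((x, 0) \<otimes>\<^bsub>?E\<^esub> (y, 0)) = H (x, 0) \<otimes>\<^bsub>?E'\<^esub> H (y, 0)" using xy q1 by (intro h(3)) auto
    then show "f (x \<otimes>\<^bsub>P\<^esub> y) = f x \<otimes>\<^bsub>P'\<^esub> f y" using xy f by (simp add: P.mult_closed)
  qed
  ultimately have "f \<in> brace_iso P P'" by (intro brace_isoI)
  moreover have "\<chi>' (f x) = \<chi> x" if x: "x \<in> carrier P" for x
  proof -
    note cx = brace_charD[OF chi(1) x] and cfx = brace_charD[OF chi(2) f(2)[OF x]]
    \<comment> \<open>The product of \<open>(x, 0)\<close> with the generator of Z_q is an integer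
      multiple of that generator, so additivity of \<open>H\<close> alone computes its image;
      comparison with the product of the images and cancellation of the unit \<open>c\<close>
      identifies the characters.\<close>
    have "H ((x, 0) \<otimes>\<^bsub>?E\<^esub> (\<zero>\<^bsub>P\<^esub>, 1)) = H ([(\<chi> x - 1)] \<cdot>\<^bsub>?E\<^esub> (\<zero>\<^bsub>P\<^esub>, 1))"
      using x q1 by (simp add: pw P.mult_zero)
    also have "\<dots> = [(\<chi> x - 1)] \<cdot>\<^bsub>?E'\<^esub> (\<zero>\<^bsub>P'\<^esub>, c)" using q1 c by (simp add: Hpw)
    also have "\<dots> = (\<zero>\<^bsub>P'\<^esub>, (\<chi> x - 1) * c mod int q)" using c by (simp add: pw)
    finally have "(\<chi> x - 1) * c mod int q = (\<chi>' (f x) - 1) * c mod int q"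
      using h(3)[of "(x, 0)" "(\<zero>\<^bsub>P\<^esub>, 1)"] x q1 f[OF x] c by (simp add: P'.mult_zero)
    then have "c * (\<chi>' (f x) - 1) mod int q = c * (\<chi> x - 1) mod int q"
      by (metis mult.commute)
    then have "\<chi>' (f x) - 1 = \<chi> x - 1"
      by (rule mod_cancel[OF q(1) c0 c(3)]) (use cx(1,2) cfx(1,2) in linarith)+
    then show ?thesis by simp
  qed
  ultimately show ?thesis by (rule that)
qed

section \<open>Splitting off the normal Sylow subgroup\<close>

text \<open>Stability under \<open>lam\<close> gives closure under the product, since the product of
  \<open>x\<close> and \<open>y\<close> is \<open>lam A x y\<close> minus \<open>y\<close>.\<close>

lemma (in brace) sub_brace:
  assumes H: "subgroup H (add_monoid A)" and lam: "\<And>x y. \<lbrakk>x \<in> H; y \<in> H\<rbrakk> \<Longrightarrow> lam A x y \<in> H"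
  shows "brace (A\<lparr>carrier := H\<rparr>)"
proof -
  interpret H: subgroup H "add_monoid A" by fact
  have HA: "x \<in> carrier A" if "x \<in> H" for x using H.subset that by auto
  have minus: "\<ominus> x \<in> H" if "x \<in> H" for x using H.m_inv_closed that by (simp add: a_inv_def)
  have add: "x \<oplus> y \<in> H" if "x \<in> H" "y \<in> H" for x y using H.m_closed that by simp
  have mult: "x \<otimes> y \<in> H" if "x \<in> H" "y \<in> H" for x y
  proof -
    have "x \<otimes> y = lam A x y \<oplus> \<ominus> y"
      using that by (simp add: lam_def HA mult_closed a_assoc r_neg)
    then show ?thesis using that add lam minus by simp
  qed
  have fin: "finite H" using finite_carrier HA by (meson finite_subset subsetI)
  have "abelian_group (A\<lparr>carrier := H\<rparr>)"
  proof (rule abelian_groupI)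
    fix x assume "x \<in> carrier (A\<lparr>carrier := H\<rparr>)"
    then show "\<exists>y \<in> carrier (A\<lparr>carrier := H\<rparr>). y \<oplus>\<^bsub>A\<lparr>carrier := H\<rparr>\<^esub> x = \<zero>\<^bsub>A\<lparr>carrier := H\<rparr>\<^esub>"
      using minus HA l_neg by auto
  qed (use H.one_closed in \<open>simp_all add: add HA a_ac\<close>)
  moreover have "bij_betw (\<lambda>y. x \<otimes> y \<oplus> y) H H" if "x \<in> H" for x
  proof -
    have inj: "inj_on (\<lambda>y. x \<otimes> y \<oplus> y) H"
      using lam_inj[unfolded lam_def] HA that by (meson inj_onI)
    moreover have "(\<lambda>y. x \<otimes> y \<oplus> y) ` H = H"
      by (rule endo_inj_surj[OF fin _ inj]) (auto simp: mult add that)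
    ultimately show ?thesis by (simp add: bij_betw_def)
  qed
  ultimately show ?thesis
    by (intro brace.intro brace_axioms.intro)
       (use fin in \<open>simp_all add: mult HA left_distrib circle_mult\<close>)
qed

lemma circle_restrict [simp]: "circle (A\<lparr>carrier := H\<rparr>) = circle A"
  by (simp add: circle_def fun_eq_iff)

text \<open>Serves as the Sylow subgroup: described by torsion, it is visibly invariant under every
  additive automorphism and so under all \<open>lam A x\<close>.\<close>

definition torsion :: "('a, 'm) ring_scheme \<Rightarrow> nat \<Rightarrow> 'a set" where
  "torsion A n = {x \<in> carrier A. [(int n)] \<cdot>\<^bsub>A\<^esub> x = \<zero>\<^bsub>A\<^esub>}"

context brace
begin

lemma lam_minus:
  assumes "x \<in> carrier A" "y \<in> carrier A"
  shows "lam A x (\<ominus> y) = \<ominus> lam A x y"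
proof -
  have "lam A x (\<ominus> y) \<oplus> lam A x y = \<zero>"
    using assms by (simp add: lam_add[symmetric] l_neg lam_zero)
  then show ?thesis using assms by (simp add: minus_equality lam_closed)
qed

lemma int_pow_zero: "[(n :: int)] \<cdot> \<zero> = \<zero>"
  using add.int_pow_one[of n] by simp

lemma torsion_subgroup: "subgroup (torsion A n) (add_monoid A)"
  by (rule add.subgroupI)
     (auto simp: torsion_def int_pow_zero add.int_pow_distrib add.int_pow_inv simp flip: a_inv_def)

lemma torsion_lam: "x \<in> carrier A \<Longrightarrow> y \<in> torsion A n \<Longrightarrow> lam A x y \<in> torsion A n"
  by (auto simp: torsion_def lam_closed lam_zero simp flip: lam_int_pow)

lemma torsion_disjoint:
  "coprime m n \<Longrightarrow> x \<in> torsion A m \<Longrightarrow> x \<in> torsion A n \<Longrightarrow> x = \<zero>"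
  using torsion_coprime[of x "int m" "int n"] by (auto simp: torsion_def)

lemma torsion_sum_inj:
  assumes "coprime m n"
  shows "inj_on (\<lambda>(x, y). x \<oplus> y) (torsion A m \<times> torsion A n)"
proof (rule inj_onI; clarsimp)
  fix x y x' y' assume *: "x \<in> torsion A m" "x' \<in> torsion A m" "y \<in> torsion A n" "y' \<in> torsion A n"
    and eq: "x \<oplus> y = x' \<oplus> y'"
  have c: "x \<in> carrier A" "x' \<in> carrier A" "y \<in> carrier A" "y' \<in> carrier A"
    using * by (auto simp: torsion_def)
  have d: "y' \<oplus> \<ominus> y = x \<oplus> \<ominus> x'" by (rule add_eq_swap[OF eq[symmetric]]) (use c in simp_all)
  interpret M: subgroup "torsion A m" "add_monoid A" by (rule torsion_subgroup)
  interpret N: subgroup "torsion A n" "add_monoid A" by (rule torsion_subgroup)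
  have "x \<oplus> \<ominus> x' \<in> torsion A m" using M.m_closed M.m_inv_closed * by (simp add: a_inv_def)
  moreover have "y' \<oplus> \<ominus> y \<in> torsion A n" using N.m_closed N.m_inv_closed * by (simp add: a_inv_def)
  ultimately have "x \<oplus> \<ominus> x' = \<zero>" using d torsion_disjoint[OF assms] by metis
  then have "\<ominus> (\<ominus> x') = x" using c by (intro minus_equality) auto
  then have "x = x'" using c by simp
  then show "x = x' \<and> y = y'" using eq c by simp
qed

lemma subgroup_torsion:
  assumes H: "subgroup H (add_monoid A)"
  shows "H \<subseteq> torsion A (card H)"
proof
  fix x assume x: "x \<in> H"
  interpret H: group "(add_monoid A)\<lparr>carrier := H\<rparr>" using add.subgroup_imp_group[OF H] .
  have "x [^]\<^bsub>(add_monoid A)\<lparr>carrier := H\<rparr>\<^esub> card H = \<zero>"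
    using H.pow_order_eq_1[of x] x by (simp add: order_def)
  then have "x [^]\<^bsub>add_monoid A\<^esub> card H = \<zero>" by (simp add: nat_pow_def)
  then show "x \<in> torsion A (card H)"
    using x subgroup.subset[OF H] by (auto simp: torsion_def add_pow_def int_pow_int)
qed

text \<open>Sylow subgroups lie in the torsion parts and bound their sizes from below; injectivity
  of the sum map bounds the product of the sizes from above, so both bounds are attained.\<close>

lemma card_torsion:
  assumes p: "Factorial_Ring.prime p" "Factorial_Ring.prime q" "p \<noteq> q"
    and ord: "order A = p ^ a * q ^ b"
  shows "card (torsion A (p ^ a)) = p ^ a" "card (torsion A (q ^ b)) = q ^ b"
proof -
  have fin: "finite (torsion A n)" for n using finite_carrier by (simp add: torsion_def)
  have *: "r ^ c \<le> card (torsion A (r ^ c))"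
    if r: "Factorial_Ring.prime r" "order A = r ^ c * m" for r c m
  proof -
    obtain H where H: "subgroup H (add_monoid A)" "card H = r ^ c"
      using sylow_thm[OF r(1) add.is_group, of c m] r(2) finite_carrier by (auto simp: order_def)
    show ?thesis using card_mono[OF fin subgroup_torsion[OF H(1)]] H(2) by simp
  qed
  have cop: "coprime (p ^ a) (q ^ b)" using p by (simp add: primes_coprime)
  have "card (torsion A (p ^ a) \<times> torsion A (q ^ b)) \<le> card (carrier A)"
    by (rule card_inj_on_le[OF torsion_sum_inj[OF cop] _ finite_carrier]) (auto simp: torsion_def)
  then have le: "card (torsion A (p ^ a)) * card (torsion A (q ^ b)) \<le> p ^ a * q ^ b"
    using ord by (simp add: card_cartesian_product order_def)
  have 1: "p ^ a \<le> card (torsion A (p ^ a))" using *[OF p(1) ord] .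
  have 2: "q ^ b \<le> card (torsion A (q ^ b))" using *[OF p(2), of b "p ^ a"] ord by (simp add: mult.commute)
  have pos: "0 < p ^ a" "0 < q ^ b" using p by (simp_all add: prime_gt_0_nat)
  from 1 2 le pos show "card (torsion A (p ^ a)) = p ^ a" "card (torsion A (q ^ b)) = q ^ b"
    using mult_less_le_imp_less[of "p ^ a" _ "q ^ b"] mult_le_less_imp_less[of "p ^ a" _ "q ^ b"]
    by (metis leD le_neq_implies_less less_imp_le zero_le)+
qed

lemma ord_eq_prime:
  assumes "Factorial_Ring.prime p" "x \<in> carrier A" "[(int p)] \<cdot> x = \<zero>" "x \<noteq> \<zero>"
  shows "add.ord x = p"
proof -
  have "add.ord x dvd p" using assms add.pow_eq_id[of x p] by (simp add: add_pow_def int_pow_int)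
  moreover have "add.ord x \<noteq> 1" using assms add.ord_eq_1[of x] by simp
  ultimately show ?thesis using assms(1) prime_nat_iff by metis
qed

lemma prime_subgroup_generator:
  assumes F: "subgroup F (add_monoid A)" "card F = p" "Factorial_Ring.prime p" and w: "w \<in> F" "w \<noteq> \<zero>"
  shows "add.ord w = p" and "F = (\<lambda>i. [i] \<cdot> w) ` {0..<int p}"
proof -
  interpret F: subgroup F "add_monoid A" by fact
  have wA: "w \<in> carrier A" using F.subset w by auto
  show ord: "add.ord w = p"
    by (rule ord_eq_prime[OF F(3) wA _ w(2)]) (use subgroup_torsion[OF F(1)] w F(2) in \<open>auto simp: torsion_def\<close>)
  have "inj_on (\<lambda>i. [i] \<cdot> w) {0..<int p}"
  proof (rule inj_onI)
    fix i j assume *: "i \<in> {0..<int p}" "j \<in> {0..<int p}" "[i] \<cdot> w = [j] \<cdot> w"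
    then have "[j = i] (mod int p)" using add.int_pow_eq[OF wA, of i j] ord by (simp add: cong_iff_dvd_diff)
    then show "i = j" using * by (simp add: cong_def)
  qed
  then have "card ((\<lambda>i. [i] \<cdot> w) ` {0..<int p}) = card F" using F(2) by (simp add: card_image)
  moreover have "[i] \<cdot> w \<in> F" for i :: int
    using add.subgroup_int_pow_closed[OF F(1) w(1)] .
  moreover have "finite F" using finite_carrier F.subset finite_subset by auto
  ultimately show "F = (\<lambda>i. [i] \<cdot> w) ` {0..<int p}"
    using card_subset_eq[of F "(\<lambda>i. [i] \<cdot> w) ` {0..<int p}"] by auto
qed

definition fixp :: "'a set \<Rightarrow> 'a set \<Rightarrow> 'a set" where
  "fixp H Y = {y \<in> Y. \<forall>x \<in> H. lam A x y = y}"

lemma fixp_subgroup: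
  assumes "H \<subseteq> carrier A" "subgroup Y (add_monoid A)"
  shows "subgroup (fixp H Y) (add_monoid A)"
proof -
  interpret Y: subgroup Y "add_monoid A" by fact
  have YA: "y \<in> carrier A" if "y \<in> Y" for y using Y.subset that by auto
  show ?thesis
  proof (rule add.subgroupI)
    show "fixp H Y \<noteq> {}"
      using Y.one_closed lam_zero assms(1) by (auto simp: fixp_def intro!: exI[of _ \<zero>])
  qed (use YA assms(1) Y.m_closed Y.m_inv_closed in
      \<open>auto simp: fixp_def lam_minus lam_add subset_iff simp flip: a_inv_def\<close>)
qed

text \<open>The congruence is the class equation and the divisibility is Lagrange's theorem, the
  fixed points being an additive subgroup. Together they leave few possible sizes.\<close>

lemma card_fixp:
  assumes H: "subgroup H (add_monoid A)" "\<And>x y. \<lbrakk>x \<in> H; y \<in> H\<rbrakk> \<Longrightarrow> lam A x y \<in> H"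
    and Y: "subgroup Y (add_monoid A)" "\<And>x y. x \<in> H \<Longrightarrow> y \<in> Y \<Longrightarrow> lam A x y \<in> Y"
    and r: "Factorial_Ring.prime r" "card H = r ^ n"
  shows "[card (fixp H Y) = card Y] (mod r)" "card (fixp H Y) dvd card Y"
proof -
  have YA: "Y \<subseteq> carrier A" using subgroup.subset[OF Y(1)] by simp
  have HA: "H \<subseteq> carrier A" using subgroup.subset[OF H(1)] by simp
  interpret group_action "circle_group A H" Y "\<lambda>x. \<lambda>y\<in>Y. lam A x y"
    by (rule lam_group_action[OF H YA Y(2)])
  have "fixp H Y = {y \<in> Y. \<forall>x\<in>carrier (circle_group A H). (\<lambda>y\<in>Y. lam A x y) y = y}"
    by (auto simp: fixp_def circle_group_def)
  then show "[card (fixp H Y) = card Y] (mod r)"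
    using card_fixed_points_cong[OF r(1), of n] r(2) finite_subset[OF YA finite_carrier]
    by (simp add: order_def circle_group_def)
  interpret Y: group "(add_monoid A)\<lparr>carrier := Y\<rparr>" using add.subgroup_imp_group[OF Y(1)] .
  have "subgroup (fixp H Y) ((add_monoid A)\<lparr>carrier := Y\<rparr>)"
    by (rule add.subgroup_incl[OF fixp_subgroup[OF HA Y(1)] Y(1)]) (auto simp: fixp_def)
  note lagr = Y.lagrange[OF this]
  have "order ((add_monoid A)\<lparr>carrier := Y\<rparr>) = card Y" by (simp add: order_def)
  then show "card (fixp H Y) dvd card Y" using lagr by (metis dvd_triv_right)
qed

lemmas lam_eq_mult_zero = lam_eq_iff[THEN iffD1]

text \<open>As \<open>q > p > 2\<close>, neither \<open>1\<close> nor \<open>p\<close> is congruent to \<open>p\<^sup>2\<close> modulo \<open>q\<close>, so the \<open>q\<close>-part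
  fixes the \<open>p\<close>-part pointwise.\<close>

lemma torsion_mult_zero:
  assumes p: "Factorial_Ring.prime p" "Factorial_Ring.prime q" "2 < p" "p < q"
    and ord: "order A = p\<^sup>2 * q" and x: "x \<in> torsion A q" and y: "y \<in> carrier A"
  shows "x \<otimes> y = \<zero>"
proof -
  let ?P = "torsion A (p\<^sup>2)" and ?Q = "torsion A q"
  have card: "card ?P = p\<^sup>2" "card ?Q = q"
    using card_torsion[OF p(1,2), of 2 1] p(4) ord by auto
  have PA: "?P \<subseteq> carrier A" and QA: "?Q \<subseteq> carrier A" by (auto simp: torsion_def)
  have fin: "finite ?P" "finite ?Q" using PA QA finite_carrier finite_subset by auto
  have lam: "lam A u v \<in> torsion A n" if "u \<in> ?Q" "v \<in> torsion A n" for u v n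
    using torsion_lam that QA by auto
  have fx: "[card (fixp ?Q (torsion A n)) = card (torsion A n)] (mod q)"
    "card (fixp ?Q (torsion A n)) dvd card (torsion A n)" for n
    by (intro card_fixp(1)[where n = 1] torsion_subgroup lam p(2); simp add: card)
       (intro card_fixp(2)[where r = q and n = 1] torsion_subgroup lam p(2); simp add: card)
  have "?Q = fixp ?Q ?Q"
  proof -
    \<comment> \<open>Zero is fixed, so the number of fixed points is a positive multiple of q and
      must equal the size q of \<open>?Q\<close>.\<close>
    have "q dvd card (fixp ?Q ?Q)" using fx(1)[of q] card by (simp add: cong_def mod_eq_0_iff_dvd)
    moreover have "\<zero> \<in> fixp ?Q ?Q"
      using subgroup.one_closed[OF fixp_subgroup[OF QA torsion_subgroup[of q]]] by simp
    then have "card (fixp ?Q ?Q) \<noteq> 0" using fin by (auto simp: fixp_def)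
    ultimately have "card ?Q \<le> card (fixp ?Q ?Q)" using card by (simp add: dvd_imp_le)
    then show ?thesis using fin card_seteq[of ?Q "fixp ?Q ?Q"] by (auto simp: fixp_def)
  qed
  moreover have "?P = fixp ?Q ?P"
  proof -
    let ?c = "card (fixp ?Q ?P)"
    have c: "[?c = p\<^sup>2] (mod q)" "?c dvd p\<^sup>2" using fx[of "p\<^sup>2"] card by simp_all
    have "?c \<noteq> 1"
    proof
      assume "?c = 1"
      \<comment> \<open>From q dividing (p - 1)(p + 1) and q > p only q = p + 1 is left, which
        parity excludes for two odd primes; p = 2 and q = 3 would escape here.\<close>
      then have "q dvd p\<^sup>2 - 1" using c(1) p(3) cong_altdef_nat[of 1 "p\<^sup>2" q] by (simp add: cong_sym_eq)
      also have "p\<^sup>2 - 1 = (p - 1) * (p + 1)" by (simp add: power2_eq_square algebra_simps)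
      finally have "q dvd p - 1 \<or> q dvd p + 1" unfolding prime_dvd_mult_iff[OF p(2)] .
      then have "q \<le> p + 1" using p(3) by (auto dest!: dvd_imp_le)
      then have "q = p + 1" using p(4) by simp
      moreover have "odd p" "odd q" using p prime_odd_nat by auto
      ultimately show False by simp
    qed
    moreover have "?c \<noteq> p"
    proof
      assume "?c = p"
      then have "q dvd p\<^sup>2 - p" using c(1) cong_altdef_nat[of p "p\<^sup>2" q]
        by (simp add: cong_sym_eq power2_eq_square)
      also have "p\<^sup>2 - p = p * (p - 1)" by (simp add: power2_eq_square algebra_simps)
      finally have "q dvd p \<or> q dvd p - 1" unfolding prime_dvd_mult_iff[OF p(2)] .
      then show False using p(3,4) by (auto dest!: dvd_imp_le)
    qed
    moreover obtain i where "i \<le> 2" "?c = p ^ i" using c(2) p(1) by (auto simp: divides_primepow_nat)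
    then have "?c = 1 \<or> ?c = p \<or> ?c = p\<^sup>2" by (auto simp: le_Suc_eq numeral_2_eq_2)
    ultimately have "?c = card ?P" using card by simp
    then show ?thesis using fin card_seteq[of ?P "fixp ?Q ?P"] by (auto simp: fixp_def)
  qed
  \<comment> \<open>The sum map on the two coprime torsion parts is injective, hence onto by
    counting.\<close>
  moreover obtain u v where uv: "u \<in> ?P" "v \<in> ?Q" "y = u \<oplus> v"
  proof -
    have cop: "coprime (p\<^sup>2) q" using p by (simp add: primes_coprime)
    have "(\<lambda>(x, y). x \<oplus> y) ` (?P \<times> ?Q) = carrier A"
      by (rule card_subset_eq[OF finite_carrier])
         (use PA QA ord card in \<open>auto simp: card_image[OF torsion_sum_inj[OF cop]] card_cartesian_product order_def\<close>)
    then have "y \<in> (\<lambda>(x, y). x \<oplus> y) ` (?P \<times> ?Q)" using y by simp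
    then show ?thesis using that by auto
  qed
  ultimately have "lam A x u = u" "lam A x v = v" using x by (auto simp: fixp_def)
  then show ?thesis using uv x PA QA
    by (simp add: left_distrib lam_eq_mult_zero subset_iff)
qed

text \<open>With a generator \<open>g\<close> of the q-torsion, the character is defined by
  \<open>lam A x g\<close> being the \<open>\<chi> x\<close>-fold multiple of \<open>g\<close>. It
  is multiplicative because \<open>lam\<close> turns circle products into composition.\<close>

lemma brace_ext_decomposition:
  assumes q: "Factorial_Ring.prime q" "coprime N q" and ord: "order A = N * q"
    and card: "card (torsion A N) = N" "card (torsion A q) = q"
    and triv: "\<And>x y. x \<in> torsion A q \<Longrightarrow> y \<in> carrier A \<Longrightarrow> x \<otimes> y = \<zero>"
  defines "P \<equiv> A\<lparr>carrier := torsion A N\<rparr>"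
  obtains \<chi> where "brace P" "brace_char P q \<chi>" "brace_isomorphic (brace_ext P q \<chi>) A"
proof -
  let ?T = "torsion A N"
  have TA: "x \<in> carrier A" if "x \<in> torsion A n" for x n using that by (simp add: torsion_def)
  have q1: "1 < q" using q(1) by (rule prime_gt_1_nat)
  have P: "brace P" unfolding P_def
    by (rule sub_brace[OF torsion_subgroup]) (simp add: torsion_lam TA)
  have "\<not> torsion A q \<subseteq> {\<zero>}" using card(2) q1 card_mono[of "{\<zero>}" "torsion A q"] by auto
  then obtain g where g: "g \<in> torsion A q" "g \<noteq> \<zero>" by auto
  note gA = TA[OF g(1)]
  note ggen = prime_subgroup_generator[OF torsion_subgroup card(2) q(1) g]
  have geq: "[i] \<cdot> g = [j] \<cdot> g \<longleftrightarrow> [i = j] (mod int q)" for i j :: int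
    using add.int_pow_eq[OF gA, of i j] ggen(1) by (simp add: cong_iff_dvd_diff dvd_diff_commute)
  have gT: "[i] \<cdot> g \<in> torsion A q" for i :: int
    using add.subgroup_int_pow_closed[OF torsion_subgroup g(1)] .
  have gfull: "\<exists>i. 0 \<le> i \<and> i < int q \<and> x = [i] \<cdot> g" if "x \<in> torsion A q" for x
    using that by (subst (asm) ggen(2)) auto
  have "\<exists>c. 0 < c \<and> c < int q \<and> lam A x g = [c] \<cdot> g" if x: "x \<in> ?T" for x
  proof -
    obtain c where c: "0 \<le> c" "c < int q" "lam A x g = [c] \<cdot> g"
      using gfull[OF torsion_lam[OF TA[OF x] g(1)]] by auto
    have "c \<noteq> 0"
    proof
      assume "c = 0"
      then have "lam A x g = lam A x \<zero>" using c lam_zero[OF TA[OF x]] by (simp add: add_pow_def)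
      then show False using lam_inj[OF _ TA[OF x] gA] g(2) by simp
    qed
    then show ?thesis using c by (intro exI[of _ c]) auto
  qed
  then obtain \<chi> where \<chi>: "0 < \<chi> x" "\<chi> x < int q" "lam A x g = [(\<chi> x)] \<cdot> g" if "x \<in> ?T" for x
    by metis
  have char: "brace_char P q \<chi>"
    unfolding brace_char_def
  proof (intro conjI ballI)
    fix x y assume "x \<in> carrier P" "y \<in> carrier P"
    then have xy: "x \<in> ?T" "y \<in> ?T" by (simp_all add: P_def)
    have cT: "circle A x y \<in> ?T"
      using xy subgroup.m_closed[OF torsion_subgroup[of N]] torsion_lam by (simp add: circle_lam TA)
    have "[(\<chi> (circle A x y))] \<cdot> g = lam A x (lam A y g)"
      using xy cT gA by (simp add: TA lam_circle flip: \<chi>(3))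
    also have "\<dots> = [(\<chi> y)] \<cdot> ([(\<chi> x)] \<cdot> g)"
      using xy gA by (simp add: TA \<chi>(3) lam_int_pow)
    also have "\<dots> = [(\<chi> x * \<chi> y)] \<cdot> g" using gA by (simp add: add.int_pow_pow)
    finally have "[\<chi> (circle A x y) = \<chi> x * \<chi> y] (mod int q)" by (simp add: geq)
    then show "\<chi> (circle P x y) = \<chi> x * \<chi> y mod int q"
      using \<chi>(1,2)[OF cT] by (simp add: P_def cong_def)
  qed (use \<chi> in \<open>auto simp: P_def\<close>)
  have xg: "x \<otimes> g = [(\<chi> x - 1)] \<cdot> g" if x: "x \<in> ?T" for x
  proof -
    have "x \<otimes> g \<oplus> g = [(\<chi> x - 1)] \<cdot> g \<oplus> g"
      using \<chi>(3)[OF x] add.int_pow_mult[OF gA, of "\<chi> x - 1" 1] gA by (simp add: lam_def)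
    then show ?thesis using gA TA[OF x] by (simp add: mult_closed)
  qed
  \<comment> \<open>A product depends only on the component of its left factor outside the
    q-torsion: as \<open>a\<close> annihilates everything, the sum of \<open>x\<close> and
    \<open>a\<close> is also the circle product of \<open>a\<close> with \<open>x\<close>, and
    \<open>lam A a\<close> is the identity.\<close>
  have absorb: "(x \<oplus> a) \<otimes> z = x \<otimes> z" if "x \<in> ?T" "a \<in> torsion A q" "z \<in> carrier A" for x a z
  proof -
    have "circle A a x = x \<oplus> a" using that triv by (simp add: circle_def TA a_comm)
    then have "lam A (x \<oplus> a) z = lam A a (lam A x z)" using that by (metis TA lam_circle)
    also have "\<dots> = lam A x z" using that triv[OF that(2), of "lam A x z"] by (simp add: TA lam_closed lam_def[of A a])
    finally show ?thesis using that by (simp add: lam_def TA mult_closed)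
  qed
  let ?h = "\<lambda>(x, i). x \<oplus> [i] \<cdot> g"
  have inj: "inj_on ?h (carrier (brace_ext P q \<chi>))"
  proof (rule inj_onI)
    fix u v assume "u \<in> carrier (brace_ext P q \<chi>)" "v \<in> carrier (brace_ext P q \<chi>)" and eq: "?h u = ?h v"
    then obtain x i y j where *: "u = (x, i)" "v = (y, j)" "x \<in> ?T" "y \<in> ?T" "0 \<le> i" "i < int q" "0 \<le> j" "j < int q"
      by (auto simp: P_def)
    then have "x = y" "[i] \<cdot> g = [j] \<cdot> g"
      using inj_onD[OF torsion_sum_inj[OF q(2)], of "(x, [i] \<cdot> g)" "(y, [j] \<cdot> g)"] eq gT by auto
    then show "u = v" using * by (auto simp: geq cong_def)
  qed
  have "?h ` carrier (brace_ext P q \<chi>) = carrier A"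
  proof (rule card_subset_eq[OF finite_carrier])
    show "?h ` carrier (brace_ext P q \<chi>) \<subseteq> carrier A" using gA TA by (auto simp: P_def)
    show "card (?h ` carrier (brace_ext P q \<chi>)) = card (carrier A)"
      using card(1) ord by (simp only: card_image[OF inj]) (simp add: P_def card_cartesian_product order_def)
  qed
  then have "bij_betw ?h (carrier (brace_ext P q \<chi>)) (carrier A)" using inj by (simp add: bij_betw_def)
  moreover have "?h (u \<oplus>\<^bsub>brace_ext P q \<chi>\<^esub> v) = ?h u \<oplus> ?h v" "?h (u \<otimes>\<^bsub>brace_ext P q \<chi>\<^esub> v) = ?h u \<otimes> ?h v"
    if uv: "u \<in> carrier (brace_ext P q \<chi>)" "v \<in> carrier (brace_ext P q \<chi>)" for u v
  proof -
    obtain x i y j where *: "u = (x, i)" "v = (y, j)" "x \<in> ?T" "y \<in> ?T"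
      using uv by (auto simp: P_def)
    have modg: "[(k mod int q)] \<cdot> g = [k] \<cdot> g" for k by (simp add: geq)
    show "?h (u \<oplus>\<^bsub>brace_ext P q \<chi>\<^esub> v) = ?h u \<oplus> ?h v"
      using * gA by (simp add: P_def modg add.int_pow_mult TA a_ac)
    have "?h u \<otimes> ?h v = x \<otimes> y \<oplus> x \<otimes> ([j] \<cdot> g)"
      using * gA gT by (simp add: absorb TA left_distrib)
    also have "x \<otimes> ([j] \<cdot> g) = [((\<chi> x - 1) * j)] \<cdot> g"
      using * gA by (simp add: mult_int_pow TA xg add.int_pow_pow)
    finally show "?h (u \<otimes>\<^bsub>brace_ext P q \<chi>\<^esub> v) = ?h u \<otimes> ?h v"
      using * by (simp add: P_def modg)
  qed
  ultimately have "?h \<in> brace_iso (brace_ext P q \<chi>) A" by (intro brace_isoI)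
  then show ?thesis using that[OF P char] brace_isomorphicI by blast
qed

end

section \<open>Braces of order \<open>p\<^sup>2\<close>\<close>

text \<open>The values 0 and 1 of \<open>k\<close> give the Sylow p-part of the braces
  \<open>T_p2q\<close> and \<open>B_p2q\<close>; the parameter lets both be treated at once.\<close>

definition cyc_brace :: "nat \<Rightarrow> int \<Rightarrow> int ring" where
  "cyc_brace p k = \<lparr>carrier = {0..<(int p)\<^sup>2}, monoid.mult = \<lambda>x y. k * int p * x * y mod (int p)\<^sup>2,
     one = 0, ring.zero = 0, ring.add = \<lambda>x y. (x + y) mod (int p)\<^sup>2\<rparr>"

text \<open>The analogous p-part for \<open>T_ppq\<close> and \<open>B_ppq\<close>: a bilinear form
  in the second coordinates with values in the first.\<close>

definition elem_brace :: "nat \<Rightarrow> int \<Rightarrow> (int \<times> int) ring" where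
  "elem_brace p k = \<lparr>carrier = {0..<int p} \<times> {0..<int p},
     monoid.mult = \<lambda>u v. (k * snd u * snd v mod int p, 0), one = (0, 0), ring.zero = (0, 0),
     ring.add = \<lambda>u v. ((fst u + fst v) mod int p, (snd u + snd v) mod int p)\<rparr>"

lemma cyc_brace_simps [simp]:
  "carrier (cyc_brace p k) = {0..<(int p)\<^sup>2}"
  "x \<otimes>\<^bsub>cyc_brace p k\<^esub> y = k * int p * x * y mod (int p)\<^sup>2"
  "x \<oplus>\<^bsub>cyc_brace p k\<^esub> y = (x + y) mod (int p)\<^sup>2"
  "\<zero>\<^bsub>cyc_brace p k\<^esub> = 0"
  by (simp_all add: cyc_brace_def)

lemma elem_brace_simps [simp]:
  "carrier (elem_brace p k) = {0..<int p} \<times> {0..<int p}"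
  "(x, y) \<otimes>\<^bsub>elem_brace p k\<^esub> (x', y') = (k * y * y' mod int p, 0)"
  "(x, y) \<oplus>\<^bsub>elem_brace p k\<^esub> (x', y') = ((x + x') mod int p, (y + y') mod int p)"
  "\<zero>\<^bsub>elem_brace p k\<^esub> = (0, 0)"
  by (simp_all add: elem_brace_def)

lemma order_cyc_brace: "order (cyc_brace p k) = p\<^sup>2"
  using nat_int[of "p\<^sup>2"] by (simp add: order_def)

lemma order_elem_brace: "order (elem_brace p k) = p\<^sup>2"
  by (simp add: order_def card_cartesian_product power2_eq_square)

context brace
begin

section \<open>Recognising the two families of order p^2\<close>

lemma int_pow_0: "[(0 :: int)] \<cdot> x = \<zero>"
  by (simp add: add_pow_def)

lemma int_pow_eq_iff:
  assumes "x \<in> carrier A" "add.ord x = n"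
  shows "[i] \<cdot> x = [j] \<cdot> x \<longleftrightarrow> [i = j] (mod int n)"
  using add.int_pow_eq[OF assms(1), of i j] assms(2) by (simp add: cong_iff_dvd_diff dvd_diff_commute)

text \<open>An element not killed by p has order p^2 here, so its multiples exhaust the
  group.\<close>

lemma cyc_brace_isoI:
  assumes p: "Factorial_Ring.prime p" "order A = p\<^sup>2" and g: "g \<in> carrier A" "[(int p)] \<cdot> g \<noteq> \<zero>"
    and mult: "\<And>i j :: int. [i] \<cdot> g \<otimes> [j] \<cdot> g = [(k * int p * i * j)] \<cdot> g"
  shows "brace_isomorphic (cyc_brace p k) A"
proof -
  have "add.ord g dvd p\<^sup>2"
    using add.ord_dvd_group_order[OF g(1)] p(2) by (simp add: order_def)
  then obtain i where i: "i \<le> 2" "add.ord g = p ^ i" using p(1) by (auto simp: divides_primepow_nat)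
  have "i = 2"
  proof (rule ccontr)
    assume "i \<noteq> 2"
    then have "add.ord g dvd p" using i le_imp_power_dvd[of i 1 p] by simp
    then have "[(int p)] \<cdot> g = \<zero>"
      using add.pow_eq_id[OF g(1), of p] by (simp add: add_pow_def int_pow_int)
    then show False using g(2) by simp
  qed
  then have eq: "[i] \<cdot> g = [j] \<cdot> g \<longleftrightarrow> [i = j] (mod (int p)\<^sup>2)" for i j
    using int_pow_eq_iff[OF g(1)] i(2) by simp
  let ?h = "\<lambda>i :: int. [i] \<cdot> g"
  have inj: "inj_on ?h (carrier (cyc_brace p k))"
    by (rule inj_onI) (auto simp: eq cong_def)
  have "?h ` carrier (cyc_brace p k) = carrier A"
  proof (rule card_subset_eq[OF finite_carrier])
    show "?h ` carrier (cyc_brace p k) \<subseteq> carrier A" using g by auto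
    show "card (?h ` carrier (cyc_brace p k)) = card (carrier A)"
      using order_cyc_brace[of p k] p(2) unfolding card_image[OF inj] by (simp add: order_def)
  qed
  then have "bij_betw ?h (carrier (cyc_brace p k)) (carrier A)" using inj by (simp add: bij_betw_def)
  moreover have "[(i mod (int p)\<^sup>2)] \<cdot> g = [i] \<cdot> g" for i by (simp add: eq)
  ultimately have "?h \<in> brace_iso (cyc_brace p k) A"
    using g(1) by (intro brace_isoI) (simp_all add: mult add.int_pow_mult)
  then show ?thesis by (rule brace_isomorphicI)
qed

text \<open>By Bezout, \<open>y\<close> is an integer combination of its \<open>m\<close>-fold and
  \<open>n\<close>-fold multiples.\<close>

lemma coprime_int_pow_mem:
  assumes F: "subgroup F (add_monoid A)" and y: "y \<in> carrier A"
    and "[m] \<cdot> y \<in> F" "[n] \<cdot> y \<in> F" "coprime (m :: int) n"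
  shows "y \<in> F"
proof -
  interpret F: subgroup F "add_monoid A" by fact
  obtain a b where ab: "a * m + b * n = 1"
    using assms(5) bezout_int[of m n] by (auto simp: coprime_iff_gcd_eq_1)
  have "y = [(m * a)] \<cdot> y \<oplus> [(n * b)] \<cdot> y"
    using y ab by (simp add: mult.commute flip: add.int_pow_mult)
  also have "\<dots> = [a] \<cdot> ([m] \<cdot> y) \<oplus> [b] \<cdot> ([n] \<cdot> y)" using y by (simp add: add.int_pow_pow)
  also have "\<dots> \<in> F"
    using F.m_closed add.subgroup_int_pow_closed[OF F] assms(3,4) by simp
  finally show ?thesis .
qed

lemma elem_brace_isoI:
  assumes p: "Factorial_Ring.prime p" "order A = p\<^sup>2"
    and ey: "e \<in> carrier A" "y \<in> carrier A" "[(int p)] \<cdot> e = \<zero>" "[(int p)] \<cdot> y = \<zero>" "e \<noteq> \<zero>"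
      "y \<notin> range (\<lambda>i :: int. [i] \<cdot> e)"
    and mult: "\<And>(i :: int) (j :: int) (i' :: int) (j' :: int). ([i] \<cdot> e \<oplus> [j] \<cdot> y) \<otimes> ([i'] \<cdot> e \<oplus> [j'] \<cdot> y) = [(k * j * j')] \<cdot> e"
  shows "brace_isomorphic (elem_brace p k) A"
proof -
  have "\<zero> = [(0 :: int)] \<cdot> e" by (simp add: int_pow_0)
  then have "y \<noteq> \<zero>" using ey(6) by auto
  then have oy: "add.ord y = p" using ord_eq_prime[OF p(1)] ey by simp
  have oe: "add.ord e = p" using ord_eq_prime[OF p(1)] ey by simp
  note eqe = int_pow_eq_iff[OF ey(1) oe] and eqy = int_pow_eq_iff[OF ey(2) oy]
  have R: "subgroup (range (\<lambda>i :: int. [i] \<cdot> e)) (add_monoid A)"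
  proof (rule add.subgroupI)
    fix a assume "a \<in> range (\<lambda>i :: int. [i] \<cdot> e)"
    then obtain i :: int where i: "a = [i] \<cdot> e" by auto
    have "[(- i)] \<cdot> e = \<ominus> a" using i add.int_pow_neg[OF ey(1), of i] by (simp add: a_inv_def)
    then show "\<ominus> a \<in> range (\<lambda>i :: int. [i] \<cdot> e)" by (metis rangeI)
    fix b assume "b \<in> range (\<lambda>i :: int. [i] \<cdot> e)"
    then obtain j :: int where j: "b = [j] \<cdot> e" by auto
    show "a \<oplus> b \<in> range (\<lambda>i :: int. [i] \<cdot> e)"
      using i j ey(1) by (auto simp flip: add.int_pow_mult)
  qed (use ey(1) in auto)
  let ?h = "\<lambda>(i :: int, j :: int). [i] \<cdot> e \<oplus> [j] \<cdot> y"
  have inj: "inj_on ?h (carrier (elem_brace p k))"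
  proof (rule inj_onI)
    fix u v assume "u \<in> carrier (elem_brace p k)" "v \<in> carrier (elem_brace p k)" and eq: "?h u = ?h v"
    then obtain i j i' j' where *: "u = (i, j)" "v = (i', j')" "0 \<le> i" "i < int p" "0 \<le> j" "j < int p"
      "0 \<le> i'" "i' < int p" "0 \<le> j'" "j' < int p" by auto
    have 1: "[(j - j')] \<cdot> y = [(i' - i)] \<cdot> e"
    proof -
      have "[i] \<cdot> e \<oplus> [j] \<cdot> y = [i'] \<cdot> e \<oplus> [j'] \<cdot> y" using eq * by simp
      then have "[j] \<cdot> y \<oplus> \<ominus> ([j'] \<cdot> y) = [i'] \<cdot> e \<oplus> \<ominus> ([i] \<cdot> e)"
        by (rule add_eq_swap) (use ey in auto)
      then show ?thesis using ey(1,2) by (simp add: add.int_pow_diff)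
    qed
    \<comment> \<open>Otherwise the multiples of \<open>y\<close> by \<open>j - j'\<close> and by
      \<open>p\<close>, coprime numbers, would both lie in the span of \<open>e\<close>, and with
      them \<open>y\<close>.\<close>
    have "j = j'"
    proof (rule ccontr)
      assume "j \<noteq> j'"
      then have "\<not> int p dvd j - j'" using * by (auto simp: cong_def simp flip: cong_iff_dvd_diff)
      then have "coprime (j - j') (int p)"
        using prime_imp_coprime[of "int p" "j - j'"] p(1) by (simp add: coprime_commute)
      moreover have "[(int p)] \<cdot> y \<in> range (\<lambda>i :: int. [i] \<cdot> e)" using subgroup.one_closed[OF R] ey(4) by simp
      ultimately have "y \<in> range (\<lambda>i :: int. [i] \<cdot> e)"
        using coprime_int_pow_mem[OF R ey(2), of "j - j'" "int p"] 1 by auto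
      then show False using ey(6) by simp
    qed
    moreover have "i = i'"
    proof -
      have "[i] \<cdot> e = [i'] \<cdot> e" using eq * \<open>j = j'\<close> ey(1,2) by simp
      then show ?thesis using * by (simp add: eqe cong_def)
    qed
    ultimately show "u = v" using * by simp
  qed
  have "?h ` carrier (elem_brace p k) = carrier A"
  proof (rule card_subset_eq[OF finite_carrier])
    show "?h ` carrier (elem_brace p k) \<subseteq> carrier A" using ey by auto
    show "card (?h ` carrier (elem_brace p k)) = card (carrier A)"
      using order_elem_brace[of p k] p(2) unfolding card_image[OF inj] by (simp add: order_def)
  qed
  then have bij: "bij_betw ?h (carrier (elem_brace p k)) (carrier A)" using inj by (simp add: bij_betw_def)
  have me: "[(i mod int p)] \<cdot> e = [i] \<cdot> e" "[(i mod int p)] \<cdot> y = [i] \<cdot> y" for i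
    by (simp_all add: eqe eqy)
  have "?h (u \<oplus>\<^bsub>elem_brace p k\<^esub> v) = ?h u \<oplus> ?h v" for u v
    using ey(1,2) by (cases u; cases v) (simp add: me add.int_pow_mult a_ac)
  moreover have "?h (u \<otimes>\<^bsub>elem_brace p k\<^esub> v) = ?h u \<otimes> ?h v" for u v
    using ey(1,2) by (cases u; cases v) (simp add: me mult int_pow_0)
  ultimately have "?h \<in> brace_iso (elem_brace p k) A"
    using bij by (intro brace_isoI)
  then show ?thesis by (rule brace_isomorphicI)
qed


section \<open>Classification at order p^2\<close>

lemma card_fixp_p2:
  assumes p: "Factorial_Ring.prime p" "order A = p\<^sup>2"
  shows "card (fixp (carrier A) (carrier A)) = p \<or> fixp (carrier A) (carrier A) = carrier A"
proof -
  let ?F = "fixp (carrier A) (carrier A)"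
  have card: "card (carrier A) = p ^ 2" using p(2) by (simp add: order_def)
  have "[card ?F = p\<^sup>2] (mod p)"
    using card_fixp(1)[OF add.subgroup_self _ add.subgroup_self _ p(1) card] lam_closed card by simp
  then have "p dvd card ?F" by (simp add: cong_def mod_eq_0_iff_dvd)
  moreover have "card ?F dvd p ^ 2"
    using card_fixp(2)[OF add.subgroup_self _ add.subgroup_self _ p(1) card] lam_closed card by simp
  then obtain i where i: "i \<le> 2" "card ?F = p ^ i" using p(1) by (auto simp: divides_primepow_nat)
  moreover have "i \<noteq> 0"
  proof
    assume "i = 0"
    then show False using calculation p(1) by simp
  qed
  ultimately have "i = 1 \<or> i = 2" by auto
  then show ?thesis
  proof
    assume "i = 2"
    then have "?F = carrier A"
      using i card finite_carrier by (intro card_subset_eq) (auto simp: fixp_def)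
    then show ?thesis ..
  qed (use i in simp)
qed

text \<open>Only the additive group matters. Either some element is not killed by p and generates
  it, or p kills everything and any \<open>y\<close> outside the at most p multiples of a nonzero
  \<open>e\<close> completes a basis.\<close>

lemma trivial_brace_p2:
  assumes p: "Factorial_Ring.prime p" "order A = p\<^sup>2"
    and triv: "\<And>x y. x \<in> carrier A \<Longrightarrow> y \<in> carrier A \<Longrightarrow> x \<otimes> y = \<zero>"
  shows "brace_isomorphic (cyc_brace p 0) A \<or> brace_isomorphic (elem_brace p 0) A"
proof (cases "\<exists>g \<in> carrier A. [(int p)] \<cdot> g \<noteq> \<zero>")
  case True
  then obtain g where g: "g \<in> carrier A" "[(int p)] \<cdot> g \<noteq> \<zero>" by auto
  have "brace_isomorphic (cyc_brace p 0) A"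
    by (rule cyc_brace_isoI[OF p g]) (use g triv in \<open>simp add: int_pow_0\<close>)
  then show ?thesis ..
next
  case False
  have card: "card (carrier A) = p\<^sup>2" using p(2) by (simp add: order_def)
  have p1: "1 < p" using p(1) by (rule prime_gt_1_nat)
  have "\<not> carrier A \<subseteq> {\<zero>}"
  proof
    assume "carrier A \<subseteq> {\<zero>}"
    then have "card (carrier A) \<le> card {\<zero>}" by (intro card_mono) auto
    then show False using one_less_power[OF p1, of 2] card by simp
  qed
  then obtain e where e: "e \<in> carrier A" "e \<noteq> \<zero>" by auto
  have ee: "range (\<lambda>i :: int. [i] \<cdot> e) \<subseteq> (\<lambda>i. [i] \<cdot> e) ` {0..<int p}"
  proof (clarify)
    fix i :: int
    have "[(int p * (i div int p))] \<cdot> e = \<zero>"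
      using False e add.int_pow_pow[OF e(1), of "i div int p" "int p"] int_pow_zero by simp
    then have "[i] \<cdot> e = [(i mod int p)] \<cdot> e"
      using add.int_pow_mult[OF e(1), of "int p * (i div int p)" "i mod int p"] e by simp
    then show "[i] \<cdot> e \<in> (\<lambda>i. [i] \<cdot> e) ` {0..<int p}" using p1 by auto
  qed
  have "\<not> carrier A \<subseteq> range (\<lambda>i :: int. [i] \<cdot> e)"
  proof
    assume "carrier A \<subseteq> range (\<lambda>i :: int. [i] \<cdot> e)"
    then have "card (carrier A) \<le> card ((\<lambda>i. [i] \<cdot> e) ` {0..<int p})" using ee by (intro card_mono) auto
    also have "\<dots> \<le> p" using card_image_le[of "{0..<int p}" "\<lambda>i. [i] \<cdot> e"] by simp
    finally show False using card p1 by (simp add: power2_eq_square)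
  qed
  then obtain y where y: "y \<in> carrier A" "y \<notin> range (\<lambda>i :: int. [i] \<cdot> e)" by auto
  have "brace_isomorphic (elem_brace p 0) A"
  proof (rule elem_brace_isoI[OF p e(1) y(1) _ _ e(2) y(2)])
    show "[(int p)] \<cdot> e = \<zero>" "[(int p)] \<cdot> y = \<zero>" using False e y by auto
    show "([i] \<cdot> e \<oplus> [j] \<cdot> y) \<otimes> ([i'] \<cdot> e \<oplus> [j'] \<cdot> y) = [(0 * j * j')] \<cdot> e" for i j i' j' :: int
      using e(1) y(1) by (simp add: int_pow_0 triv)
  qed
  then show ?thesis ..
qed

text \<open>For \<open>card F = p\<close>: each \<open>lam A a\<close> acts on \<open>A/F\<close> as multiplication by some \<open>n\<close> with
  \<open>n^(p\<^sup>2) = 1\<close>, so \<open>n = 1\<close> by Fermat and all products lie in \<open>F\<close>; then \<open>F\<close> also annihilates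
  from the left, and the product is a bilinear form on \<open>A/F\<close> with values in \<open>F\<close>.\<close>

lemma nontrivial_brace_p2:
  assumes p: "Factorial_Ring.prime p" "order A = p\<^sup>2" and cardF: "card (fixp (carrier A) (carrier A)) = p"
  shows "brace_isomorphic (cyc_brace p 1) A \<or> brace_isomorphic (elem_brace p 1) A"
proof -
  define F where "F = fixp (carrier A) (carrier A)"
  have F: "subgroup F (add_monoid A)"
    unfolding F_def by (rule fixp_subgroup[OF _ add.subgroup_self]) simp
  interpret F: subgroup F "add_monoid A" by fact
  have cF: "card F = p" using cardF by (simp add: F_def)
  have FA: "f \<in> carrier A" if "f \<in> F" for f using F.subset that by auto
  have Fadd: "f \<oplus> g \<in> F" if "f \<in> F" "g \<in> F" for f g using F.m_closed that by simp
  have Fneg: "\<ominus> f \<in> F" if "f \<in> F" for f using F.m_inv_closed that by (simp add: a_inv_def)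
  have Fpow: "[i] \<cdot> f \<in> F" if "f \<in> F" for f and i :: int
    using add.subgroup_int_pow_closed[OF F that] .
  have Ffix: "lam A a f = f" if "a \<in> carrier A" "f \<in> F" for a f
    using that by (auto simp: F_def fixp_def)
  have multF: "a \<otimes> f = \<zero>" if "a \<in> carrier A" "f \<in> F" for a f
    using lam_eq_mult_zero[OF that(1) FA[OF that(2)]] Ffix[OF that] .
  have p1: "1 < p" using p(1) by (rule prime_gt_1_nat)
  have cA: "card (carrier A) = p\<^sup>2" using p(2) by (simp add: order_def)
  have "\<not> carrier A \<subseteq> F"
  proof
    assume "carrier A \<subseteq> F"
    then have "card (carrier A) \<le> card F"
      using F.subset finite_carrier by (intro card_mono) (auto intro: finite_subset)
    then show False using cF cA p1 by (simp add: power2_eq_square)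
  qed
  then obtain y where y: "y \<in> carrier A" "y \<notin> F" by auto
  have pow2: "[(int p)\<^sup>2] \<cdot> y = \<zero>"
    using add.pow_order_eq_1[OF y(1)] cA by (simp add: order_def add_pow_def flip: int_pow_int)
  \<comment> \<open>The class of \<open>y\<close> has order exactly p in the quotient by
    \<open>F\<close>: a multiplier prime to p could be combined with p^2, which kills
    \<open>y\<close>.\<close>
  have ydvd: "int p dvd m" if m: "[m] \<cdot> y \<in> F" for m
  proof (rule ccontr)
    assume "\<not> int p dvd m"
    then have "coprime m ((int p)\<^sup>2)"
      using prime_imp_coprime[of "int p" m] p(1) by (simp add: coprime_commute)
    then show False
      using coprime_int_pow_mem[OF F y(1) m, of "(int p)\<^sup>2"] pow2 F.one_closed y(2) by simp
  qed
  \<comment> \<open>The p multiples of \<open>y\<close> represent the cosets of \<open>F\<close>: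
    they are distinct modulo \<open>F\<close> by \<open>ydvd\<close>, and there are p^2 / p
    cosets.\<close>
  have repr: "\<exists>(m :: int) f. a = [m] \<cdot> y \<oplus> f \<and> f \<in> F \<and> 0 \<le> m \<and> m < int p" if a: "a \<in> carrier A" for a
  proof -
    let ?h = "\<lambda>(m :: int, f). [m] \<cdot> y \<oplus> f"
    have inj: "inj_on ?h ({0..<int p} \<times> F)"
    proof (rule inj_onI; clarsimp)
      fix m f m' f' assume *: "0 \<le> m" "m < int p" "f \<in> F" "0 \<le> m'" "m' < int p" "f' \<in> F"
        and eq: "[m] \<cdot> y \<oplus> f = [m'] \<cdot> y \<oplus> f'"
      have "f \<oplus> [m] \<cdot> y = f' \<oplus> [m'] \<cdot> y" using eq * y(1) by (simp add: a_comm FA)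
      then have "[m] \<cdot> y \<oplus> \<ominus> ([m'] \<cdot> y) = f' \<oplus> \<ominus> f"
        by (rule add_eq_swap) (use * y(1) FA in auto)
      then have "[(m - m')] \<cdot> y \<in> F"
        using y(1) Fadd Fneg * by (simp add: add.int_pow_diff)
      then have "[m = m'] (mod int p)" using ydvd by (simp add: cong_iff_dvd_diff)
      then have "m = m'" using * by (simp add: cong_def)
      then show "m = m' \<and> f = f'" using eq * y(1) FA by simp
    qed
    have "?h ` ({0..<int p} \<times> F) = carrier A"
      by (rule card_subset_eq[OF finite_carrier])
         (use y(1) FA cF cA in \<open>auto simp: card_image[OF inj] card_cartesian_product power2_eq_square\<close>)
    then have "a \<in> ?h ` ({0..<int p} \<times> F)" using a by simp
    then obtain u where u: "u \<in> {0..<int p} \<times> F" "a = ?h u" by (rule imageE)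
    then show ?thesis by (intro exI[of _ "fst u"] exI[of _ "snd u"]) (auto split: prod.splits)
  qed
  \<comment> \<open>Writing the p-fold multiple as that by \<open>m\<close> plus an element of
    \<open>F\<close>, with \<open>m\<close> below p, puts the multiple by \<open>p - m\<close> into
    \<open>F\<close>; so p divides \<open>m\<close> and \<open>m = 0\<close>.\<close>
  have py: "[(int p)] \<cdot> y \<in> F"
  proof -
    obtain m :: int and f where mf: "[(int p)] \<cdot> y = [m] \<cdot> y \<oplus> f" "f \<in> F" "0 \<le> m" "m < int p"
      using repr[of "[(int p)] \<cdot> y"] y(1) by auto
    have "[(int p - m)] \<cdot> y = f \<oplus> [m] \<cdot> y \<oplus> \<ominus> ([m] \<cdot> y)"
      using y(1) FA[OF mf(2)] by (simp add: add.int_pow_diff mf(1) a_comm)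
    also have "\<dots> = f" using y(1) FA[OF mf(2)] by (simp add: a_assoc r_neg)
    finally have "int p dvd int p - m" using ydvd[of "int p - m"] mf(2) by simp
    then have "int p dvd int p - (int p - m)" by (rule dvd_diff[OF dvd_refl])
    then have "int p dvd m" by simp
    then have "m = 0" using zdvd_not_zless[of m "int p"] mf(3,4) by linarith
    then show ?thesis using mf FA[OF mf(2)] by (simp add: int_pow_0)
  qed
  have multy: "a \<otimes> y \<in> F" if a: "a \<in> carrier A" for a
  proof -
    obtain n :: int and f where nf: "lam A a y = [n] \<cdot> y \<oplus> f" "f \<in> F" "0 \<le> n" "n < int p"
      using repr[OF lam_closed[OF a y(1)]] by auto
    let ?C = "circle_group A (carrier A)"
    interpret C: group ?C by (rule circle_group)
    have aC: "a [^]\<^bsub>?C\<^esub> j \<in> carrier A" for j :: nat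
      using C.nat_pow_closed[of a j] a by (simp add: circle_group_def)
    \<comment> \<open>Modulo \<open>F\<close>, the j-th circle power of \<open>a\<close> multiplies
      \<open>y\<close> by \<open>n ^ j\<close>, the error terms staying in \<open>F\<close> because
      \<open>F\<close> is fixed pointwise. At j = p^2 the circle power is zero and acts as the
      identity.\<close>
    have "\<exists>f \<in> F. lam A (a [^]\<^bsub>?C\<^esub> j) y = [(n ^ j)] \<cdot> y \<oplus> f" for j :: nat
    proof (induction j)
      case 0
      then show ?case using y(1) F.one_closed by (auto simp: circle_group_def lam_zero_left intro!: bexI[of _ \<zero>])
    next
      case (Suc j)
      then obtain g where g: "g \<in> F" "lam A (a [^]\<^bsub>?C\<^esub> j) y = [(n ^ j)] \<cdot> y \<oplus> g" by auto
      have "lam A (a [^]\<^bsub>?C\<^esub> Suc j) y = lam A (a [^]\<^bsub>?C\<^esub> j) (lam A a y)"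
        using a aC y(1) by (simp add: lam_circle[symmetric]) (simp add: circle_group_def)
      also have "\<dots> = [n] \<cdot> ([(n ^ j)] \<cdot> y \<oplus> g) \<oplus> f"
        using nf g y(1) aC FA by (simp add: lam_add lam_int_pow Ffix)
      also have "\<dots> = [(n ^ Suc j)] \<cdot> y \<oplus> ([n] \<cdot> g \<oplus> f)"
        using g nf y(1) FA by (simp add: add.int_pow_distrib add.int_pow_pow a_assoc mult.commute)
      finally show ?case using Fadd Fpow g nf by blast
    qed
    then obtain g where g: "g \<in> F" "lam A (a [^]\<^bsub>?C\<^esub> p\<^sup>2) y = [(n ^ p\<^sup>2)] \<cdot> y \<oplus> g" by blast
    have "a [^]\<^bsub>?C\<^esub> p\<^sup>2 = \<zero>"
      using C.pow_order_eq_1[of a] a cA by (simp add: order_def circle_group_def)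
    then have "y = [(n ^ p\<^sup>2)] \<cdot> y \<oplus> g" using g(2) y(1) by (simp add: lam_zero_left)
    then have "[(1 :: int)] \<cdot> y \<oplus> \<zero> = [(n ^ p\<^sup>2)] \<cdot> y \<oplus> g" using y(1) by simp
    then have "\<zero> \<oplus> \<ominus> g = [(n ^ p\<^sup>2)] \<cdot> y \<oplus> \<ominus> ([(1 :: int)] \<cdot> y)"
      by (rule add_eq_swap) (use y(1) g FA in auto)
    then have "[(n ^ p\<^sup>2 - 1)] \<cdot> y = \<ominus> g"
      using y(1) g FA by (simp add: add.int_pow_diff)
    then have "[(n ^ p\<^sup>2 - 1)] \<cdot> y \<in> F" using Fneg[OF g(1)] by simp
    then have d: "[n ^ p\<^sup>2 = 1] (mod int p)" using ydvd by (simp add: cong_iff_dvd_diff)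
    have fermat: "[m ^ p = m] (mod int p)" for m :: int
    proof (cases "int p dvd m")
      case True
      then have "int p dvd m ^ p" using dvd_trans[OF True dvd_power[of p m]] p1 by simp
      then show ?thesis using True by (simp add: cong_def dvd_imp_mod_0)
    next
      case False
      have "[nat (m mod int p) ^ (p - 1) = 1] (mod p)"
        using fermat_theorem[OF p(1), of "nat (m mod int p)"] False p1
        by (metis dvd_eq_mod_eq_0 int_dvd_int_iff mod_mod_trivial nat_0_le pos_mod_sign of_nat_0_less_iff prime_gt_0_nat p(1))
      then have "[int (nat (m mod int p) ^ (p - 1)) = int 1] (mod int p)" by (simp only: cong_int_iff)
      then have "[(m mod int p) ^ (p - 1) = 1] (mod int p)" using p1 by simp
      then have "[m ^ (p - 1) = 1] (mod int p)" by (simp add: cong_def power_mod)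
      then have "[m * m ^ (p - 1) = m * 1] (mod int p)" by (rule cong_scalar_left)
      then show ?thesis using p1 by (simp flip: power_Suc)
    qed
    \<comment> \<open>Fermat in the form m^p = m, applied twice, covers multiples of p as well; it
      turns n^(p^2) = 1 into n = 1.\<close>
    have "[n ^ p\<^sup>2 = n] (mod int p)"
      using cong_trans[OF cong_pow[OF fermat[of n], of p] fermat[of n]]
      by (simp add: power2_eq_square power_mult)
    then have "[n = 1] (mod int p)" using d cong_trans cong_sym by blast
    then have "n = 1" using nf p1 by (simp add: cong_def)
    then have "a \<otimes> y \<oplus> y = f \<oplus> y" using nf y(1) FA by (simp add: lam_def a_comm)
    then have "a \<otimes> y = f" using a y(1) nf FA by (simp add: mult_closed)
    then show ?thesis using nf by simp
  qed
  have multA: "a \<otimes> b \<in> F" if ab: "a \<in> carrier A" "b \<in> carrier A" for a b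
  proof -
    obtain m :: int and f where "b = [m] \<cdot> y \<oplus> f" "f \<in> F" using repr[OF ab(2)] by auto
    then have "a \<otimes> b = [m] \<cdot> (a \<otimes> y)"
      using ab(1) y(1) FA by (simp add: left_distrib multF mult_int_pow mult_closed)
    then show ?thesis using Fpow multy[OF ab(1)] by simp
  qed
  \<comment> \<open>The term with the iterated product vanishes in the circle axiom, because inner
    products lie in \<open>F\<close> and \<open>F\<close> annihilates from the right.\<close>
  have circ: "circle A a b \<otimes> c = a \<otimes> c \<oplus> b \<otimes> c"
    if "a \<in> carrier A" "b \<in> carrier A" "c \<in> carrier A" for a b c
    using circle_mult[OF that] that by (simp add: circle_def multF multA mult_closed)
  have addF: "(x \<oplus> f) \<otimes> c = x \<otimes> c \<oplus> f \<otimes> c" if "x \<in> carrier A" "f \<in> F" "c \<in> carrier A" for x f c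
    using circ[of x f c] that FA by (simp add: circle_def multF)
  \<comment> \<open>The circle product of \<open>f\<close> and \<open>x\<close> is \<open>x\<close>
    plus an element of \<open>F\<close>; multiplying it by \<open>c\<close> once with
    \<open>circ\<close> and once with \<open>addF\<close> leaves only the iterated product.\<close>
  have ann: "(f \<otimes> x) \<otimes> c = \<zero>" if "f \<in> F" "x \<in> carrier A" "c \<in> carrier A" for f x c
  proof -
    have fx: "f \<otimes> x \<in> F" using multA FA that by simp
    have "circle A f x = x \<oplus> (f \<otimes> x \<oplus> f)" using that FA by (simp add: circle_def mult_closed a_comm)
    then have "f \<otimes> c \<oplus> x \<otimes> c = x \<otimes> c \<oplus> ((f \<otimes> x) \<otimes> c \<oplus> f \<otimes> c)"
      using circ[OF FA[OF that(1)] that(2,3)] addF[OF that(2) Fadd[OF fx that(1)] that(3)]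
        addF[OF FA[OF fx] that(1,3)] by simp
    then have "x \<otimes> c \<oplus> f \<otimes> c \<oplus> \<zero> = x \<otimes> c \<oplus> f \<otimes> c \<oplus> (f \<otimes> x) \<otimes> c"
      using that FA by (simp add: mult_closed a_ac)
    then show ?thesis using that FA by (simp add: mult_closed)
  qed
  \<comment> \<open>If the product \<open>?w\<close> were nonzero it would generate
    \<open>F\<close>, which has prime order. By \<open>ann\<close> and additivity on
    \<open>F\<close> all multiples of \<open>?w\<close>, among them \<open>f\<close>, annihilate
    \<open>x\<close>, a contradiction.\<close>
  have Fmult: "f \<otimes> x = \<zero>" if fx: "f \<in> F" "x \<in> carrier A" for f x
  proof (rule ccontr)
    assume nz: "f \<otimes> x \<noteq> \<zero>"
    let ?w = "f \<otimes> x"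
    have w: "?w \<in> F" using multA FA fx by simp
    have "[(int j)] \<cdot> ?w \<otimes> x = \<zero>" for j :: nat
    proof (induction j)
      case 0
      then show ?case using fx by (simp add: int_pow_0 zero_mult)
    next
      case (Suc j)
      have "[(int (Suc j))] \<cdot> ?w = [(int j)] \<cdot> ?w \<oplus> ?w"
        using add.int_pow_mult[OF FA[OF w], of "int j" 1] FA[OF w] by (simp add: add.commute)
      then show ?case using Suc addF[OF _ w fx(2), of "[(int j)] \<cdot> ?w"] ann[OF fx fx(2)] FA[OF w] by simp
    qed
    moreover obtain i :: int where "0 \<le> i" "f = [i] \<cdot> ?w"
      using prime_subgroup_generator(2)[OF F cF p(1) w nz] fx(1) by auto
    then have "f = [(int (nat i))] \<cdot> ?w" by simp
    ultimately have "f \<otimes> x = \<zero>" by metis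
    then show False using nz by simp
  qed
  \<comment> \<open>The circle product differs from the sum by an element of \<open>F\<close>, which
    now also annihilates from the left.\<close>
  have addl: "(a \<oplus> b) \<otimes> c = a \<otimes> c \<oplus> b \<otimes> c" if "a \<in> carrier A" "b \<in> carrier A" "c \<in> carrier A" for a b c
  proof -
    have "circle A a b = (a \<oplus> b) \<oplus> a \<otimes> b" using that by (simp add: circle_def mult_closed a_ac)
    then show ?thesis
      using circ[OF that] addF[of "a \<oplus> b" "a \<otimes> b" c] that by (simp add: multA Fmult mult_closed)
  qed
  have powl: "[i] \<cdot> a \<otimes> c = [i] \<cdot> (a \<otimes> c)" if "a \<in> carrier A" "c \<in> carrier A" for a c and i :: int
    using that abelian_group_axioms by (intro add_hom_int_pow[where f = "\<lambda>a. a \<otimes> c"]) (auto simp: mult_closed addl)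
  \<comment> \<open>As \<open>y\<close> spans the quotient by \<open>F\<close>, this single value
    determines the bilinear form. It is nonzero, for otherwise \<open>y\<close> would be a fixed
    point.\<close>
  define e where "e = y \<otimes> y"
  have e: "e \<in> F" "e \<in> carrier A" using multA y(1) FA by (auto simp: e_def)
  have form: "([i] \<cdot> y \<oplus> f) \<otimes> ([j] \<cdot> y \<oplus> g) = [(i * j)] \<cdot> e" if "f \<in> F" "g \<in> F" for i j :: int and f g
    using that y(1) FA
    by (simp add: addl left_distrib Fmult multF powl mult_int_pow add.int_pow_pow mult_closed e_def[symmetric] e mult.commute)
  have e0: "e \<noteq> \<zero>"
  proof
    assume "e = \<zero>"
    have "lam A a y = y" if aA: "a \<in> carrier A" for a
    proof -
      obtain m :: int and f where "a = [m] \<cdot> y \<oplus> f" "f \<in> F" using repr[OF aA] by auto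
      then have "a \<otimes> y = \<zero>"
        using form[of f \<zero> m 1] F.one_closed y(1) \<open>e = \<zero>\<close> by (simp add: int_pow_zero)
      then show ?thesis using aA y(1) by (simp add: lam_eq_iff)
    qed
    then have "y \<in> F" using y(1) by (simp add: F_def fixp_def)
    then show False using y(2) by simp
  qed
  have orde: "add.ord e = p" and Fe: "F = (\<lambda>i. [i] \<cdot> e) ` {0..<int p}"
    using prime_subgroup_generator[OF F cF p(1) e(1) e0] by auto
  have pe: "[(int p)] \<cdot> e = \<zero>"
    using int_pow_eq_iff[OF e(2) orde, of "int p" 0] by (simp add: int_pow_0 cong_def)
  show ?thesis
  proof (cases "[(int p)] \<cdot> y = \<zero>")
    case True
    have "brace_isomorphic (elem_brace p 1) A"
    proof (rule elem_brace_isoI[OF p e(2) y(1) pe True e0])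
      show "y \<notin> range (\<lambda>i :: int. [i] \<cdot> e)" using Fpow[OF e(1)] y(2) by auto
      show "([i] \<cdot> e \<oplus> [j] \<cdot> y) \<otimes> ([i'] \<cdot> e \<oplus> [j'] \<cdot> y) = [(1 * j * j')] \<cdot> e" for i j i' j' :: int
      proof -
        have "[i] \<cdot> e \<oplus> [j] \<cdot> y = [j] \<cdot> y \<oplus> [i] \<cdot> e" for i j :: int
          using y(1) e(2) by (simp add: a_comm)
        then show ?thesis using form[OF Fpow[OF e(1), of i] Fpow[OF e(1), of i'], of j j'] by simp
      qed
    qed
    then show ?thesis ..
  next
    case False
    obtain k :: int where k: "e = [k] \<cdot> ([(int p)] \<cdot> y)"
      using prime_subgroup_generator(2)[OF F cF p(1) py False] e(1) by auto
    have ppy: "[(int p * int p * i)] \<cdot> y = \<zero>" for i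
      using pow2 add.int_pow_pow[OF y(1), of i "(int p)\<^sup>2"] by (simp add: power2_eq_square int_pow_zero)
    have "\<not> int p dvd k"
    proof
      assume "int p dvd k"
      then obtain l where "k = int p * l" by auto
      then have "e = \<zero>" using k y(1) ppy[of l] by (simp add: add.int_pow_pow mult_ac)
      then show False using e0 by simp
    qed
    then have "coprime k (int p)" using prime_imp_coprime[of "int p" k] p(1) by (simp add: coprime_commute)
    then obtain u where u: "[k * u = 1] (mod int p)" using cong_solve_coprime_int by blast
    then obtain v where v: "k * u = 1 + int p * v" by (metis cong_iff_lin cong_sym)
    \<comment> \<open>Normalises the constant \<open>k\<close> to 1: the square of \<open>u\<close>
      times \<open>y\<close> is u^2 k p y = u p y, that is, p times the new generator, since k u = 1
      modulo p and p^2 kills \<open>y\<close>.\<close>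
    let ?g = "[u] \<cdot> y"
    have "brace_isomorphic (cyc_brace p 1) A"
    proof (rule cyc_brace_isoI[OF p])
      show "?g \<in> carrier A" using y(1) by simp
      have ku: "[(int p * (k * u))] \<cdot> y = [(int p)] \<cdot> y"
        using ppy[of v] y(1) unfolding v by (simp add: distrib_left add.int_pow_mult mult.assoc)
      show "[(int p)] \<cdot> ?g \<noteq> \<zero>"
      proof
        assume "[(int p)] \<cdot> ?g = \<zero>"
        then have "[k] \<cdot> ([(int p)] \<cdot> ?g) = \<zero>" by (simp add: int_pow_zero)
        then show False using ku False y(1) by (simp add: add.int_pow_pow mult_ac)
      qed
      fix i j :: int
      have "[i] \<cdot> ?g \<otimes> [j] \<cdot> ?g = [(u * i * (u * j))] \<cdot> e"
        using form[of \<zero> \<zero> "u * i" "u * j"] F.one_closed y(1) by (simp add: add.int_pow_pow)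
      also have "\<dots> = [(u * i * j)] \<cdot> ([(int p * (k * u))] \<cdot> y)"
        using y(1) by (simp add: k add.int_pow_pow mult_ac)
      also have "\<dots> = [(1 * int p * i * j)] \<cdot> ?g"
        unfolding ku using y(1) by (simp add: add.int_pow_pow mult_ac)
      finally show "[i] \<cdot> ?g \<otimes> [j] \<cdot> ?g = [(1 * int p * i * j)] \<cdot> ?g" .
    qed
    then show ?thesis ..
  qed
qed

lemma brace_p2_classification:
  assumes p: "Factorial_Ring.prime p" "order A = p\<^sup>2"
  shows "\<exists>k \<in> {0, 1}. brace_isomorphic (cyc_brace p k) A \<or> brace_isomorphic (elem_brace p k) A"
  using card_fixp_p2[OF p]
proof
  assume "card (fixp (carrier A) (carrier A)) = p"
  then show ?thesis using nontrivial_brace_p2[OF p] by blast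
next
  assume "fixp (carrier A) (carrier A) = carrier A"
  then have "x \<otimes> y = \<zero>" if "x \<in> carrier A" "y \<in> carrier A" for x y
    using that by (intro lam_eq_mult_zero) (auto simp: fixp_def)
  then show ?thesis using trivial_brace_p2[OF p] by blast
qed

end

section \<open>Powers of units of \<open>Z_q\<close>\<close>

lemma C2_eq: "2 * C2 n = n * (n - 1)"
  unfolding C2_def by (simp add: even_mult_iff)

text \<open>The failure of additivity is exactly the product. This is why \<open>C2\<close> corrects
  the circle operations below.\<close>

lemma C2_add: "C2 (m + n) = C2 m + C2 n + m * n"
proof -
  have "2 * C2 (m + n) = 2 * (C2 m + C2 n + m * n)"
    unfolding distrib_left C2_eq by (simp add: algebra_simps)
  then show ?thesis by simp
qed

lemma C2_0 [simp]: "C2 0 = 0" and C2_1 [simp]: "C2 1 = 0"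
  by (simp_all add: C2_def)

text \<open>Twice \<open>C2\<close> is a polynomial, and 2 cancels for an odd modulus; so
  \<open>C2\<close> makes sense on residues.\<close>

lemma C2_cong:
  assumes "odd p" "[m = n] (mod p)"
  shows "[C2 m = C2 n] (mod p)"
proof -
  have "[2 * C2 m = 2 * C2 n] (mod p)"
    unfolding C2_eq using assms(2) by (simp add: cong_mult cong_diff)
  then show ?thesis using assms(1) cong_mult_lcancel[of 2 p "C2 m" "C2 n"] by simp
qed

lemma (in monoid) units_of_nat_pow: "x [^]\<^bsub>units_of G\<^esub> (n :: nat) = x [^] n"
  by (simp add: nat_pow_def units_of_mult units_of_one)

text \<open>The named braces use powers in the ring Z_q, while orders and exponent laws are
  available in its group of units.\<close>

lemma (in monoid) units_of_int_pow:
  assumes "x \<in> Units G"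
  shows "x [^]\<^bsub>units_of G\<^esub> (z :: int) = x [^] z"
  unfolding int_pow_def2 units_of_nat_pow units_of_inv[OF Units_pow_closed[OF assms]] ..

lemma (in group) int_pow_cong:
  assumes "x \<in> carrier G" "x [^] (n :: int) = \<one>" "[i = j] (mod n)"
  shows "x [^] i = x [^] j"
proof -
  have "int (ord x) dvd n" using int_pow_eq[OF assms(1), of n 0] assms(2) by simp
  then have "[i = j] (mod int (ord x))" using assms(3) cong_dvd_modulus by blast
  then show ?thesis using int_pow_eq[OF assms(1), of i j] by (simp add: cong_iff_dvd_diff dvd_diff_commute)
qed

locale prime_modulus =
  fixes q :: nat
  assumes q: "Factorial_Ring.prime q"
begin

abbreviation "Zq \<equiv> residue_ring (int q)"
abbreviation "U \<equiv> units_of Zq"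
abbreviation int_power_U :: "int \<Rightarrow> int \<Rightarrow> int" (infixr \<open>\<up>\<close> 75)
  where "w \<up> z \<equiv> w [^]\<^bsub>U\<^esub> z"

sublocale R: residues_prime q Zq
  by unfold_locales (use q in simp_all)

sublocale U: comm_group U
  by (rule R.units_comm_group)

lemma q_gt_1: "1 < int q"
  using q prime_gt_1_nat by simp

lemma carrier_U: "carrier U = {0<..<int q}"
  unfolding units_of_carrier R.res_prime_units_eq by auto

lemma mult_U [simp]: "x \<otimes>\<^bsub>U\<^esub> y = x * y mod int q"
  by (simp add: units_of_mult residue_ring_def)

lemma one_U [simp]: "\<one>\<^bsub>U\<^esub> = 1"
  by (simp add: units_of_one residue_ring_def)

lemma brace_char_iff_U:
  "brace_char P q \<chi> \<longleftrightarrow> (\<forall>x \<in> carrier P. \<chi> x \<in> carrier U) \<and>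
     (\<forall>x \<in> carrier P. \<forall>y \<in> carrier P. \<chi> (circle P x y) = \<chi> x \<otimes>\<^bsub>U\<^esub> \<chi> y)"
  by (auto simp: brace_char_def carrier_U)

lemma int_pow_U: "w \<in> carrier U \<Longrightarrow> w \<up> (z :: int) = w [^]\<^bsub>Zq\<^esub> z"
  by (simp add: R.units_of_int_pow units_of_carrier)

end

section \<open>The two families of order \<open>p\<^sup>2\<close> and their characters\<close>

locale odd_prime =
  fixes p :: nat
  assumes p: "Factorial_Ring.prime p" and odd_p: "odd p"
begin

lemma p_gt_1: "1 < int p"
  using p prime_gt_1_nat by simp

lemma circle_cyc: "circle (cyc_brace p k) x y = (k * int p * x * y + x + y) mod (int p)\<^sup>2"
  by (simp add: circle_def mod_simps)

lemma circle_elem: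
  "circle (elem_brace p k) (x, y) (x', y') = ((k * y * y' + x + x') mod int p, (y + y') mod int p)"
  by (simp add: circle_def mod_simps)

lemma brace_cyc_brace: "brace (cyc_brace p k)"
proof -
  let ?P = "cyc_brace p k" and ?n = "(int p)\<^sup>2"
  have n0: "0 < ?n" using p_gt_1 by simp
  have ab: "abelian_group ?P"
  proof (rule abelian_groupI)
    fix x assume "x \<in> carrier ?P"
    then show "\<exists>y \<in> carrier ?P. y \<oplus>\<^bsub>?P\<^esub> x = \<zero>\<^bsub>?P\<^esub>"
      using n0 by (intro bexI[of _ "(- x) mod ?n"]) (auto simp: mod_simps)
  qed (use n0 in \<open>auto simp: mod_simps add_ac\<close>)
  show ?thesis
  proof (intro brace.intro ab brace_axioms.intro)
    fix a assume "a \<in> carrier ?P"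
    have inj: "inj_on (\<lambda>x. a \<otimes>\<^bsub>?P\<^esub> x \<oplus>\<^bsub>?P\<^esub> x) (carrier ?P)"
    proof (rule inj_onI)
      fix x y assume xy: "x \<in> carrier ?P" "y \<in> carrier ?P"
        and "a \<otimes>\<^bsub>?P\<^esub> x \<oplus>\<^bsub>?P\<^esub> x = a \<otimes>\<^bsub>?P\<^esub> y \<oplus>\<^bsub>?P\<^esub> y"
      then have "[(k * int p * a + 1) * x = (k * int p * a + 1) * y] (mod ?n)"
        by (simp add: cong_def mod_simps distrib_right)
      \<comment> \<open>The map \<open>lam\<close> of \<open>a\<close> is multiplication by 1 + k p
        a, a unit modulo p^2.\<close>
      moreover have "coprime (1 + int p * (k * a)) (int p)"
        by (metis coprime_add_one_left coprime_commute coprime_mult_left_iff add.commute)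
      then have "coprime (k * int p * a + 1) ?n" by (simp add: ac_simps)
      ultimately have "[x = y] (mod ?n)" by (simp add: cong_mult_lcancel)
      then show "x = y" using xy by (simp add: cong_def)
    qed
    moreover have "(\<lambda>x. a \<otimes>\<^bsub>?P\<^esub> x \<oplus>\<^bsub>?P\<^esub> x) ` carrier ?P = carrier ?P"
      by (rule endo_inj_surj[OF _ _ inj]) (use n0 in auto)
    ultimately show "bij_betw (\<lambda>x. a \<otimes>\<^bsub>?P\<^esub> x \<oplus>\<^bsub>?P\<^esub> x) (carrier ?P) (carrier ?P)"
      by (simp add: bij_betw_def)
    fix b c
    show "a \<otimes>\<^bsub>?P\<^esub> (b \<oplus>\<^bsub>?P\<^esub> c) = a \<otimes>\<^bsub>?P\<^esub> b \<oplus>\<^bsub>?P\<^esub> a \<otimes>\<^bsub>?P\<^esub> c"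
      by (simp add: mod_simps distrib_left)
    have "[k * int p * ((k * int p * a * b + a + b) mod ?n) * c = k * int p * (k * int p * a * b + a + b) * c] (mod ?n)"
      by (intro cong_mult cong_refl) simp
    then have "(k * int p * ((k * int p * a * b + a + b) mod ?n) * c) mod ?n = (k * int p * (k * int p * a * b + a + b) * c) mod ?n"
      by (simp add: cong_def)
    also have "\<dots> = (k * int p * a * (k * int p * b * c) + k * int p * a * c + k * int p * b * c) mod ?n"
      by (simp add: algebra_simps power2_eq_square)
    finally show "(a \<otimes>\<^bsub>?P\<^esub> b \<oplus>\<^bsub>?P\<^esub> a \<oplus>\<^bsub>?P\<^esub> b) \<otimes>\<^bsub>?P\<^esub> c = a \<otimes>\<^bsub>?P\<^esub> (b \<otimes>\<^bsub>?P\<^esub> c) \<oplus>\<^bsub>?P\<^esub> a \<otimes>\<^bsub>?P\<^esub> c \<oplus>\<^bsub>?P\<^esub> b \<otimes>\<^bsub>?P\<^esub> c"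
      by (simp add: mod_simps)
  qed (use n0 in auto)
qed

lemma brace_elem_brace: "brace (elem_brace p k)"
proof -
  let ?P = "elem_brace p k"
  have p0: "0 < int p" using p_gt_1 by simp
  have ab: "abelian_group ?P"
  proof (rule abelian_groupI)
    fix u assume "u \<in> carrier ?P"
    then show "\<exists>v \<in> carrier ?P. v \<oplus>\<^bsub>?P\<^esub> u = \<zero>\<^bsub>?P\<^esub>"
      using p0 by (intro bexI[of _ "((- fst u) mod int p, (- snd u) mod int p)"]) (auto simp: mod_simps)
  qed (use p0 in \<open>auto simp: mod_simps add_ac\<close>)
  show ?thesis
  proof (intro brace.intro ab brace_axioms.intro)
    fix u assume "u \<in> carrier ?P"
    then obtain x y where u: "u = (x, y)" by auto
    have inj: "inj_on (\<lambda>v. u \<otimes>\<^bsub>?P\<^esub> v \<oplus>\<^bsub>?P\<^esub> v) (carrier ?P)"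
    proof (rule inj_onI)
      fix v w assume vw: "v \<in> carrier ?P" "w \<in> carrier ?P"
        and eq: "u \<otimes>\<^bsub>?P\<^esub> v \<oplus>\<^bsub>?P\<^esub> v = u \<otimes>\<^bsub>?P\<^esub> w \<oplus>\<^bsub>?P\<^esub> w"
      obtain a b a' b' where *: "v = (a, b)" "w = (a', b')" by (cases v; cases w)
      have "b = b'" using eq vw by (simp add: u *)
      then have "[k * y * b + a = k * y * b + a'] (mod int p)"
        using eq by (simp add: u * cong_def mod_simps)
      then have "[a = a'] (mod int p)" by (simp add: cong_add_lcancel)
      then show "v = w" using \<open>b = b'\<close> vw by (simp add: * cong_def)
    qed
    moreover have "(\<lambda>v. u \<otimes>\<^bsub>?P\<^esub> v \<oplus>\<^bsub>?P\<^esub> v) ` carrier ?P = carrier ?P"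
      by (rule endo_inj_surj[OF _ _ inj]) (use p0 u in auto)
    ultimately show "bij_betw (\<lambda>v. u \<otimes>\<^bsub>?P\<^esub> v \<oplus>\<^bsub>?P\<^esub> v) (carrier ?P) (carrier ?P)"
      by (simp add: bij_betw_def)
    fix v w
    show "u \<otimes>\<^bsub>?P\<^esub> (v \<oplus>\<^bsub>?P\<^esub> w) = u \<otimes>\<^bsub>?P\<^esub> v \<oplus>\<^bsub>?P\<^esub> u \<otimes>\<^bsub>?P\<^esub> w"
      by (cases u; cases v; cases w) (simp add: mod_simps distrib_left)
    have "(k * ((y + b) mod int p) * d) mod int p = (k * y * d + k * b * d) mod int p" for y b d
    proof -
      have "[k * ((y + b) mod int p) * d = k * (y + b) * d] (mod int p)"
        by (intro cong_mult cong_refl) simp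
      then show ?thesis by (simp add: cong_def algebra_simps)
    qed
    then show "(u \<otimes>\<^bsub>?P\<^esub> v \<oplus>\<^bsub>?P\<^esub> u \<oplus>\<^bsub>?P\<^esub> v) \<otimes>\<^bsub>?P\<^esub> w = u \<otimes>\<^bsub>?P\<^esub> (v \<otimes>\<^bsub>?P\<^esub> w) \<oplus>\<^bsub>?P\<^esub> u \<otimes>\<^bsub>?P\<^esub> w \<oplus>\<^bsub>?P\<^esub> v \<otimes>\<^bsub>?P\<^esub> w"
      by (cases u; cases v; cases w) (simp add: mod_simps)
  qed (use p0 in auto)
qed

lemma C2_p_cong: "[m = n] (mod int p) \<Longrightarrow> [C2 m = C2 n] (mod int p)"
  using odd_p by (intro C2_cong) auto

lemma p_times_cong: "[a = b] (mod int p) \<Longrightarrow> [int p * a = int p * b] (mod (int p)\<^sup>2)"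
  by (simp add: power2_eq_square cong_iff_dvd_diff flip: right_diff_distrib)

lemma cong_p2_p: "[a = b] (mod (int p)\<^sup>2) \<Longrightarrow> [a = b] (mod int p)"
  by (erule cong_dvd_modulus) simp

text \<open>A logarithm for the circle operation, with values modulo p^2; for \<open>k = 1\<close>
  it is the exponent occurring in \<open>B_p2q\<close>.\<close>

definition cyc_exp :: "int \<Rightarrow> int \<Rightarrow> int" where
  "cyc_exp k x = x - k * int p * C2 x"

text \<open>\<open>C2\<close> respects congruence only modulo p here, which suffices because of the
  factor p in front of it.\<close>

lemma cyc_exp_cong:
  assumes "[x = y] (mod (int p)\<^sup>2)"
  shows "[cyc_exp k x = cyc_exp k y] (mod (int p)\<^sup>2)"
proof -
  have "[k * (int p * C2 x) = k * (int p * C2 y)] (mod (int p)\<^sup>2)"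
    by (intro cong_mult cong_refl p_times_cong C2_p_cong cong_p2_p assms)
  then show ?thesis unfolding cyc_exp_def by (intro cong_diff assms) (simp add: mult.assoc)
qed

text \<open>The summand k p x y of the circle product cancels against the one that
  \<open>C2_add\<close> produces.\<close>

lemma cyc_exp_circle:
  "[cyc_exp k (circle (cyc_brace p k) x y) = cyc_exp k x + cyc_exp k y] (mod (int p)\<^sup>2)"
proof -
  let ?z = "k * int p * x * y + x + y"
  have "[?z = x + y] (mod int p)" by (simp add: cong_iff_dvd_diff)
  then have "[k * (int p * C2 ?z) = k * (int p * C2 (x + y))] (mod (int p)\<^sup>2)"
    by (intro cong_mult cong_refl p_times_cong C2_p_cong)
  then have "[?z - k * (int p * C2 ?z) = ?z - k * (int p * C2 (x + y))] (mod (int p)\<^sup>2)"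
    by (intro cong_diff cong_refl)
  also have "?z - k * (int p * C2 (x + y)) = cyc_exp k x + cyc_exp k y"
    by (simp add: C2_add cyc_exp_def algebra_simps)
  finally have "[cyc_exp k ?z = cyc_exp k x + cyc_exp k y] (mod (int p)\<^sup>2)"
    by (simp add: cyc_exp_def mult.assoc)
  moreover have "[circle (cyc_brace p k) x y = ?z] (mod (int p)\<^sup>2)" by (simp add: circle_cyc)
  ultimately show ?thesis using cyc_exp_cong cong_trans by blast
qed

text \<open>One of two logarithmic coordinates of the circle group; the other is \<open>snd\<close>,
  which is additive as it stands.\<close>

definition elem_exp :: "int \<Rightarrow> int \<times> int \<Rightarrow> int" where
  "elem_exp k u = fst u - k * C2 (snd u)"

lemma elem_exp_circle:
  "[elem_exp k (circle (elem_brace p k) u v) = elem_exp k u + elem_exp k v] (mod int p)"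
proof -
  obtain x y x' y' where *: "u = (x, y)" "v = (x', y')" by (cases u; cases v)
  have "[(k * y * y' + x + x') mod int p - k * C2 ((y + y') mod int p)
      = (k * y * y' + x + x') - k * C2 (y + y')] (mod int p)"
    by (intro cong_diff cong_mult cong_refl C2_p_cong) simp_all
  also have "(k * y * y' + x + x') - k * C2 (y + y') = elem_exp k u + elem_exp k v"
    by (simp add: * elem_exp_def C2_add algebra_simps)
  finally show ?thesis by (simp add: * circle_elem elem_exp_def)
qed

end

locale pq_primes = odd_prime p + prime_modulus q for p q :: nat
begin

definition cyc_char :: "int \<Rightarrow> int \<Rightarrow> int \<Rightarrow> int" where
  "cyc_char k w x = w \<up> cyc_exp k x"

definition elem_char :: "int \<Rightarrow> int \<Rightarrow> int \<Rightarrow> int \<times> int \<Rightarrow> int" where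
  "elem_char k w v u = w \<up> elem_exp k u \<otimes>\<^bsub>U\<^esub> v \<up> snd u"

abbreviation "cycE k w \<equiv> brace_ext (cyc_brace p k) q (cyc_char k w)"
abbreviation "elemE k w v \<equiv> brace_ext (elem_brace p k) q (elem_char k w v)"

definition unity_root :: "nat \<Rightarrow> int \<Rightarrow> bool" where
  "unity_root n w \<longleftrightarrow> w \<in> carrier U \<and> w \<up> int n = 1"

lemma rootD: "unity_root n w \<Longrightarrow> w \<in> carrier U" "unity_root n w \<Longrightarrow> w \<up> int n = 1"
  by (simp_all add: unity_root_def)

lemma root_cong: "unity_root n w \<Longrightarrow> [i = j] (mod int n) \<Longrightarrow> w \<up> i = w \<up> j"
  using U.int_pow_cong[of w "int n" i j] by (simp add: unity_root_def)

lemma root_cong2: "unity_root (p\<^sup>2) w \<Longrightarrow> [i = j] (mod (int p)\<^sup>2) \<Longrightarrow> w \<up> i = w \<up> j"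
  using root_cong[of "p\<^sup>2"] by simp

lemma brace_char_cyc:
  assumes w: "unity_root (p\<^sup>2) w"
  shows "brace_char (cyc_brace p k) q (cyc_char k w)"
  unfolding brace_char_iff_U
proof (intro conjI ballI)
  fix x y
  show "cyc_char k w (circle (cyc_brace p k) x y) = cyc_char k w x \<otimes>\<^bsub>U\<^esub> cyc_char k w y"
    unfolding cyc_char_def root_cong2[OF w cyc_exp_circle] using U.int_pow_mult[OF rootD(1)[OF w]] .
qed (use rootD(1)[OF w] in \<open>simp add: cyc_char_def\<close>)

lemma brace_char_elem:
  assumes w: "unity_root p w" and v: "unity_root p v"
  shows "brace_char (elem_brace p k) q (elem_char k w v)"
  unfolding brace_char_iff_U
proof (intro conjI ballI)
  note wU = rootD(1)[OF w] rootD(1)[OF v]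
  fix a b
  have sn: "[snd (circle (elem_brace p k) a b) = snd a + snd b] (mod int p)"
    by (cases a; cases b) (simp add: circle_elem)
  show "elem_char k w v (circle (elem_brace p k) a b) = elem_char k w v a \<otimes>\<^bsub>U\<^esub> elem_char k w v b"
    unfolding elem_char_def root_cong[OF w elem_exp_circle] root_cong[OF v sn]
    by (simp only: U.int_pow_mult[OF wU(1)] U.int_pow_mult[OF wU(2)] U.m_ac U.m_closed U.int_pow_closed wU)
  show "elem_char k w v a \<in> carrier U"
    unfolding elem_char_def by (intro U.m_closed U.int_pow_closed wU)
qed

lemma brace_char_zero:
  assumes "brace P" "brace_char P q \<chi>"
  shows "\<chi> \<zero>\<^bsub>P\<^esub> = 1"
proof -
  interpret P: brace P by fact
  have "\<chi> \<zero>\<^bsub>P\<^esub> = \<chi> \<zero>\<^bsub>P\<^esub> \<otimes>\<^bsub>U\<^esub> \<chi> \<zero>\<^bsub>P\<^esub>" "\<chi> \<zero>\<^bsub>P\<^esub> \<in> carrier U"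
    using assms(2)[unfolded brace_char_iff_U] P.circle_zero(1)[of "\<zero>\<^bsub>P\<^esub>"] P.zero_closed by metis+
  then have "\<chi> \<zero>\<^bsub>P\<^esub> = \<one>\<^bsub>U\<^esub>" using U.l_cancel_one' by metis
  then show ?thesis by simp
qed

text \<open>The circle powers of \<open>1\<close> are \<open>n + k p C2 n\<close>, the inverse of \<open>cyc_exp\<close>.\<close>

lemma cyc_char_unique:
  assumes "brace_char (cyc_brace p k) q \<chi>"
  obtains w where "unity_root (p\<^sup>2) w" "\<And>x. x \<in> carrier (cyc_brace p k) \<Longrightarrow> \<chi> x = cyc_char k w x"
proof -
  let ?P = "cyc_brace p k" and ?n = "(int p)\<^sup>2"
  note chi = assms[unfolded brace_char_iff_U]
  have n1: "1 < ?n" using p_gt_1 one_less_power[of "int p" 2] by simp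
  have n0: "0 < ?n" using p_gt_1 by simp
  \<comment> \<open>\<open>s m\<close> is the m-th circle power of 1, extended to all integers
    m.\<close>
  define s where "s m = (m + k * int p * C2 m) mod ?n" for m
  have sP: "s m \<in> carrier ?P" for m using n0 by (simp add: s_def)
  have s_cong: "s a = s b" if "[a = b] (mod ?n)" for a b
  proof -
    have "[k * (int p * C2 a) = k * (int p * C2 b)] (mod ?n)"
      by (intro cong_mult cong_refl p_times_cong C2_p_cong cong_p2_p that)
    then have "[a + k * (int p * C2 a) = b + k * (int p * C2 b)] (mod ?n)" using that by (intro cong_add)
    then show ?thesis by (simp add: s_def cong_def mult.assoc)
  qed
  define w where "w = \<chi> 1"
  have w: "w \<in> carrier U" using chi n1 by (simp add: w_def)
  have chi0: "\<chi> 0 = 1" using brace_char_zero[OF brace_cyc_brace assms] by simp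
  have step: "s (m + 1) = circle ?P (s m) 1" for m
  proof -
    have "[k * int p * s m * 1 + s m + 1
        = k * int p * (m + k * int p * C2 m) * 1 + (m + k * int p * C2 m) + 1] (mod ?n)"
      unfolding s_def by (intro cong_add cong_mult cong_refl) simp_all
    then have "circle ?P (s m) 1 = (k * int p * (m + k * int p * C2 m) + (m + k * int p * C2 m) + 1) mod ?n"
      by (simp add: circle_cyc cong_def)
    \<comment> \<open>The second-order term carries the factor p^2 and disappears.\<close>
    also have "\<dots> = (m + 1 + k * int p * C2 (m + 1) + ?n * (k * k * C2 m)) mod ?n"
      by (simp add: C2_add algebra_simps power2_eq_square)
    finally show ?thesis by (simp add: s_def)
  qed
  have pw: "\<chi> (s (int m)) = w \<up> int m" for m
  proof (induction m)
    case 0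
    then show ?case using chi0 by (simp add: s_def)
  next
    case (Suc m)
    have "\<chi> (s (int (Suc m))) = \<chi> (s (int m)) \<otimes>\<^bsub>U\<^esub> w"
      using chi sP[of "int m"] n1 step[of "int m"] by (simp add: w_def add.commute del: mult_U)
    also have "\<dots> = w \<up> (int m + 1)" unfolding Suc U.int_pow_mult[OF w] using w by simp
    finally show ?case by (simp add: add.commute)
  qed
  have "s ?n = s 0" by (rule s_cong) (simp add: cong_def)
  then have "w \<up> int (p\<^sup>2) = 1" using pw[of "p\<^sup>2"] chi0 by (simp add: s_def)
  then have unity_root: "unity_root (p\<^sup>2) w" using w by (simp add: unity_root_def)
  moreover have "\<chi> x = cyc_char k w x" if x: "x \<in> carrier ?P" for x
  proof -
    let ?e = "cyc_exp k x"
    \<comment> \<open>\<open>?e\<close> and \<open>x\<close> agree modulo p, so the two corrections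
      by \<open>C2\<close>, each carrying a factor p, cancel modulo p^2.\<close>
    have "s ?e = x"
    proof -
      have "[?e = x] (mod int p)" by (simp add: cyc_exp_def cong_iff_dvd_diff)
      then have "[k * (int p * C2 ?e) = k * (int p * C2 x)] (mod ?n)"
        by (intro cong_mult cong_refl p_times_cong C2_p_cong)
      then have "[?e + k * (int p * C2 ?e) = ?e + k * (int p * C2 x)] (mod ?n)" by (intro cong_add cong_refl)
      then show ?thesis using x by (simp add: s_def cong_def cyc_exp_def mult.assoc)
    qed
    \<comment> \<open>\<open>pw\<close> speaks of nonnegative exponents only, whereas
      \<open>?e\<close> may be negative.\<close>
    moreover have "s (?e mod ?n) = s ?e" by (rule s_cong) (simp add: cong_def)
    ultimately have "\<chi> x = w \<up> (?e mod ?n)" using pw[of "nat (?e mod ?n)"] n0 by simp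
    also have "\<dots> = w \<up> ?e" by (rule root_cong2[OF unity_root]) (simp add: cong_def)
    finally show ?thesis by (simp add: cyc_char_def)
  qed
  ultimately show ?thesis by (rule that)
qed

text \<open>\<open>(1, 0)\<close> and \<open>(0, 1)\<close> generate the circle group; the m-th
  circle power of the latter is (k C2(m), m).\<close>

lemma elem_char_unique:
  assumes "brace_char (elem_brace p k) q \<chi>"
  obtains w v where "unity_root p w" "unity_root p v"
    "\<And>u. u \<in> carrier (elem_brace p k) \<Longrightarrow> \<chi> u = elem_char k w v u"
proof -
  let ?P = "elem_brace p k"
  note chi = assms[unfolded brace_char_iff_U]
  define w where "w = \<chi> (1, 0)"
  define v where "v = \<chi> (0, 1)"
  have wv: "w \<in> carrier U" "v \<in> carrier U" using chi p_gt_1 by (simp_all add: w_def v_def)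
  have chi0: "\<chi> (0, 0) = 1" using brace_char_zero[OF brace_elem_brace assms] by simp
  have pw: "\<chi> (int m mod int p, 0) = w \<up> int m" for m
  proof (induction m)
    case 0
    then show ?case using chi0 by simp
  next
    case (Suc m)
    have "(int (Suc m) mod int p, 0) = circle ?P (int m mod int p, 0) (1, 0)"
      by (simp add: circle_elem mod_simps add.commute)
    then have "\<chi> (int (Suc m) mod int p, 0) = \<chi> (int m mod int p, 0) \<otimes>\<^bsub>U\<^esub> w"
      using chi p_gt_1 by (simp add: w_def del: mult_U)
    also have "\<dots> = w \<up> (int m + 1)" unfolding Suc U.int_pow_mult[OF wv(1)] using wv by simp
    finally show ?case by (simp add: add.commute)
  qed
  have pv: "\<chi> (k * C2 (int m) mod int p, int m mod int p) = v \<up> int m" for m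
  proof (induction m)
    case 0
    then show ?case using chi0 by simp
  next
    case (Suc m)
    have "[k * (int m mod int p) * 1 + k * C2 (int m) mod int p + 0 = k * int m * 1 + k * C2 (int m) + 0] (mod int p)"
      by (intro cong_add cong_mult cong_refl) simp_all
    then have "(k * C2 (int (Suc m)) mod int p, int (Suc m) mod int p)
        = circle ?P (k * C2 (int m) mod int p, int m mod int p) (0, 1)"
      using C2_add[of "int m" 1] by (simp add: circle_elem cong_def mod_simps algebra_simps)
    then have "\<chi> (k * C2 (int (Suc m)) mod int p, int (Suc m) mod int p)
        = \<chi> (k * C2 (int m) mod int p, int m mod int p) \<otimes>\<^bsub>U\<^esub> v"
      using chi p_gt_1 by (simp add: v_def del: mult_U)
    also have "\<dots> = v \<up> (int m + 1)" unfolding Suc U.int_pow_mult[OF wv(2)] using wv by simp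
    finally show ?case by (simp add: add.commute)
  qed
  \<comment> \<open>As p is odd, the p-th circle power of \<open>(0, 1)\<close> is zero, which makes
    \<open>v\<close> a p-th root of unity.\<close>
  have "[C2 (int p) = C2 0] (mod int p)" by (rule C2_p_cong) (simp add: cong_def)
  then have "k * C2 (int p) mod int p = 0" by (simp add: cong_def mod_0_imp_dvd)
  then have "v \<up> int p = 1" using pv[of p] chi0 by simp
  then have v: "unity_root p v" using wv by (simp add: unity_root_def)
  have "w \<up> int p = 1" using pw[of p] chi0 by simp
  then have w: "unity_root p w" using wv by (simp add: unity_root_def)
  have "\<chi> u = elem_char k w v u" if u: "u \<in> carrier ?P" for u
  proof -
    obtain x y where xy: "u = (x, y)" "0 \<le> x" "x < int p" "0 \<le> y" "y < int p" using u by auto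
    let ?e = "elem_exp k u mod int p"
    have e: "0 \<le> ?e" "?e < int p" using p_gt_1 by simp_all
    have "\<chi> (?e, 0) = w \<up> ?e" using pw[of "nat ?e"] e by simp
    also have "\<dots> = w \<up> elem_exp k u" by (rule root_cong[OF w]) (simp add: cong_def)
    finally have 1: "\<chi> (?e, 0) = w \<up> elem_exp k u" .
    have 2: "\<chi> (k * C2 y mod int p, y) = v \<up> y" using pv[of "nat y"] xy by simp
    \<comment> \<open>Factorisation of \<open>u\<close> in the two logarithmic coordinates.\<close>
    have "u = circle ?P (?e, 0) (k * C2 y mod int p, y)"
      using xy by (simp add: circle_elem elem_exp_def mod_simps)
    moreover have "(?e, 0) \<in> carrier ?P" "(k * C2 y mod int p, y) \<in> carrier ?P"
      using e xy p_gt_1 by simp_all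
    ultimately have "\<chi> u = \<chi> (?e, 0) \<otimes>\<^bsub>U\<^esub> \<chi> (k * C2 y mod int p, y)"
      using chi by metis
    then show ?thesis unfolding 1 2 by (simp add: elem_char_def xy)
  qed
  with w v show ?thesis by (rule that)
qed

end

section \<open>The named braces as extensions\<close>

lemma RDirProd_list_add:
  assumes "a \<in> carrier R" "b \<in> carrier R"
    "as \<in> carrier (RDirProd_list Rs)" "bs \<in> carrier (RDirProd_list Rs)"
  shows "(a # as) \<oplus>\<^bsub>RDirProd_list (R # Rs)\<^esub> (b # bs) = (a \<oplus>\<^bsub>R\<^esub> b) # (as \<oplus>\<^bsub>RDirProd_list Rs\<^esub> bs)"
  using ring_hom_add[OF RDirProd_list_hom1, of "(a, as)" R Rs "(b, bs)"] assms
  by (simp add: RDirProd_carrier) (simp add: RDirProd_def DirProd_def monoid.defs)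

lemma RDirProd_list_Nil_simps:
  "carrier nil_ring = {[]}" "as \<oplus>\<^bsub>nil_ring\<^esub> bs = []" "\<zero>\<^bsub>nil_ring\<^esub> = []"
  by (simp_all add: monoid.defs)

lemma RDirProd_list_Cons_carrier:
  "a # as \<in> carrier (RDirProd_list (R # Rs)) \<longleftrightarrow> a \<in> carrier R \<and> as \<in> carrier (RDirProd_list Rs)"
  by (auto simp: RDirProd_list_carrier)

lemma residue_ring_simps:
  "carrier (residue_ring m) = {0..m - 1}" "x \<otimes>\<^bsub>residue_ring m\<^esub> y = x * y mod m"
  "x \<oplus>\<^bsub>residue_ring m\<^esub> y = (x + y) mod m" "\<zero>\<^bsub>residue_ring m\<^esub> = 0" "\<one>\<^bsub>residue_ring m\<^esub> = 1"
  by (simp_all add: residue_ring_def)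

context pq_primes
begin

text \<open>Merges the families \<open>T_p2q\<close> and \<open>B_p2q\<close> into one indexed by
  \<open>k\<close> in {0, 1}, matching \<open>cyc_brace\<close>.\<close>

definition cycB :: "int \<Rightarrow> int \<Rightarrow> int list ring" where
  "cycB k w = (if k = 0 then T_p2q p q w else B_p2q p q w)"

definition elemB :: "int \<Rightarrow> int \<Rightarrow> int \<Rightarrow> int list ring" where
  "elemB k w v = (if k = 0 then T_ppq p q w v else B_ppq p q w v)"

lemma Zq_minus_one: "(c \<ominus>\<^bsub>Zq\<^esub> \<one>\<^bsub>Zq\<^esub>) \<otimes>\<^bsub>Zq\<^esub> a = (c - 1) * a mod int q"
  unfolding a_minus_def R.res_neg_eq residue_ring_simps
  by (metis add_uminus_conv_diff mod_add_right_eq mod_mult_left_eq)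

lemma cycB_simps:
  assumes w: "w \<in> carrier U" and k: "k \<in> {0, 1}"
  shows "carrier (cycB k w) = (\<lambda>(x, a). [x, a]) ` ({0..<(int p)\<^sup>2} \<times> {0..<int q})"
    and "[x, a] \<otimes>\<^bsub>cycB k w\<^esub> [y, b] = [k * int p * x * y mod (int p)\<^sup>2, (cyc_char k w x - 1) * b mod int q]"
    and "x \<in> {0..<(int p)\<^sup>2} \<Longrightarrow> y \<in> {0..<(int p)\<^sup>2} \<Longrightarrow> a \<in> {0..<int q} \<Longrightarrow> b \<in> {0..<int q} \<Longrightarrow>
      [x, a] \<oplus>\<^bsub>cycB k w\<^esub> [y, b] = [(x + y) mod (int p)\<^sup>2, (a + b) mod int q]"
    and "\<zero>\<^bsub>cycB k w\<^esub> = [0, 0]"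
proof -
  have "{0..(int p)\<^sup>2 - 1} = {0..<(int p)\<^sup>2}" "{0..int q - 1} = {0..<int q}" by auto
  then show "carrier (cycB k w) = (\<lambda>(x, a). [x, a]) ` ({0..<(int p)\<^sup>2} \<times> {0..<int q})"
    by (auto simp: cycB_def T_p2q_def B_p2q_def Let_def RDirProd_list_carrier RDirProd_list_Nil_simps residue_ring_simps)
  have "(int p * x mod (int p)\<^sup>2) * y mod (int p)\<^sup>2 = int p * x * y mod (int p)\<^sup>2" by (simp add: mod_simps)
  then show "[x, a] \<otimes>\<^bsub>cycB k w\<^esub> [y, b] = [k * int p * x * y mod (int p)\<^sup>2, (cyc_char k w x - 1) * b mod int q]"
    using k w by (auto simp: cycB_def T_p2q_def B_p2q_def Let_def Zq_minus_one cyc_char_def cyc_exp_def int_pow_U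
        residue_ring_simps(2)[of "(int p)\<^sup>2"])
  show "\<zero>\<^bsub>cycB k w\<^esub> = [0, 0]"
    by (simp add: cycB_def T_p2q_def B_p2q_def Let_def RDirProd_list_zero' RDirProd_list_Nil_simps residue_ring_simps)
  assume "x \<in> {0..<(int p)\<^sup>2}" "y \<in> {0..<(int p)\<^sup>2}" "a \<in> {0..<int q}" "b \<in> {0..<int q}"
  then show "[x, a] \<oplus>\<^bsub>cycB k w\<^esub> [y, b] = [(x + y) mod (int p)\<^sup>2, (a + b) mod int q]"
    by (simp add: cycB_def T_p2q_def B_p2q_def Let_def RDirProd_list_add RDirProd_list_Cons_carrier RDirProd_list_Nil_simps residue_ring_simps)
qed

lemma elemB_simps:
  assumes w: "w \<in> carrier U" "v \<in> carrier U" and k: "k \<in> {0, 1}"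
  shows "carrier (elemB k w v) = (\<lambda>((x, y), a). [x, y, a]) ` (({0..<int p} \<times> {0..<int p}) \<times> {0..<int q})"
    and "[x, y, a] \<otimes>\<^bsub>elemB k w v\<^esub> [x', y', b] = [k * y * y' mod int p, 0, (elem_char k w v (x, y) - 1) * b mod int q]"
    and "x \<in> {0..<int p} \<Longrightarrow> x' \<in> {0..<int p} \<Longrightarrow> y \<in> {0..<int p} \<Longrightarrow> y' \<in> {0..<int p} \<Longrightarrow>
      a \<in> {0..<int q} \<Longrightarrow> b \<in> {0..<int q} \<Longrightarrow>
      [x, y, a] \<oplus>\<^bsub>elemB k w v\<^esub> [x', y', b] = [(x + x') mod int p, (y + y') mod int p, (a + b) mod int q]"
    and "\<zero>\<^bsub>elemB k w v\<^esub> = [0, 0, 0]"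
proof -
  have "{0..int p - 1} = {0..<int p}" "{0..int q - 1} = {0..<int q}" by auto
  then show "carrier (elemB k w v) = (\<lambda>((x, y), a). [x, y, a]) ` (({0..<int p} \<times> {0..<int p}) \<times> {0..<int q})"
    by (auto simp: elemB_def T_ppq_def B_ppq_def Let_def RDirProd_list_carrier RDirProd_list_Nil_simps residue_ring_simps image_iff)
  show "[x, y, a] \<otimes>\<^bsub>elemB k w v\<^esub> [x', y', b] = [k * y * y' mod int p, 0, (elem_char k w v (x, y) - 1) * b mod int q]"
    using k w by (auto simp: elemB_def T_ppq_def B_ppq_def Let_def Zq_minus_one elem_char_def elem_exp_def int_pow_U
        residue_ring_simps(2)[of "int p"] simp del: mult_U) (simp_all add: residue_ring_simps)
  show "\<zero>\<^bsub>elemB k w v\<^esub> = [0, 0, 0]"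
    by (simp add: elemB_def T_ppq_def B_ppq_def Let_def RDirProd_list_zero' RDirProd_list_Nil_simps residue_ring_simps)
  assume "x \<in> {0..<int p}" "x' \<in> {0..<int p}" "y \<in> {0..<int p}" "y' \<in> {0..<int p}" "a \<in> {0..<int q}" "b \<in> {0..<int q}"
  then show "[x, y, a] \<oplus>\<^bsub>elemB k w v\<^esub> [x', y', b] = [(x + x') mod int p, (y + y') mod int p, (a + b) mod int q]"
    by (simp add: elemB_def T_ppq_def B_ppq_def Let_def RDirProd_list_add RDirProd_list_Cons_carrier RDirProd_list_Nil_simps residue_ring_simps)
qed

lemma cycB_iso_ext:
  assumes "w \<in> carrier U" "k \<in> {0, 1}"
  shows "(\<lambda>(x, a). [x, a]) \<in> brace_iso (cycE k w) (cycB k w)"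
proof (rule brace_isoI)
  show "bij_betw (\<lambda>(x, a). [x, a]) (carrier (cycE k w)) (carrier (cycB k w))"
    by (auto simp: bij_betw_def inj_on_def cycB_simps[OF assms])
qed (auto simp: cycB_simps[OF assms])

lemma elemB_iso_ext:
  assumes "w \<in> carrier U" "v \<in> carrier U" "k \<in> {0, 1}"
  shows "(\<lambda>((x, y), a). [x, y, a]) \<in> brace_iso (elemE k w v) (elemB k w v)"
proof (rule brace_isoI)
  show "bij_betw (\<lambda>((x, y), a). [x, y, a]) (carrier (elemE k w v)) (carrier (elemB k w v))"
    by (auto simp: bij_betw_def inj_on_def elemB_simps[OF assms])
qed (auto simp: elemB_simps[OF assms])

lemma brace_ext_cyc: "unity_root (p\<^sup>2) w \<Longrightarrow> brace (cycE k w)"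
  by (rule brace_brace_ext[OF brace_cyc_brace q brace_char_cyc])

lemma brace_ext_elem: "unity_root p w \<Longrightarrow> unity_root p v \<Longrightarrow> brace (elemE k w v)"
  by (rule brace_brace_ext[OF brace_elem_brace q brace_char_elem])

lemma brace_cycB:
  assumes w: "unity_root (p\<^sup>2) w" and k: "k \<in> {0, 1}"
  shows "brace (cycB k w)" "order (cycB k w) = p\<^sup>2 * q"
proof -
  note h = cycB_iso_ext[OF rootD(1)[OF w] k]
  show "brace (cycB k w)"
    by (rule brace_transport[OF brace_ext_cyc[OF w] h]) (simp add: cycB_simps[OF rootD(1)[OF w] k])
  show "order (cycB k w) = p\<^sup>2 * q"
    using brace_isomorphic_order[OF brace_isomorphicI[OF h]] by (simp add: order_brace_ext order_cyc_brace)
qed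

lemma brace_elemB:
  assumes w: "unity_root p w" and v: "unity_root p v" and k: "k \<in> {0, 1}"
  shows "brace (elemB k w v)" "order (elemB k w v) = p\<^sup>2 * q"
proof -
  note h = elemB_iso_ext[OF rootD(1)[OF w] rootD(1)[OF v] k]
  show "brace (elemB k w v)"
    by (rule brace_transport[OF brace_ext_elem[OF w v] h]) (simp add: elemB_simps[OF rootD(1)[OF w] rootD(1)[OF v] k])
  show "order (elemB k w v) = p\<^sup>2 * q"
    using brace_isomorphic_order[OF brace_isomorphicI[OF h]] by (simp add: order_brace_ext order_elem_brace)
qed

section \<open>Isomorphisms between the named braces\<close>

lemma cyc_int_pow:
  fixes i :: int
  assumes x: "x \<in> carrier (cyc_brace p k)"
  shows "[i] \<cdot>\<^bsub>cyc_brace p k\<^esub> x = i * x mod (int p)\<^sup>2"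
proof -
  let ?P = "cyc_brace p k"
  interpret P: brace ?P by (rule brace_cyc_brace)
  have n0: "0 < (int p)\<^sup>2" using p_gt_1 by simp
  show ?thesis
  proof (induction i rule: int_induct[of _ 0])
    case base
    then show ?case by (simp add: add_pow_def)
  next
    case (step1 i)
    then show ?case using P.add.int_pow_mult[OF x, of i 1] x by (simp add: mod_simps distrib_right)
  next
    case (step2 i)
    have "[(i - 1)] \<cdot>\<^bsub>?P\<^esub> x \<oplus>\<^bsub>?P\<^esub> x = [i] \<cdot>\<^bsub>?P\<^esub> x"
      using P.add.int_pow_mult[OF x, of "i - 1" 1] x by simp
    also have "\<dots> = ((i - 1) * x mod (int p)\<^sup>2) \<oplus>\<^bsub>?P\<^esub> x"
      using step2 by (simp add: mod_simps left_diff_distrib)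
    finally show ?case
      by (rule P.add.r_cancel) (use x n0 P.add.int_pow_closed[OF x] in auto)
  qed
qed

lemma elem_p_torsion:
  assumes u: "u \<in> carrier (elem_brace p k)"
  shows "[(int p)] \<cdot>\<^bsub>elem_brace p k\<^esub> u = \<zero>\<^bsub>elem_brace p k\<^esub>"
proof -
  let ?P = "elem_brace p k"
  interpret P: brace ?P by (rule brace_elem_brace)
  have "[(int m)] \<cdot>\<^bsub>?P\<^esub> u = (int m * fst u mod int p, int m * snd u mod int p)" for m
  proof (induction m)
    case 0
    then show ?case by (simp add: add_pow_def)
  next
    case (Suc m)
    then show ?case
      using P.add.int_pow_mult[OF u, of "int m" 1] u by (cases u) (simp add: mod_simps distrib_right add.commute)
  qed
  then show ?thesis by simp
qed

text \<open>The additive groups differ: p kills every element on the right but not the element 1 on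
  the left.\<close>

lemma cyc_elem_no_iso: "h \<notin> brace_iso (cyc_brace p k) (elem_brace p k')"
proof
  assume h: "h \<in> brace_iso (cyc_brace p k) (elem_brace p k')"
  note hD = brace_isoD[OF h]
  have pp: "int p < (int p)\<^sup>2" using p_gt_1 by (simp add: power2_eq_square)
  then have mem: "1 \<in> carrier (cyc_brace p k)" "int p \<in> carrier (cyc_brace p k)" "0 \<in> carrier (cyc_brace p k)"
    using p_gt_1 by simp_all
  have "h (int p) = h ([(int p)] \<cdot>\<^bsub>cyc_brace p k\<^esub> 1)"
    using pp unfolding cyc_int_pow[OF mem(1)] by simp
  also have "\<dots> = h \<zero>\<^bsub>cyc_brace p k\<^esub>"
    using brace_iso_int_pow[OF brace_cyc_brace brace_elem_brace h mem(1)] elem_p_torsion[OF hD(4)[OF mem(1)]]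
      brace_iso_zero[OF brace_cyc_brace brace_elem_brace h] by simp
  finally have "int p = 0" using inj_onD[OF bij_betw_imp_inj_on[OF hD(1)], of "int p" 0] mem by simp
  then show False using p_gt_1 by simp
qed

lemma coprime_p: "coprime (u :: int) (int p) \<longleftrightarrow> \<not> int p dvd u"
  using prime_imp_coprime[of "int p" u] p p_gt_1 coprime_common_divisor[of u "int p" "int p"]
  by (auto simp: coprime_commute)

text \<open>An additive map is determined by \<open>u = h 1\<close>, a unit. Applying
  \<open>h\<close> to the square of 1 gives u k p = k' p u^2 modulo p^2, and p and one factor u
  cancel. Equal parameters 1 thus force u = 1 modulo p, while equal parameters 0 leave u
  free.\<close>

lemma cyc_iso_form:
  assumes h: "h \<in> brace_iso (cyc_brace p k) (cyc_brace p k')"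
  obtains u where "coprime u (int p)" "[k = k' * u] (mod int p)"
    "\<And>x. x \<in> carrier (cyc_brace p k) \<Longrightarrow> h x = u * x mod (int p)\<^sup>2"
proof -
  let ?n = "(int p)\<^sup>2"
  note hD = brace_isoD[OF h]
  have pp: "int p < ?n" using p_gt_1 by (simp add: power2_eq_square)
  then have mem: "1 \<in> carrier (cyc_brace p k)" "int p \<in> carrier (cyc_brace p k)" "0 \<in> carrier (cyc_brace p k)"
    using p_gt_1 by simp_all
  define u where "u = h 1"
  have form: "h x = u * x mod ?n" if x: "x \<in> carrier (cyc_brace p k)" for x
  proof -
    have "h x = h ([x] \<cdot>\<^bsub>cyc_brace p k\<^esub> 1)" using x unfolding cyc_int_pow[OF mem(1)] by simp
    also have "\<dots> = u * x mod ?n"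
      using brace_iso_int_pow[OF brace_cyc_brace brace_cyc_brace h mem(1)] cyc_int_pow[OF hD(4)[OF mem(1)]]
      by (simp add: u_def mult.commute)
    finally show ?thesis .
  qed
  have cop: "coprime u (int p)"
  proof (rule ccontr)
    assume "\<not> coprime u (int p)"
    then obtain t where "u = int p * t" using coprime_p by auto
    then have "h (int p) = h 0" using form mem by (simp add: power2_eq_square)
    then have "int p = 0" using inj_onD[OF bij_betw_imp_inj_on[OF hD(1)], of "int p" 0] mem by simp
    then show False using p_gt_1 by simp
  qed
  have "h (1 \<otimes>\<^bsub>cyc_brace p k\<^esub> 1) = h 1 \<otimes>\<^bsub>cyc_brace p k'\<^esub> h 1" using hD(3) mem by blast
  then have "h (k * int p mod ?n) = k' * int p * u * u mod ?n" by (simp add: u_def)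
  moreover have "k * int p mod ?n \<in> carrier (cyc_brace p k)" using p_gt_1 by simp
  ultimately have "[u * (k * int p) = k' * int p * u * u] (mod ?n)" using form by (simp add: cong_def mod_simps)
  then have "int p * int p dvd int p * (u * k - k' * u * u)"
    by (simp add: cong_iff_dvd_diff power2_eq_square algebra_simps)
  then have "int p dvd u * k - k' * u * u" using p_gt_1 by (subst (asm) dvd_mult_cancel_left) auto
  then have "int p dvd u * (k - k' * u)" by (simp add: algebra_simps)
  then have "int p dvd k - k' * u" using cop by (simp add: coprime_commute coprime_dvd_mult_right_iff)
  then have "[k = k' * u] (mod int p)" by (simp add: cong_iff_dvd_diff)
  from that[OF cop this form] show ?thesis .
qed

lemma cyc_isoI:
  assumes cop: "coprime u (int p)" and k: "[k = k' * u] (mod int p)"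
  shows "(\<lambda>x. u * x mod (int p)\<^sup>2) \<in> brace_iso (cyc_brace p k) (cyc_brace p k')"
proof (rule brace_isoI)
  let ?n = "(int p)\<^sup>2" and ?h = "\<lambda>x. u * x mod (int p)\<^sup>2"
  have n0: "0 < ?n" using p_gt_1 by simp
  have inj: "inj_on ?h {0..<?n}"
  proof (rule inj_onI)
    fix x y assume xy: "x \<in> {0..<?n}" "y \<in> {0..<?n}" and "?h x = ?h y"
    then have "[u * x = u * y] (mod ?n)" by (simp add: cong_def)
    then have "[x = y] (mod ?n)" using cop by (simp add: cong_mult_lcancel)
    then show "x = y" using xy by (simp add: cong_def)
  qed
  have "?h ` {0..<?n} = {0..<?n}"
    by (rule endo_inj_surj[OF _ _ inj]) (use n0 in auto)
  then show "bij_betw ?h (carrier (cyc_brace p k)) (carrier (cyc_brace p k'))"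
    using inj by (simp add: bij_betw_def)
  fix x y
  show "?h (x \<oplus>\<^bsub>cyc_brace p k\<^esub> y) = ?h x \<oplus>\<^bsub>cyc_brace p k'\<^esub> ?h y"
    by (simp add: mod_simps distrib_left)
  have "[int p * k = int p * (k' * u)] (mod ?n)" using p_times_cong[OF k] .
  then have "[int p * k * (u * x * y) = int p * (k' * u) * (u * x * y)] (mod ?n)" by (rule cong_scalar_right)
  then have "[u * (k * int p * x * y) = k' * int p * (u * x) * (u * y)] (mod ?n)" by (simp add: ac_simps)
  also have "[k' * int p * (u * x) * (u * y) = k' * int p * ?h x * ?h y] (mod ?n)"
    by (intro cong_mult cong_refl) simp_all
  finally show "?h (x \<otimes>\<^bsub>cyc_brace p k\<^esub> y) = ?h x \<otimes>\<^bsub>cyc_brace p k'\<^esub> ?h y"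
    by (simp add: cong_def mod_simps)
qed

text \<open>\<open>C2\<close> of \<open>u * x\<close> matters only modulo p, where \<open>u\<close>
  is 1 in the case \<open>k = 1\<close>; hence automorphisms are linear in the logarithm.\<close>

lemma cyc_exp_scale:
  assumes k: "k \<in> {0, 1}" and u: "k = 1 \<Longrightarrow> [u = 1] (mod int p)"
  shows "[cyc_exp k (u * x mod (int p)\<^sup>2) = u * cyc_exp k x] (mod (int p)\<^sup>2)"
proof -
  have "[cyc_exp k (u * x mod (int p)\<^sup>2) = cyc_exp k (u * x)] (mod (int p)\<^sup>2)" by (rule cyc_exp_cong) simp
  also have "[cyc_exp k (u * x) = u * cyc_exp k x] (mod (int p)\<^sup>2)"
  proof (cases "k = 0")
    case False
    then have "k = 1" using k by simp
    note u1 = u[OF this]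
    have "[u * x = 1 * x] (mod int p)" by (intro cong_mult u1 cong_refl)
    then have "[C2 (u * x) = C2 x] (mod int p)" by (intro C2_p_cong) simp
    moreover have "[C2 x = u * C2 x] (mod int p)" using cong_scalar_right[OF cong_sym[OF u1], of "C2 x"] by simp
    ultimately have "[int p * C2 (u * x) = int p * (u * C2 x)] (mod (int p)\<^sup>2)"
      using p_times_cong cong_trans by blast
    then have "[u * x - int p * C2 (u * x) = u * x - int p * (u * C2 x)] (mod (int p)\<^sup>2)" by (intro cong_diff cong_refl)
    then show ?thesis using \<open>k = 1\<close> by (simp add: cyc_exp_def algebra_simps)
  qed (simp add: cyc_exp_def)
  finally show ?thesis .
qed

lemma cyc_char_scale:
  assumes w: "unity_root (p\<^sup>2) w" and "k \<in> {0, 1}" "k = 1 \<Longrightarrow> [u = 1] (mod int p)"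
  shows "cyc_char k w (u * x mod (int p)\<^sup>2) = cyc_char k (w \<up> u) x"
  using root_cong2[OF w cyc_exp_scale[OF assms(2,3)]] U.int_pow_pow[OF rootD(1)[OF w]]
  by (simp add: cyc_char_def)

lemma root_power: "unity_root n w \<Longrightarrow> unity_root n (w \<up> (i :: int))"
  using U.int_pow_pow[of w i "int n"] U.int_pow_pow[of w "int n" i] U.int_pow_one[of i]
  by (simp add: unity_root_def mult.commute)

lemma coprime_p2_q: "p \<noteq> q \<Longrightarrow> coprime (p\<^sup>2) q"
  using p q by (simp add: primes_coprime)

section \<open>Isomorphism criteria for the named braces\<close>

lemma cycB_iso_iff_ext:
  assumes "unity_root (p\<^sup>2) w" "unity_root (p\<^sup>2) w'" "k \<in> {0, 1}" "k' \<in> {0, 1}"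
  shows "brace_isomorphic (cycB k w) (cycB k' w') \<longleftrightarrow>
    brace_isomorphic (cycE k w) (cycE k' w')"
proof -
  note 1 = brace_isomorphicI[OF cycB_iso_ext[OF rootD(1)[OF assms(1)] assms(3)]]
  note 2 = brace_isomorphicI[OF cycB_iso_ext[OF rootD(1)[OF assms(2)] assms(4)]]
  note s1 = brace_isomorphic_sym[OF brace_ext_cyc[OF assms(1)] 1]
  note s2 = brace_isomorphic_sym[OF brace_ext_cyc[OF assms(2)] 2]
  show ?thesis using 1 2 s1 s2 by (meson brace_isomorphic_trans)
qed

lemma elemB_iso_iff_ext:
  assumes "unity_root p w" "unity_root p v" "unity_root p w'" "unity_root p v'" "k \<in> {0, 1}" "k' \<in> {0, 1}"
  shows "brace_isomorphic (elemB k w v) (elemB k' w' v') \<longleftrightarrow>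
    brace_isomorphic (elemE k w v) (elemE k' w' v')"
proof -
  note 1 = brace_isomorphicI[OF elemB_iso_ext[OF rootD(1)[OF assms(1)] rootD(1)[OF assms(2)] assms(5)]]
  note 2 = brace_isomorphicI[OF elemB_iso_ext[OF rootD(1)[OF assms(3)] rootD(1)[OF assms(4)] assms(6)]]
  note s1 = brace_isomorphic_sym[OF brace_ext_elem[OF assms(1,2)] 1]
  note s2 = brace_isomorphic_sym[OF brace_ext_elem[OF assms(3,4)] 2]
  show ?thesis using 1 2 s1 s2 by (meson brace_isomorphic_trans)
qed

lemma cycB_iso_iff:
  assumes pq: "p \<noteq> q" and w: "unity_root (p\<^sup>2) w" "unity_root (p\<^sup>2) w'" and k: "k \<in> {0, 1}" "k' \<in> {0, 1}"
  shows "brace_isomorphic (cycB k w) (cycB k' w') \<longleftrightarrow>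
    k = k' \<and> (\<exists>u. coprime u (int p) \<and> (k = 1 \<longrightarrow> [u = 1] (mod int p)) \<and> w = w' \<up> u)"
proof
  assume "brace_isomorphic (cycB k w) (cycB k' w')"
  then have iso: "brace_isomorphic (cycE k w) (cycE k' w')"
    using cycB_iso_iff_ext[OF w k] by simp
  obtain h where h: "h \<in> brace_iso (cyc_brace p k) (cyc_brace p k')"
    and chi: "\<And>x. x \<in> carrier (cyc_brace p k) \<Longrightarrow> cyc_char k' w' (h x) = cyc_char k w x"
    by (rule brace_ext_isoE[OF brace_cyc_brace brace_cyc_brace q _ brace_char_cyc[OF w(1)] brace_char_cyc[OF w(2)] _ iso])
       (use coprime_p2_q[OF pq] in \<open>simp_all add: order_cyc_brace\<close>)
  obtain u where u: "coprime u (int p)" "[k = k' * u] (mod int p)"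
    "\<And>x. x \<in> carrier (cyc_brace p k) \<Longrightarrow> h x = u * x mod (int p)\<^sup>2"
    using cyc_iso_form[OF h] by blast
  have "k = k'"
  proof (rule ccontr)
    assume "k \<noteq> k'"
    then consider "k = 0" "k' = 1" | "k = 1" "k' = 0" using k by auto
    then show False
    proof cases
      case 1
      then have "int p dvd u" using u(2) by (simp add: cong_iff_dvd_diff)
      then show ?thesis using u(1) coprime_p by simp
    next
      case 2
      then show ?thesis using u(2) p_gt_1 by (simp add: cong_iff_dvd_diff)
    qed
  qed
  moreover have u1: "[u = 1] (mod int p)" if "k' = 1" using u(2) \<open>k = k'\<close> that by (simp add: cong_sym_eq)
  moreover have "w = w' \<up> u"
  proof -
    \<comment> \<open>\<open>C2 1\<close> is zero, so the value of a character at 1 is its root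
      itself.\<close>
    have mem: "1 \<in> carrier (cyc_brace p k)" using p_gt_1 one_less_power[of "int p" 2] by simp
    have "cyc_char k w 1 = cyc_char k' w' (u * 1 mod (int p)\<^sup>2)" using chi[OF mem] u(3)[OF mem] by simp
    also have "\<dots> = cyc_char k' (w' \<up> u) 1" by (rule cyc_char_scale[OF w(2) k(2) u1])
    finally show ?thesis using rootD(1)[OF w(1)] rootD(1)[OF w(2)] by (simp add: cyc_char_def cyc_exp_def)
  qed
  ultimately show "k = k' \<and> (\<exists>u. coprime u (int p) \<and> (k = 1 \<longrightarrow> [u = 1] (mod int p)) \<and> w = w' \<up> u)"
    using u(1) by blast
next
  assume "k = k' \<and> (\<exists>u. coprime u (int p) \<and> (k = 1 \<longrightarrow> [u = 1] (mod int p)) \<and> w = w' \<up> u)"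
  then obtain u where u: "k = k'" "coprime u (int p)" "k = 1 \<Longrightarrow> [u = 1] (mod int p)" "w = w' \<up> u" by blast
  have "[k = k' * u] (mod int p)" using k u(1,3) by (auto simp: cong_sym_eq)
  then have "(\<lambda>x. u * x mod (int p)\<^sup>2) \<in> brace_iso (cyc_brace p k) (cyc_brace p k')" by (rule cyc_isoI[OF u(2)])
  moreover have "cyc_char k' w' (u * x mod (int p)\<^sup>2) = cyc_char k w x" for x
    using cyc_char_scale[OF w(2) k(2), of u x] u by simp
  ultimately have "map_prod (\<lambda>x. u * x mod (int p)\<^sup>2) id \<in>
      brace_iso (cycE k w) (cycE k' w')"
    by (rule brace_ext_isoI)
  then show "brace_isomorphic (cycB k w) (cycB k' w')"
    using cycB_iso_iff_ext[OF w k] brace_isomorphicI by blast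
qed

lemma cycB_elemB_not_iso:
  assumes pq: "p \<noteq> q" and w: "unity_root (p\<^sup>2) w" "unity_root p w'" "unity_root p v'" and k: "k \<in> {0, 1}" "k' \<in> {0, 1}"
  shows "\<not> brace_isomorphic (cycB k w) (elemB k' w' v')"
proof
  assume iso: "brace_isomorphic (cycB k w) (elemB k' w' v')"
  let ?E = "cycE k w" and ?E' = "elemE k' w' v'"
  have "brace_isomorphic ?E (cycB k w)"
    by (rule brace_isomorphicI[OF cycB_iso_ext[OF rootD(1)[OF w(1)] k(1)]])
  moreover have "brace_isomorphic (elemB k' w' v') ?E'"
    by (rule brace_isomorphic_sym[OF brace_ext_elem[OF w(2,3)]])
       (rule brace_isomorphicI[OF elemB_iso_ext[OF rootD(1)[OF w(2)] rootD(1)[OF w(3)] k(2)]])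
  ultimately have iso: "brace_isomorphic ?E ?E'" using iso by (meson brace_isomorphic_trans)
  obtain h where "h \<in> brace_iso (cyc_brace p k) (elem_brace p k')"
    by (rule brace_ext_isoE[OF brace_cyc_brace brace_elem_brace q _ brace_char_cyc[OF w(1)] brace_char_elem[OF w(2,3)] _ iso])
       (use coprime_p2_q[OF pq] in \<open>simp_all add: order_cyc_brace order_elem_brace\<close>)
  then show False using cyc_elem_no_iso by blast
qed

text \<open>Necessary conditions, enough to separate the list. The square of \<open>(0, 1)\<close>
  is \<open>(k, 0)\<close>, so an isomorphism sending \<open>(0, 1)\<close> to \<open>(b, d)\<close>
  multiplies the first coordinate of that square by d^2; this is the source of the squares in the
  exponent.\<close>

lemma elemB_isoD:
  assumes pq: "p \<noteq> q" and w: "unity_root p w" "unity_root p v" "unity_root p w'" "unity_root p v'" and k: "k \<in> {0, 1}" "k' \<in> {0, 1}"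
    and iso: "brace_isomorphic (elemB k w v) (elemB k' w' v')"
  shows "k = k'" and "k = 1 \<Longrightarrow> \<exists>d. coprime d (int p) \<and> w = w' \<up> (d * d)"
    and "w = 1 \<Longrightarrow> v = 1 \<Longrightarrow> w' = 1 \<and> v' = 1"
proof -
  let ?P = "elem_brace p k" and ?P' = "elem_brace p k'"
  have iso: "brace_isomorphic (brace_ext ?P q (elem_char k w v)) (brace_ext ?P' q (elem_char k' w' v'))"
    using iso elemB_iso_iff_ext[OF w k] by simp
  obtain h where h: "h \<in> brace_iso ?P ?P'"
    and chi: "\<And>x. x \<in> carrier ?P \<Longrightarrow> elem_char k' w' v' (h x) = elem_char k w v x"
    by (rule brace_ext_isoE[OF brace_elem_brace brace_elem_brace q _ brace_char_elem[OF w(1,2)] brace_char_elem[OF w(3,4)] _ iso])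
       (use coprime_p2_q[OF pq] in \<open>simp_all add: order_elem_brace\<close>)
  note hD = brace_isoD[OF h]
  have mem: "(1, 0) \<in> carrier ?P" "(0, 1) \<in> carrier ?P" "(0, 0) \<in> carrier ?P"
    "(1, 0) \<in> carrier ?P'" "(0, 1) \<in> carrier ?P'"
    using p_gt_1 by simp_all
  have h0: "h (0, 0) = (0, 0)" using brace_iso_zero[OF brace_elem_brace brace_elem_brace h] by simp
  have inj: "inj_on h (carrier ?P)" using hD(1) by (simp add: bij_betw_def)
  have surj: "\<exists>x \<in> carrier ?P. h x = y" if "y \<in> carrier ?P'" for y
    using hD(1) that by (metis bij_betw_imp_surj_on imageE)
  obtain b d where bd: "h (0, 1) = (b, d)" by (cases "h (0, 1)")
  have hk: "h (k mod int p, 0) = (k' * d * d mod int p, 0)"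
    using hD(3)[OF mem(2,2)] by (simp add: bd)
  show kk: "k = k'"
  proof (rule ccontr)
    assume "k \<noteq> k'"
    then consider "k = 0" "k' = 1" | "k = 1" "k' = 0" using k by auto
    then show False
    proof cases
      case 1
      \<comment> \<open>All products vanish on the left, whereas \<open>(0, 1)\<close> has a nonzero
        square on the right.\<close>
      obtain x where x: "x \<in> carrier ?P" "h x = (0, 1)" using surj[OF mem(5)] by blast
      have "h (x \<otimes>\<^bsub>?P\<^esub> x) = (1, 0)" using hD(3)[OF x(1) x(1)] x(2) 1 p_gt_1 by simp
      moreover have "x \<otimes>\<^bsub>?P\<^esub> x = (0, 0)" using 1 by (cases x) simp
      ultimately show False using h0 by simp
    next
      case 2
      then have "h (1, 0) = h (0, 0)" using hk p_gt_1 h0 by simp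
      then show False using inj_onD[OF inj, of "(1, 0)" "(0, 0)"] mem by simp
    qed
  qed
  show "\<exists>d. coprime d (int p) \<and> w = w' \<up> (d * d)" if "k = 1"
  proof (intro exI conjI)
    have h1: "h (1, 0) = (d * d mod int p, 0)" using hk that kk p_gt_1 by simp
    show "coprime d (int p)"
    proof (rule ccontr)
      assume "\<not> coprime d (int p)"
      then have "h (1, 0) = h (0, 0)" using h1 h0 coprime_p by simp
      then show False using inj_onD[OF inj, of "(1, 0)" "(0, 0)"] mem by simp
    qed
    have "w = elem_char k w v (1, 0)"
      using rootD(1)[OF w(1)] rootD(1)[OF w(2)] by (simp add: elem_char_def elem_exp_def carrier_U)
    also have "\<dots> = w' \<up> (d * d mod int p)"
      using chi[OF mem(1)] rootD(1)[OF w(3)] U.int_pow_closed[OF rootD(1)[OF w(3)], of "d * d mod int p"]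
      by (simp add: h1 elem_char_def elem_exp_def carrier_U)
    also have "\<dots> = w' \<up> (d * d)" by (rule root_cong[OF w(3)]) simp
    finally show "w = w' \<up> (d * d)" .
  qed
  show "w' = 1 \<and> v' = 1" if "w = 1" "v = 1"
  proof -
    have "elem_char k w v x = 1" for x
      using that U.int_pow_one q_gt_1 by (simp add: elem_char_def)
    then have one: "elem_char k' w' v' y = 1" if "y \<in> carrier ?P'" for y
      using chi surj[OF that] by metis
    have "elem_char k' w' v' (1, 0) = w'" "elem_char k' w' v' (0, 1) = v'"
      using rootD(1)[OF w(3)] rootD(1)[OF w(4)] by (simp_all add: elem_char_def elem_exp_def carrier_U)
    then show ?thesis using one mem by simp
  qed
qed

text \<open>The matrix with rows (a, b) and (c, d). For \<open>k = 0\<close> only invertibility is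
  asked; for \<open>k = 1\<close> preservation of the form (y y', 0) means c = 0 and a = d^2 modulo
  p.\<close>

lemma elem_isoI:
  assumes det: "coprime (a * d - b * c) (int p)"
    and mult: "[k * a = k * d * d] (mod int p)" "[k * c = 0] (mod int p)"
  shows "(\<lambda>(x, y). ((a * x + b * y) mod int p, (c * x + d * y) mod int p)) \<in> brace_iso (elem_brace p k) (elem_brace p k)"
    (is "?h \<in> _")
proof (rule brace_isoI)
  let ?C = "carrier (elem_brace p k)"
  have p0: "0 < int p" using p_gt_1 by simp
  have inj: "inj_on ?h ?C"
  proof (rule inj_onI)
    fix u v assume uv: "u \<in> ?C" "v \<in> ?C" and eq: "?h u = ?h v"
    obtain x y x' y' where *: "u = (x, y)" "v = (x', y')" by (cases u; cases v)
    have e1: "[a * x + b * y = a * x' + b * y'] (mod int p)" and e2: "[c * x + d * y = c * x' + d * y'] (mod int p)"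
      using eq by (simp_all add: * cong_def)
    \<comment> \<open>Cramer's rule: each coordinate is isolated with the determinant as
      factor.\<close>
    have "[d * (a * x + b * y) - b * (c * x + d * y) = d * (a * x' + b * y') - b * (c * x' + d * y')] (mod int p)"
      by (intro cong_diff cong_mult cong_refl e1 e2)
    then have "[(a * d - b * c) * x = (a * d - b * c) * x'] (mod int p)" by (simp add: algebra_simps)
    then have "[x = x'] (mod int p)" using det by (simp add: cong_mult_lcancel)
    moreover have "[a * (c * x + d * y) - c * (a * x + b * y) = a * (c * x' + d * y') - c * (a * x' + b * y')] (mod int p)"
      by (intro cong_diff cong_mult cong_refl e1 e2)
    then have "[(a * d - b * c) * y = (a * d - b * c) * y'] (mod int p)" by (simp add: algebra_simps)
    then have "[y = y'] (mod int p)" using det by (simp add: cong_mult_lcancel)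
    ultimately show "u = v" using uv by (simp add: * cong_def)
  qed
  have "?h ` ?C = ?C"
    by (rule endo_inj_surj[OF _ _ inj]) (use p0 in auto)
  then show "bij_betw ?h ?C ?C" using inj by (simp add: bij_betw_def)
  fix u v :: "int \<times> int"
  obtain x y x' y' where *: "u = (x, y)" "v = (x', y')" by (cases u; cases v)
  have "[a * ((x + x') mod int p) + b * ((y + y') mod int p) = (a * x + b * y) + (a * x' + b * y')] (mod int p)" for a b
  proof -
    have "[a * ((x + x') mod int p) + b * ((y + y') mod int p) = a * (x + x') + b * (y + y')] (mod int p)"
      by (intro cong_add cong_mult cong_refl) simp_all
    then show ?thesis by (simp add: algebra_simps)
  qed
  then show "?h (u \<oplus>\<^bsub>elem_brace p k\<^esub> v) = ?h u \<oplus>\<^bsub>elem_brace p k\<^esub> ?h v"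
    by (simp add: * cong_def mod_simps)
  have "[a * (k * y * y') = k * ((c * x + d * y) mod int p) * ((c * x' + d * y') mod int p)] (mod int p)"
  proof -
    have "[k * ((c * x + d * y) mod int p) * ((c * x' + d * y') mod int p) = k * (c * x + d * y) * (c * x' + d * y')] (mod int p)"
      by (intro cong_mult cong_refl) simp_all
    also have "k * (c * x + d * y) * (c * x' + d * y') =
        k * c * (x * (c * x' + d * y') + d * y * x') + k * d * d * (y * y')" by (simp add: algebra_simps)
    also have "[\<dots> = 0 * (x * (c * x' + d * y') + d * y * x') + k * a * (y * y')] (mod int p)"
      by (intro cong_add cong_mult mult(2) cong_sym[OF mult(1)] cong_refl)
    finally show ?thesis by (simp add: ac_simps cong_sym_eq)
  qed
  moreover have "[c * (k * y * y') = 0] (mod int p)"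
    using cong_scalar_right[OF mult(2), of "y * y'"] by (simp add: ac_simps)
  ultimately show "?h (u \<otimes>\<^bsub>elem_brace p k\<^esub> v) = ?h u \<otimes>\<^bsub>elem_brace p k\<^esub> ?h v"
    by (simp add: * cong_def mod_simps)
qed

end

section \<open>Normal forms\<close>

text \<open>By Euler's criterion the product of two nonresidues is a square y^2; with c inverse to
  b, the witness is d = y c, as b y^2 c^2 = a (b c)^2 = a.\<close>

lemma nonresidue_quotient:
  fixes p :: nat
  assumes p: "Factorial_Ring.prime p" "2 < p" and a: "\<not> QuadRes (int p) a" "\<not> QuadRes (int p) b"
  obtains d where "[a = b * (d * d)] (mod int p)"
proof -
  let ?e = "(p - 1) div 2"
  have pow: "[c ^ ?e = - 1] (mod int p)" if "\<not> QuadRes (int p) c" for c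
  proof -
    have "\<not> [c = 0] (mod int p)"
      using that cong_sym[of c 0 "int p"] unfolding QuadRes_def by (metis zero_power2)
    then have "Legendre c (int p) = - 1" using that by (simp add: Legendre_def)
    then show ?thesis using euler_criterion[OF p, of c] by (simp add: cong_sym_eq)
  qed
  have "[(a * b) ^ ?e = - 1 * - 1] (mod int p)"
    unfolding power_mult_distrib by (rule cong_mult[OF pow[OF a(1)] pow[OF a(2)]])
  then have ab: "[Legendre (a * b) (int p) = 1] (mod int p)"
    using euler_criterion[OF p, of "a * b"] cong_trans by auto
  have "Legendre (a * b) (int p) = 1"
  proof (rule ccontr)
    assume "Legendre (a * b) (int p) \<noteq> 1"
    then consider "Legendre (a * b) (int p) = 0" | "Legendre (a * b) (int p) = - 1"
      by (auto simp: Legendre_def split: if_splits)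
    then have "int p dvd 1 \<or> int p dvd 2"
    proof cases
      case 1
      then show ?thesis using ab by (simp add: cong_iff_dvd_diff)
    next
      case 2
      then show ?thesis using ab by (simp add: cong_iff_dvd_diff)
    qed
    then show False using p(2) by (auto dest!: zdvd_imp_le)
  qed
  then obtain y where y: "[y\<^sup>2 = a * b] (mod int p)"
    by (auto simp: Legendre_def QuadRes_def split: if_splits)
  have "\<not> int p dvd b"
    using a(2) cong_0_iff[of b "int p"] cong_sym[of b 0 "int p"] unfolding QuadRes_def by (metis zero_power2)
  then have "coprime b (int p)"
    using prime_imp_coprime[of "int p" b] p(1) by (simp add: coprime_commute)
  then obtain c where c: "[b * c = 1] (mod int p)" using cong_solve_coprime_int by blast
  have "[b * ((y * c) * (y * c)) = y\<^sup>2 * c * (b * c)] (mod int p)" by (simp add: power2_eq_square ac_simps)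
  also have "[y\<^sup>2 * c * (b * c) = (a * b) * c * 1] (mod int p)" by (intro cong_mult y c cong_refl)
  also have "[(a * b) * c * 1 = a * (b * c)] (mod int p)" by (simp add: ac_simps)
  also have "[a * (b * c) = a * 1] (mod int p)" by (intro cong_mult c cong_refl)
  finally have "[a = b * ((y * c) * (y * c))] (mod int p)" by (simp add: cong_sym_eq)
  then show ?thesis by (rule that)
qed

context prime_modulus
begin

lemma ord_dvd_q1: "w \<in> carrier U \<Longrightarrow> U.ord w dvd q - 1"
  using U.ord_dvd_group_order[of w] q_gt_1 by (simp add: order_def carrier_U nat_diff_distrib)

text \<open>The field \<open>Z_q\<close> contains at most \<open>n\<close> solutions of \<open>x^n = 1\<close>.\<close>

lemma root_generated:
  assumes w0: "w0 \<in> carrier U" "U.ord w0 = n" "0 < n" and w: "w \<in> carrier U" "w \<up> int n = 1"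
  shows "\<exists>i. 0 \<le> i \<and> i < int n \<and> w = w0 \<up> i"
proof -
  let ?S = "{x \<in> carrier Zq. x [^]\<^bsub>Zq\<^esub> n = \<one>\<^bsub>Zq\<^esub>}"
  have S: "x \<in> ?S" if "x \<in> carrier U" "x \<up> int n = 1" for x
    using that int_pow_U[of x "int n"] R.one_cong q_gt_1
    by (simp add: int_pow_int carrier_U R.res_carrier_eq)
  have eq: "w0 \<up> i = w0 \<up> j \<longleftrightarrow> int n dvd j - i" for i j
    using U.int_pow_eq[OF w0(1)] w0(2) by simp
  have inj: "inj_on (\<lambda>i. w0 \<up> i) {0..<int n}"
    by (rule inj_onI) (auto simp: eq cong_def simp flip: cong_iff_dvd_diff)
  have "(\<lambda>i. w0 \<up> i) ` {0..<int n} = ?S"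
  proof (rule card_seteq)
    show "finite ?S" by simp
    show "(\<lambda>i. w0 \<up> i) ` {0..<int n} \<subseteq> ?S"
    proof (rule image_subsetI)
      fix i :: int
      have "(w0 \<up> i) \<up> int n = w0 \<up> (0 :: int)"
        unfolding U.int_pow_pow[OF w0(1)] eq by simp
      then show "w0 \<up> i \<in> ?S" by (intro S) (use w0(1) in simp_all)
    qed
    show "card ?S \<le> card ((\<lambda>i. w0 \<up> i) ` {0..<int n})"
      using R.num_roots_le_deg[of n] w0(3) by (simp add: card_image[OF inj])
  qed
  then have "w \<in> (\<lambda>i. w0 \<up> i) ` {0..<int n}" using S[OF w] by simp
  then show ?thesis by auto
qed

end

lemma brace_char_comp:
  assumes P: "brace P" and h: "h \<in> brace_iso P P'" and chi: "brace_char P' q \<chi>"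
  shows "brace_char P q (\<lambda>x. \<chi> (h x))"
proof -
  interpret P: brace P by fact
  note hD = brace_isoD[OF h]
  have "h (circle P x y) = circle P' (h x) (h y)" if "x \<in> carrier P" "y \<in> carrier P" for x y
    using that by (simp add: circle_def hD P.mult_closed)
  then show ?thesis using chi hD(4) by (simp add: brace_char_def)
qed

context pq_primes
begin

lemma brace_classification_params:
  assumes pq: "2 < p" "p < q" and A: "brace A" "order A = p\<^sup>2 * q"
  shows "(\<exists>k\<in>{0, 1}. \<exists>w. unity_root (p\<^sup>2) w \<and> brace_isomorphic A (cycB k w)) \<or>
    (\<exists>k\<in>{0, 1}. \<exists>w v. unity_root p w \<and> unity_root p v \<and> brace_isomorphic A (elemB k w v))"
proof -
  interpret A: brace A by fact
  have card: "card (torsion A (p\<^sup>2)) = p\<^sup>2" "card (torsion A q) = q"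
    using A.card_torsion[OF p q, of 2 1] pq A(2) by auto
  let ?P = "A\<lparr>carrier := torsion A (p\<^sup>2)\<rparr>"
  obtain \<chi> where P: "brace ?P" and chi: "brace_char ?P q \<chi>" and iso: "brace_isomorphic (brace_ext ?P q \<chi>) A"
    using A.brace_ext_decomposition[OF q coprime_p2_q A(2) card A.torsion_mult_zero[OF p q pq A(2)]] pq(2) by blast
  have "order ?P = p\<^sup>2" using card(1) by (simp add: order_def)
  then obtain k where k: "k \<in> {0, 1}"
    and "brace_isomorphic (cyc_brace p k) ?P \<or> brace_isomorphic (elem_brace p k) ?P"
    using brace.brace_p2_classification[OF P p] by blast
  then consider h where "h \<in> brace_iso (cyc_brace p k) ?P" | h where "h \<in> brace_iso (elem_brace p k) ?P"
    unfolding brace_isomorphic_def by blast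
  then show ?thesis
  proof cases
    case 1
    obtain w where w: "unity_root (p\<^sup>2) w" "\<And>x. x \<in> carrier (cyc_brace p k) \<Longrightarrow> \<chi> (h x) = cyc_char k w x"
      using cyc_char_unique[OF brace_char_comp[OF brace_cyc_brace 1 chi]] by blast
    have "brace_isomorphic (cycE k w) A"
    proof (rule brace_isomorphic_trans[OF brace_isomorphicI iso])
      show "map_prod h id \<in> brace_iso (cycE k w) (brace_ext ?P q \<chi>)"
        by (rule brace_ext_isoI[OF 1]) (rule w(2))
    qed
    then have "brace_isomorphic A (cycE k w)"
      by (rule brace_isomorphic_sym[OF brace_ext_cyc[OF w(1)]])
    then have "brace_isomorphic A (cycB k w)"
      using brace_isomorphic_trans brace_isomorphicI[OF cycB_iso_ext[OF rootD(1)[OF w(1)] k]] by blast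
    then show ?thesis using k w(1) by blast
  next
    case 2
    obtain w v where w: "unity_root p w" "unity_root p v" "\<And>x. x \<in> carrier (elem_brace p k) \<Longrightarrow> \<chi> (h x) = elem_char k w v x"
      using elem_char_unique[OF brace_char_comp[OF brace_elem_brace 2 chi]] by blast
    have "brace_isomorphic (elemE k w v) A"
    proof (rule brace_isomorphic_trans[OF brace_isomorphicI iso])
      show "map_prod h id \<in> brace_iso (elemE k w v) (brace_ext ?P q \<chi>)"
        by (rule brace_ext_isoI[OF 2]) (rule w(3))
    qed
    then have "brace_isomorphic A (elemE k w v)"
      by (rule brace_isomorphic_sym[OF brace_ext_elem[OF w(1,2)]])
    then have "brace_isomorphic A (elemB k w v)"
      using brace_isomorphic_trans brace_isomorphicI[OF elemB_iso_ext[OF rootD(1)[OF w(1)] rootD(1)[OF w(2)] k]] by blast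
    then show ?thesis using k w(1,2) by blast
  qed
qed

section \<open>Orders of roots of unity\<close>

lemma root_iff_ord: "w \<in> carrier U \<Longrightarrow> unity_root n w \<longleftrightarrow> U.ord w dvd n"
  using U.int_pow_eq[of w "int n" 0] by (simp add: unity_root_def)

lemma root_dvd: "unity_root m w \<Longrightarrow> m dvd n \<Longrightarrow> unity_root n w"
  using root_iff_ord[OF rootD(1), of m w] root_iff_ord[OF rootD(1), of m w n] dvd_trans by blast

lemma root_p_p2: "unity_root p w \<Longrightarrow> unity_root (p\<^sup>2) w"
  by (erule root_dvd) simp

lemma root_1_iff: "w \<in> carrier U \<Longrightarrow> unity_root 1 w \<longleftrightarrow> w = 1"
  by (simp add: unity_root_def)

lemma root_n_1: "unity_root n 1"
  using U.int_pow_one[of "int n"] q_gt_1 by (simp add: unity_root_def carrier_U)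

text \<open>The order of \<open>w\<close> is 1, p or p^2 and divides q - 1, so the divisibility of q
  - 1 by powers of p bounds it.\<close>

lemma root_p_cases:
  assumes w: "unity_root (p\<^sup>2) w"
  shows "\<not> p dvd q - 1 \<Longrightarrow> w = 1" and "\<not> p\<^sup>2 dvd q - 1 \<Longrightarrow> unity_root p w"
proof -
  note wU = rootD(1)[OF w]
  have "U.ord w dvd p ^ 2" using root_iff_ord[OF wU] w by simp
  then obtain i where i: "i \<le> 2" "U.ord w = p ^ i" using p by (auto simp: divides_primepow_nat)
  then have dvd: "p ^ i dvd q - 1" using ord_dvd_q1[OF wU] by simp
  show "w = 1" if "\<not> p dvd q - 1"
  proof -
    have "i = 0"
    proof (rule ccontr)
      assume "i \<noteq> 0"
      then have "p dvd p ^ i" by simp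
      then show False using dvd that dvd_trans by blast
    qed
    then show ?thesis using U.ord_eq_1[OF wU] i by simp
  qed
  show "unity_root p w" if "\<not> p\<^sup>2 dvd q - 1"
  proof -
    have "i \<noteq> 2" using dvd that by auto
    then have "p ^ i dvd p ^ 1" using i by (intro le_imp_power_dvd) simp
    then show ?thesis using root_iff_ord[OF wU] i by simp
  qed
qed

section \<open>Representatives of the orbits on characters\<close>

lemma cycB0_iso_power:
  assumes pq: "p \<noteq> q" and w: "unity_root (p\<^sup>2) w" and i: "\<not> int p dvd i"
  shows "brace_isomorphic (cycB 0 (w \<up> i)) (cycB 0 w)"
  using cycB_iso_iff[OF pq root_power[OF w] w, of 0 0] i coprime_p by auto

text \<open>The automorphism is multiplication by u = i / j, computed modulo p^2; it is 1 modulo p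
  because i and j agree modulo p.\<close>

lemma cycB1_iso_power:
  assumes pq: "p \<noteq> q" and w: "unity_root (p\<^sup>2) w" and i: "\<not> int p dvd i" "[i = j] (mod int p)"
  shows "brace_isomorphic (cycB 1 (w \<up> i)) (cycB 1 (w \<up> j))"
proof -
  have cj: "coprime j (int p)" using i coprime_p cong_dvd_iff by blast
  then have "coprime j ((int p)\<^sup>2)" by simp
  then obtain c where c: "[j * c = 1] (mod (int p)\<^sup>2)" using cong_solve_coprime_int by blast
  let ?u = "c * i"
  have "[j * c * i = 1 * i] (mod (int p)\<^sup>2)" by (intro cong_mult c cong_refl)
  then have ju: "[j * ?u = i] (mod (int p)\<^sup>2)" by (simp add: ac_simps)
  have "[c * i = c * j] (mod int p)" by (intro cong_mult i cong_refl)
  then have u1: "[?u = 1] (mod int p)" using cong_p2_p[OF c] cong_trans by (metis mult.commute)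
  then have "coprime ?u (int p)" by (metis cong_imp_coprime cong_sym coprime_1_left)
  moreover have "w \<up> i = (w \<up> j) \<up> ?u"
    unfolding U.int_pow_pow[OF rootD(1)[OF w]] by (rule root_cong2[OF w cong_sym[OF ju]])
  ultimately show ?thesis
    using cycB_iso_iff[OF pq root_power[OF w] root_power[OF w], of 1 1 i j] u1 by blast
qed

lemma elem_char_power:
  assumes "w \<in> carrier U"
  shows "elem_char k (w \<up> i) (w \<up> j) u = w \<up> (i * elem_exp k u + j * snd u)"
  unfolding elem_char_def U.int_pow_pow[OF assms] U.int_pow_mult[OF assms] ..

text \<open>With both pairs of roots written as powers of a single \<open>w\<close>, matching of
  characters becomes a linear condition on exponents modulo p.\<close>

lemma elemB_isoI:
  fixes i j i' j' :: int
  assumes w: "unity_root p w" and k: "k \<in> {0, 1}" and det: "\<not> int p dvd a * d - b * c"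
    and mult: "[k * a = k * d * d] (mod int p)" "[k * c = 0] (mod int p)"
    and exp: "\<And>x y. [i' * (a * x + b * y - k * C2 (c * x + d * y)) + j' * (c * x + d * y)
      = i * (x - k * C2 y) + j * y] (mod int p)"
  shows "brace_isomorphic (elemB k (w \<up> i) (w \<up> j)) (elemB k (w \<up> i') (w \<up> j'))"
proof -
  let ?h = "\<lambda>(x, y). ((a * x + b * y) mod int p, (c * x + d * y) mod int p)"
  have h: "?h \<in> brace_iso (elem_brace p k) (elem_brace p k)"
    using elem_isoI[OF _ mult] det coprime_p by blast
  have "elem_char k (w \<up> i') (w \<up> j') (?h u) = elem_char k (w \<up> i) (w \<up> j) u" for u
  proof -
    obtain x y where u: "u = (x, y)" by (cases u)
    have "[i' * ((a * x + b * y) mod int p - k * C2 ((c * x + d * y) mod int p)) + j' * ((c * x + d * y) mod int p)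
      = i' * (a * x + b * y - k * C2 (c * x + d * y)) + j' * (c * x + d * y)] (mod int p)"
      by (intro cong_add cong_diff cong_mult C2_p_cong cong_refl) simp_all
    then have "[i' * elem_exp k (?h u) + j' * snd (?h u) = i * elem_exp k u + j * snd u] (mod int p)"
      using exp[of x y] cong_trans by (simp add: u elem_exp_def) blast
    then show ?thesis unfolding elem_char_power[OF rootD(1)[OF w]] by (rule root_cong[OF w])
  qed
  then have "map_prod ?h id \<in> brace_iso (elemE k (w \<up> i) (w \<up> j))
      (elemE k (w \<up> i') (w \<up> j'))"
    by (rule brace_ext_isoI[OF h])
  then show ?thesis
    using elemB_iso_iff_ext[OF root_power[OF w] root_power[OF w] root_power[OF w] root_power[OF w] k k] brace_isomorphicI
    by blast
qed

text \<open>Describes the substitution of \<open>d * y\<close> for \<open>y\<close>: the quadratic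
  part scales by d^2, and the linear remainder can be absorbed into the second exponent.\<close>

lemma C2_mult: "C2 (d * y) = d * d * C2 y + C2 d * y"
proof -
  have "2 * C2 (d * y) = 2 * (d * d * C2 y + C2 d * y)"
  proof -
    have "2 * (d * d * C2 y + C2 d * y) = d * d * (2 * C2 y) + 2 * C2 d * y" by (simp add: algebra_simps)
    then show ?thesis unfolding C2_eq by (simp add: algebra_simps)
  qed
  then show ?thesis by simp
qed

lemma not_p_dvd_mult: "\<not> int p dvd a \<Longrightarrow> \<not> int p dvd b \<Longrightarrow> \<not> int p dvd a * b"
  using p prime_dvd_mult_iff[of "int p" a b] by simp

text \<open>All invertible matrices are allowed, so the nonzero linear form with coefficients i, j
  is taken as the first row, completed by a unit vector.\<close>

lemma elemB0_normal:
  fixes i j :: int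
  assumes w: "unity_root p w" and ij: "\<not> int p dvd i \<or> \<not> int p dvd j"
  shows "brace_isomorphic (elemB 0 (w \<up> i) (w \<up> j)) (elemB 0 w 1)"
proof -
  have w1: "w \<up> (1 :: int) = w" "w \<up> (0 :: int) = 1" using rootD(1)[OF w] by simp_all
  show ?thesis
  proof (cases "int p dvd i")
    case True
    have "brace_isomorphic (elemB 0 (w \<up> i) (w \<up> j)) (elemB 0 (w \<up> (1 :: int)) (w \<up> (0 :: int)))"
      by (rule elemB_isoI[OF w, where a = i and b = j and c = 1 and d = 0]) (use ij True in auto)
    then show ?thesis unfolding w1 .
  next
    case False
    have "brace_isomorphic (elemB 0 (w \<up> i) (w \<up> j)) (elemB 0 (w \<up> (1 :: int)) (w \<up> (0 :: int)))"
      by (rule elemB_isoI[OF w, where a = i and b = j and c = 0 and d = 1]) (use False in auto)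
    then show ?thesis unfolding w1 .
  qed
qed

text \<open>The first root is trivial; scaling the second coordinate by j, and hence the first by
  j^2, normalises the second root.\<close>

lemma elemB1_normal_dvd:
  fixes i j :: int
  assumes w: "unity_root p w" and ij: "int p dvd i" "\<not> int p dvd j"
  shows "brace_isomorphic (elemB 1 (w \<up> i) (w \<up> j)) (elemB 1 1 w)"
proof -
  have w1: "w \<up> (1 :: int) = w" "w \<up> (0 :: int) = 1" using rootD(1)[OF w] by simp_all
  have "brace_isomorphic (elemB 1 (w \<up> i) (w \<up> j)) (elemB 1 (w \<up> (0 :: int)) (w \<up> (1 :: int)))"
  proof (rule elemB_isoI[OF w, where a = "j * j" and b = 0 and c = 0 and d = j])
    show "\<not> int p dvd j * j * j - 0 * 0" using not_p_dvd_mult ij(2) by simp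
  qed (use ij(1) in \<open>auto simp: cong_iff_dvd_diff\<close>)
  then show ?thesis unfolding w1 .
qed

text \<open>Scaling by d changes the first exponent by a square, and the shear entry b then removes
  the second root.\<close>

lemma elemB1_normal_coprime:
  fixes i j i' d :: int
  assumes w: "unity_root p w" and i: "\<not> int p dvd i" "[i = i' * (d * d)] (mod int p)"
  shows "brace_isomorphic (elemB 1 (w \<up> i) (w \<up> j)) (elemB 1 (w \<up> i') 1)"
proof -
  have w1: "w \<up> (0 :: int) = 1" by simp
  have "\<not> int p dvd i' * (d * d)" using i cong_dvd_iff by blast
  then have d: "\<not> int p dvd d" and i': "\<not> int p dvd i'" by auto
  then obtain c where c: "[i' * c = 1] (mod int p)" using cong_solve_coprime_int coprime_p by blast
  \<comment> \<open>Solves i' (b - C2(d)) = j modulo p; the summand \<open>C2 d\<close> compensates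
    the linear remainder of \<open>C2_mult\<close>.\<close>
  define b where "b = c * j + C2 d"
  have b: "[i' * (b - C2 d) = j] (mod int p)"
    using cong_scalar_right[OF c, of j] by (simp add: b_def ac_simps)
  have "brace_isomorphic (elemB 1 (w \<up> i) (w \<up> j)) (elemB 1 (w \<up> i') (w \<up> (0 :: int)))"
  proof (rule elemB_isoI[OF w, where a = "d * d" and b = b and c = 0 and d = d])
    show "\<not> int p dvd d * d * d - b * 0" using not_p_dvd_mult d by simp
    fix x y
    have "i' * (d * d * x + b * y - 1 * C2 (0 * x + d * y)) + 0 * (0 * x + d * y)
      = i' * (d * d) * (x - C2 y) + i' * (b - C2 d) * y"
      by (simp add: C2_mult algebra_simps)
    also have "[\<dots> = i * (x - C2 y) + j * y] (mod int p)"
      by (intro cong_add cong_mult cong_refl b cong_sym[OF i(2)])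
    finally show "[i' * (d * d * x + b * y - 1 * C2 (0 * x + d * y)) + 0 * (0 * x + d * y)
      = i * (x - 1 * C2 y) + j * y] (mod int p)" by simp
  qed auto
  then show ?thesis unfolding w1 .
qed

section \<open>Invariants that separate the named braces\<close>

lemma cycB_iso_root:
  assumes pq: "p \<noteq> q" and w: "unity_root (p\<^sup>2) w" "unity_root (p\<^sup>2) w'" and k: "k \<in> {0, 1}" "k' \<in> {0, 1}"
    and iso: "brace_isomorphic (cycB k w) (cycB k' w')" and n: "unity_root n w'"
  shows "unity_root n w"
proof -
  obtain u where "w = w' \<up> (u :: int)" using cycB_iso_iff[OF pq w k] iso by blast
  then show ?thesis using root_power[OF n] by simp
qed

text \<open>In isomorphic braces each root is a power of the other. The choice n = 1 singles out the
  trivial root and n = p the roots of order p^2.\<close>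

lemma cycB_not_iso:
  assumes "p \<noteq> q" "unity_root (p\<^sup>2) w" "unity_root (p\<^sup>2) w'" "k \<in> {0, 1}" "k' \<in> {0, 1}"
    and n: "unity_root n w \<longleftrightarrow> \<not> unity_root n w'"
  shows "\<not> brace_isomorphic (cycB k w) (cycB k' w')"
proof
  assume iso: "brace_isomorphic (cycB k w) (cycB k' w')"
  have iso': "brace_isomorphic (cycB k' w') (cycB k w)"
    by (rule brace_isomorphic_sym[OF brace_cycB(1) iso]) (use assms in auto)
  show False
    using cycB_iso_root[OF assms(1-5) iso, of n] cycB_iso_root[OF assms(1,3,2,5,4) iso', of n] n by blast
qed

text \<open>The exponents agree up to a factor u = 1 modulo p, and p divides the order of
  \<open>w\<close>; this serves roots of order p and of order p^2 alike.\<close>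

lemma cycB1_power_inj:
  assumes pq: "p \<noteq> q" and w: "unity_root (p\<^sup>2) w" "p dvd U.ord w"
    and iso: "brace_isomorphic (cycB 1 (w \<up> i)) (cycB 1 (w \<up> j))"
  shows "[i = j] (mod int p)"
proof -
  obtain u where u: "[u = 1] (mod int p)" "w \<up> i = (w \<up> j) \<up> (u :: int)"
    using cycB_iso_iff[OF pq root_power[OF w(1)] root_power[OF w(1)], of 1 1 i j] iso by auto
  have "int (U.ord w) dvd j * u - i"
    using u(2) U.int_pow_eq[OF rootD(1)[OF w(1)]] unfolding U.int_pow_pow[OF rootD(1)[OF w(1)]] by simp
  then have "int p dvd j * u - i" using w(2) by (meson dvd_trans int_dvd_int_iff)
  then have 1: "[j * u = i] (mod int p)" by (simp add: cong_iff_dvd_diff)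
  have 2: "[j * u = j * 1] (mod int p)" by (intro cong_mult u cong_refl)
  from cong_trans[OF cong_sym[OF 1] 2] show ?thesis by simp
qed

end

section \<open>The classification\<close>

locale brace_list = pq_primes +
  fixes \<omega> \<eta> \<omega>t :: int
  assumes lt: "2 < p" "p < q"
    and \<omega>: "p dvd q - 1 \<Longrightarrow> primitive_root_mod p q \<omega>"
    and \<eta>: "p dvd q - 1 \<Longrightarrow> quadratic_nonresidue p \<eta>"
    and \<omega>t: "p\<^sup>2 dvd q - 1 \<Longrightarrow> primitive_root_mod (p\<^sup>2) q \<omega>t"
begin

lemma pq: "p \<noteq> q"
  using lt by simp

lemma p_dvd: "p\<^sup>2 dvd q - 1 \<Longrightarrow> p dvd q - 1"
  using dvd_trans[of p "p\<^sup>2" "q - 1"] by simp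

lemma \<omega>_facts:
  assumes "p dvd q - 1"
  shows "\<omega> \<in> carrier U" "U.ord \<omega> = p" "unity_root p \<omega>" "unity_root (p\<^sup>2) \<omega>"
proof -
  show *: "\<omega> \<in> carrier U" "U.ord \<omega> = p"
    using \<omega>[OF assms] by (simp_all add: primitive_root_mod_def units_of_carrier)
  show "unity_root p \<omega>" using root_iff_ord[OF *(1)] *(2) by simp
  then show "unity_root (p\<^sup>2) \<omega>" by (rule root_p_p2)
qed

lemma \<omega>t_facts:
  assumes "p\<^sup>2 dvd q - 1"
  shows "\<omega>t \<in> carrier U" "U.ord \<omega>t = p\<^sup>2" "unity_root (p\<^sup>2) \<omega>t"
proof -
  show *: "\<omega>t \<in> carrier U" "U.ord \<omega>t = p\<^sup>2"
    using \<omega>t[OF assms] by (simp_all add: primitive_root_mod_def units_of_carrier)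
  show "unity_root (p\<^sup>2) \<omega>t" using root_iff_ord[OF *(1)] *(2) by simp
qed

lemma \<omega>_power_eq_1: "p dvd q - 1 \<Longrightarrow> \<omega> \<up> i = 1 \<longleftrightarrow> int p dvd i"
  using U.int_pow_eq[OF \<omega>_facts(1), of i 0] \<omega>_facts(2) by simp

lemma \<omega>t_power_root_p: "p\<^sup>2 dvd q - 1 \<Longrightarrow> unity_root p (\<omega>t \<up> i) \<longleftrightarrow> int p dvd i"
proof -
  assume d: "p\<^sup>2 dvd q - 1"
  have "unity_root p (\<omega>t \<up> i) \<longleftrightarrow> \<omega>t \<up> (i * int p) = \<omega>t \<up> (0 :: int)"
    using \<omega>t_facts(1)[OF d] U.int_pow_pow[OF \<omega>t_facts(1)[OF d]] by (simp add: unity_root_def)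
  also have "\<dots> \<longleftrightarrow> int p * int p dvd i * int p"
    unfolding U.int_pow_eq[OF \<omega>t_facts(1)[OF d]] \<omega>t_facts(2)[OF d] by (simp add: power2_eq_square)
  finally show ?thesis using p_gt_1 by simp
qed

lemma \<eta>_facts:
  assumes "p dvd q - 1"
  shows "\<not> QuadRes (int p) \<eta>" "\<not> int p dvd \<eta>"
proof -
  show *: "\<not> QuadRes (int p) \<eta>" using \<eta>[OF assms] by (simp add: quadratic_nonresidue_def)
  show "\<not> int p dvd \<eta>"
    using * cong_0_iff[of \<eta> "int p"] cong_sym[of \<eta> 0 "int p"] unfolding QuadRes_def by (metis zero_power2)
qed

text \<open>The list is split according to whether the largest order of a root is 1, p or
  p^2.\<close>

definition "trivial_list = [elemB 0 1 1, cycB 0 1, elemB 1 1 1, cycB 1 1]"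

definition "order_p_list =
  [elemB 0 \<omega> 1, cycB 0 \<omega>, elemB 1 1 \<omega>, elemB 1 \<omega> 1, elemB 1 (\<omega> \<up> \<eta>) 1]
  @ map (\<lambda>i. cycB 1 (\<omega> \<up> int i)) [1..<p]"

definition "order_p2_list = cycB 0 \<omega>t # map (\<lambda>i. cycB 1 (\<omega>t \<up> int i)) [1..<p]"

lemma named_braces_eq:
  "named_braces p q \<omega> \<eta> \<omega>t =
    trivial_list @ (if p dvd q - 1 then order_p_list else []) @ (if p\<^sup>2 dvd q - 1 then order_p2_list else [])"
  using \<omega>_facts(1) \<omega>t_facts(1)
  by (simp add: named_braces_def trivial_list_def order_p_list_def order_p2_list_def Let_def elemB_def cycB_def
      int_pow_U int_pow_int R.units_of_nat_pow)

lemma named_braces_brace: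
  assumes "B \<in> set (named_braces p q \<omega> \<eta> \<omega>t)"
  shows "brace B \<and> order B = p\<^sup>2 * q"
proof -
  let ?ok = "\<lambda>B. brace B \<and> order B = p\<^sup>2 * q"
  have ok: "?ok (cycB k w)" if "unity_root (p\<^sup>2) w" "k \<in> {0, 1}" for k w
    using brace_cycB[OF that] by simp
  have ok': "?ok (elemB k w v)" if "unity_root p w" "unity_root p v" "k \<in> {0, 1}" for k w v
    using brace_elemB[OF that] by simp
  have 1: "\<forall>B \<in> set trivial_list. ?ok B"
    by (simp add: trivial_list_def ok ok' root_n_1)
  have 2: "\<forall>B \<in> set order_p_list. ?ok B" if a: "p dvd q - 1"
    by (simp add: order_p_list_def ok ok' root_n_1 \<omega>_facts(3,4)[OF a]
        root_power[OF \<omega>_facts(3)[OF a]] root_power[OF \<omega>_facts(4)[OF a]])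
  have 3: "\<forall>B \<in> set order_p2_list. ?ok B" if b: "p\<^sup>2 dvd q - 1"
    by (simp add: order_p2_list_def ok \<omega>t_facts(3)[OF b] root_power[OF \<omega>t_facts(3)[OF b]])
  have "B \<in> set trivial_list \<or> (p dvd q - 1 \<and> B \<in> set order_p_list) \<or> (p\<^sup>2 dvd q - 1 \<and> B \<in> set order_p2_list)"
    using assms unfolding named_braces_eq set_append Un_iff by (simp split: if_splits)
  then show ?thesis using 1 2 3 by blast
qed

text \<open>Ordered pairs suffice, as isomorphism is symmetric. The shape of the additive p-part and
  the parameter \<open>k\<close> separate most braces; within one family the order of the roots,
  their exponents modulo p, or quadratic residuosity decide.\<close>

lemma named_braces_pairwise:
  "sorted_wrt (\<lambda>B B'. \<not> brace_isomorphic B B') (named_braces p q \<omega> \<eta> \<omega>t)"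
proof -
  let ?R = "\<lambda>B B'. \<not> brace_isomorphic B B'"
  have ce: "?R (cycB k w) (elemB k' w' v')" "?R (elemB k' w' v') (cycB k w)"
    if "unity_root (p\<^sup>2) w" "unity_root p w'" "unity_root p v'" "k \<in> {0, 1}" "k' \<in> {0, 1}" for k k' w w' v'
    using cycB_elemB_not_iso[OF pq that] brace_isomorphic_sym[OF brace_elemB(1)[OF that(2,3,5)]] by auto
  have cc: "?R (cycB k w) (cycB k' w')"
    if "k \<noteq> k'" "unity_root (p\<^sup>2) w" "unity_root (p\<^sup>2) w'" "k \<in> {0, 1}" "k' \<in> {0, 1}" for k k' w w'
    using cycB_iso_iff[OF pq that(2-5)] that(1) by blast
  have ee: "?R (elemB k w v) (elemB k' w' v')"
    if "k \<noteq> k'" "unity_root p w" "unity_root p v" "unity_root p w'" "unity_root p v'" "k \<in> {0, 1}" "k' \<in> {0, 1}" for k k' w v w' v'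
    using elemB_isoD(1)[OF pq that(2-7)] that(1) by blast
  have e1: "?R (elemB k 1 1) (elemB k w v)"
    if "unity_root p w" "unity_root p v" "k \<in> {0, 1}" "w \<noteq> 1 \<or> v \<noteq> 1" for k w v
    using elemB_isoD(3)[OF pq root_n_1 root_n_1 that(1,2,3,3)] that(4) by blast
  have c1: "?R (cycB k 1) (cycB k w)"
    if "unity_root (p\<^sup>2) w" "k \<in> {0, 1}" "w \<noteq> 1" for k w
    by (rule cycB_not_iso[OF pq root_n_1 that(1,2,2), where n = 1])
       (use that root_1_iff[OF rootD(1)[OF that(1)]] root_n_1 in simp)
  have ct: "?R (cycB k w) (cycB k w')"
    if "unity_root p w" "unity_root (p\<^sup>2) w'" "k \<in> {0, 1}" "\<not> unity_root p w'" for k w w'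
    by (rule cycB_not_iso[OF pq root_p_p2[OF that(1)] that(2,3,3), where n = p]) (use that in simp)
  have ndvd: "\<not> int p dvd int i" if "1 \<le> i" "i < p" for i
    using that by (auto dest!: dvd_imp_le)
  have inj: "?R (cycB 1 (w \<up> int i)) (cycB 1 (w \<up> int j))"
    if "unity_root (p\<^sup>2) w" "p dvd U.ord w" "i < j" "j < p" for w i j
    using cycB1_power_inj[OF pq that(1,2), of "int i" "int j"] that(3,4) by (auto simp: cong_int_iff cong_def)
  have w1: "\<omega> \<noteq> 1" "\<omega> \<up> i = 1 \<longleftrightarrow> int p dvd i" if "p dvd q - 1" for i
    using \<omega>_power_eq_1[OF that] \<omega>_power_eq_1[OF that, of 1] \<omega>_facts(1)[OF that] p_gt_1 by auto
  have wt: "\<not> unity_root p \<omega>t" "unity_root p (\<omega>t \<up> i) \<longleftrightarrow> int p dvd i" if "p\<^sup>2 dvd q - 1" for i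
    using \<omega>t_power_root_p[OF that] \<omega>t_power_root_p[OF that, of 1] \<omega>t_facts(1)[OF that] p_gt_1 by auto
  have wt1: "\<omega>t \<noteq> 1" "\<omega>t \<up> i \<noteq> 1" if "p\<^sup>2 dvd q - 1" "\<not> int p dvd i" for i
    using wt[OF that(1)] that(2) root_n_1[of p] by metis+
  have sq: "?R (elemB 1 1 \<omega>) (elemB 1 (\<omega> \<up> i) 1)"
    if a: "p dvd q - 1" and ai: "\<not> int p dvd i" for i
  proof
    assume "brace_isomorphic (elemB 1 1 \<omega>) (elemB 1 (\<omega> \<up> i) 1)"
    then obtain d where d: "coprime d (int p)" "1 = (\<omega> \<up> i) \<up> (d * d)"
      using elemB_isoD(2)[OF pq root_n_1 \<omega>_facts(3)[OF a] root_power[OF \<omega>_facts(3)[OF a]] root_n_1, of 1 1 i] by auto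
    \<comment> \<open>The first root on the left is trivial, so i d^2 would vanish modulo p although
      neither factor does.\<close>
    then have "int p dvd i * (d * d)"
      using w1(2)[OF a] unfolding U.int_pow_pow[OF \<omega>_facts(1)[OF a]] by metis
    then show False using not_p_dvd_mult ai d(1) coprime_p by metis
  qed
  have qr: "?R (elemB 1 \<omega> 1) (elemB 1 (\<omega> \<up> \<eta>) 1)" if a: "p dvd q - 1"
  proof
    note wU = \<omega>_facts(1)[OF a]
    assume "brace_isomorphic (elemB 1 \<omega> 1) (elemB 1 (\<omega> \<up> \<eta>) 1)"
    then obtain d where d: "coprime d (int p)" "\<omega> = (\<omega> \<up> \<eta>) \<up> (d * d)"
      using elemB_isoD(2)[OF pq \<omega>_facts(3)[OF a] root_n_1 root_power[OF \<omega>_facts(3)[OF a]] root_n_1, of 1 1 \<eta>] by auto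
    then have "\<omega> \<up> (1 :: int) = \<omega> \<up> (\<eta> * (d * d))"
      unfolding U.int_pow_pow[OF wU] using wU by simp
    then have "[\<eta> * (d * d) = 1] (mod int p)"
      unfolding U.int_pow_eq[OF wU] \<omega>_facts(2)[OF a] by (simp add: cong_iff_dvd_diff)
    \<comment> \<open>The nonresidue would be the inverse of d^2, that is, the square of the inverse
      \<open>c\<close> of \<open>d\<close>.\<close>
    moreover obtain c where c: "[d * c = 1] (mod int p)" using d(1) cong_solve_coprime_int by blast
    ultimately have "[\<eta> * (d * d) * (c * c) = 1 * (c * c)] (mod int p)" by (intro cong_mult cong_refl)
    moreover have "[\<eta> * ((d * c) * (d * c)) = \<eta> * (1 * 1)] (mod int p)" by (intro cong_mult c cong_refl)
    ultimately have "[c * c = \<eta>] (mod int p)"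
      by (simp add: ac_simps) (meson cong_sym cong_trans)
    then have "QuadRes (int p) \<eta>" unfolding QuadRes_def power2_eq_square by blast
    then show False using \<eta>_facts[OF a] by simp
  qed
  have sq1: "?R (elemB 1 1 \<omega>) (elemB 1 \<omega> 1)" if "p dvd q - 1"
    using sq[OF that, of 1] \<omega>_facts(1)[OF that] p_gt_1 by simp
  have mapw: "sorted_wrt ?R (map (\<lambda>i. cycB 1 (w \<up> int i)) [1..<p])"
    if "unity_root (p\<^sup>2) w" "p dvd U.ord w" for w
    unfolding sorted_wrt_map
    by (rule sorted_wrt_mono_rel[OF _ sorted_wrt_upt]) (use inj[OF that] in auto)
  have 1: "sorted_wrt ?R trivial_list"
    by (simp add: trivial_list_def root_n_1 ce cc ee)
  have 2: "sorted_wrt ?R order_p_list" "\<forall>x \<in> set trivial_list. \<forall>y \<in> set order_p_list. ?R x y" if a: "p dvd q - 1"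
  proof -
    note rts = root_n_1 \<omega>_facts(3,4)[OF a] root_power[OF \<omega>_facts(3)[OF a]] root_power[OF \<omega>_facts(4)[OF a]]
    have m: "sorted_wrt ?R (map (\<lambda>i. cycB 1 (\<omega> \<up> int i)) [1..<p])"
      by (rule mapw[OF \<omega>_facts(4)[OF a]]) (simp add: \<omega>_facts(2)[OF a])
    have "\<forall>y \<in> (\<lambda>i. cycB 1 (\<omega> \<up> int i)) ` {1..<p}. ?R (elemB k w v) y"
      if "unity_root p w" "unity_root p v" "k \<in> {0, 1}" for k w v
      using ce(2)[OF root_power[OF \<omega>_facts(4)[OF a]] that(1,2) _ that(3)] by simp
    moreover have "\<forall>y \<in> (\<lambda>i. cycB 1 (\<omega> \<up> int i)) ` {1..<p}. ?R (cycB 0 w) y"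
      if "unity_root (p\<^sup>2) w" for w
      using cc[of 0 1, OF _ that root_power[OF \<omega>_facts(4)[OF a]]] by simp
    ultimately show "sorted_wrt ?R order_p_list"
      by (simp add: order_p_list_def sorted_wrt_append m rts ce cc ee sq[OF a] sq1[OF a] qr[OF a] \<eta>_facts(2)[OF a] del: One_nat_def)
    have m1: "\<forall>i \<in> {1..<p}. ?R (cycB 1 1) (cycB 1 (\<omega> \<up> int i))"
    proof
      fix i assume "i \<in> {1..<p}"
      then have "\<omega> \<up> int i \<noteq> 1" using w1(2)[OF a] ndvd[of i] by simp
      then show "?R (cycB 1 1) (cycB 1 (\<omega> \<up> int i))"
        using c1[OF root_power[OF \<omega>_facts(4)[OF a]], of 1] by simp
    qed
    show "\<forall>x \<in> set trivial_list. \<forall>y \<in> set order_p_list. ?R x y"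
      by (simp add: trivial_list_def order_p_list_def rts ce cc ee e1 c1 w1[OF a] \<eta>_facts(2)[OF a] m1 del: One_nat_def)
  qed
  have 3: "sorted_wrt ?R order_p2_list" "\<forall>x \<in> set trivial_list. \<forall>y \<in> set order_p2_list. ?R x y" "\<forall>x \<in> set order_p_list. \<forall>y \<in> set order_p2_list. ?R x y"
    if b: "p\<^sup>2 dvd q - 1"
  proof -
    note a = p_dvd[OF b]
    note rts = root_n_1 \<omega>_facts(3,4)[OF a] root_power[OF \<omega>_facts(3)[OF a]] root_power[OF \<omega>_facts(4)[OF a]]
      \<omega>t_facts(3)[OF b] root_power[OF \<omega>t_facts(3)[OF b]]
    have m: "sorted_wrt ?R (map (\<lambda>i. cycB 1 (\<omega>t \<up> int i)) [1..<p])"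
      by (rule mapw[OF \<omega>t_facts(3)[OF b]]) (simp add: \<omega>t_facts(2)[OF b])
    moreover have "\<forall>y \<in> (\<lambda>i. cycB 1 (\<omega>t \<up> int i)) ` {1..<p}. ?R (cycB 0 \<omega>t) y"
      using cc[of 0 1, OF _ \<omega>t_facts(3)[OF b] root_power[OF \<omega>t_facts(3)[OF b]]] by simp
    ultimately show "sorted_wrt ?R order_p2_list" by (simp add: order_p2_list_def)
    have L3: "y = cycB 0 \<omega>t \<or> (\<exists>i. 1 \<le> i \<and> i < p \<and> y = cycB 1 (\<omega>t \<up> int i))" if "y \<in> set order_p2_list" for y
      using that by (auto simp: order_p2_list_def)
    have E: "?R (elemB k w v) y" if "unity_root p w" "unity_root p v" "k \<in> {0, 1}" "y \<in> set order_p2_list" for k w v y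
      using L3[OF that(4)]
    proof (elim disjE exE conjE)
      assume "y = cycB 0 \<omega>t"
      then show ?thesis using ce(2)[OF \<omega>t_facts(3)[OF b] that(1,2) _ that(3)] by simp
    next
      fix i assume "y = cycB 1 (\<omega>t \<up> int i)"
      then show ?thesis using ce(2)[OF root_power[OF \<omega>t_facts(3)[OF b]] that(1,2) _ that(3)] by simp
    qed
    have C: "?R (cycB k w) y" if w: "unity_root p w" and k: "k \<in> {0, 1}" and y: "y \<in> set order_p2_list" for k w y
      using L3[OF y]
    proof (elim disjE exE conjE)
      assume "y = cycB 0 \<omega>t"
      then show ?thesis
        using ct[OF w \<omega>t_facts(3)[OF b], of 0] cc[of k 0, OF _ root_p_p2[OF w] \<omega>t_facts(3)[OF b]] k wt(1)[OF b]
        by (cases "k = 0") auto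
    next
      fix i assume i: "1 \<le> i" "i < p" "y = cycB 1 (\<omega>t \<up> int i)"
      then show ?thesis
        using ct[OF w root_power[OF \<omega>t_facts(3)[OF b]], of 1 "int i"] ndvd[OF i(1,2)] wt(2)[OF b, of "int i"]
          cc[of k 1, OF _ root_p_p2[OF w] root_power[OF \<omega>t_facts(3)[OF b]]] k
        by (cases "k = 1") auto
    qed
    have EC: "\<forall>y \<in> set order_p2_list. ?R (elemB k w v) y" "\<forall>y \<in> set order_p2_list. ?R (cycB k w) y"
      if "unity_root p w" "unity_root p v" "k \<in> {0, 1}" for k w v
      using E C that by blast+
    show "\<forall>x \<in> set trivial_list. \<forall>y \<in> set order_p2_list. ?R x y"
      by (simp add: trivial_list_def EC(1) EC(2)[OF _ root_n_1] root_n_1)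
    show "\<forall>x \<in> set order_p_list. \<forall>y \<in> set order_p2_list. ?R x y"
      by (simp add: order_p_list_def EC(1) EC(2)[OF _ root_n_1] rts)
  qed
  show ?thesis
  proof (cases "p dvd q - 1")
    case False
    then have "\<not> p\<^sup>2 dvd q - 1" using p_dvd by blast
    then show ?thesis using False 1 unfolding named_braces_eq by simp
  next
    case a: True
    show ?thesis
    proof (cases "p\<^sup>2 dvd q - 1")
      case False
      then show ?thesis using a 1 2[OF a] unfolding named_braces_eq by (simp add: sorted_wrt_append)
    next
      case True
      then show ?thesis using a 1 2[OF a] 3[OF True] unfolding named_braces_eq by (simp add: sorted_wrt_append ball_Un)
    qed
  qed
qed

lemma named_braces_complete:
  assumes A: "brace A" "order A = p\<^sup>2 * q"
  shows "\<exists>B \<in> set (named_braces p q \<omega> \<eta> \<omega>t). brace_isomorphic A B"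
proof -
  let ?L = "set trivial_list \<union> (if p dvd q - 1 then set order_p_list else {})
    \<union> (if p\<^sup>2 dvd q - 1 then set order_p2_list else {})"
  have "\<exists>B \<in> ?L. brace_isomorphic A B"
    using brace_classification_params[OF lt A]
  proof (elim disjE bexE exE conjE)
    fix k w assume k: "k \<in> {0, 1 :: int}" and w: "unity_root (p\<^sup>2) w" and iso: "brace_isomorphic A (cycB k w)"
    note wU = rootD[OF w]
    \<comment> \<open>The order of \<open>w\<close> is 1, p or p^2; the last two cases force the
      divisibility that puts the corresponding segment into the list.\<close>
    consider "w = 1" | "w \<noteq> 1" "unity_root p w" | "\<not> unity_root p w" by blast
    then show ?thesis
    proof cases
      case 1
      then have "cycB k w \<in> set trivial_list" using k by (auto simp: trivial_list_def)
      then show ?thesis using iso by blast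
    next
      case 2
      have a: "p dvd q - 1" using root_p_cases(1)[OF w] 2(1) by blast
      obtain i :: int where i: "0 \<le> i" "i < int p" "w = \<omega> \<up> i"
        using root_generated[OF \<omega>_facts(1,2)[OF a] _ rootD[OF 2(2)]] p_gt_1 by auto
      have ndvd: "\<not> int p dvd i" using \<omega>_power_eq_1[OF a] 2(1) i(3) by simp
      show ?thesis
      proof (cases "k = 0")
        case True
        have "brace_isomorphic A (cycB 0 \<omega>)"
          using brace_isomorphic_trans[OF iso] cycB0_iso_power[OF pq \<omega>_facts(4)[OF a] ndvd] i(3) True by simp
        moreover have "cycB 0 \<omega> \<in> set order_p_list" by (simp add: order_p_list_def)
        ultimately show ?thesis using a by auto
      next
        case False
        have "i \<noteq> 0" using ndvd by auto
        have "cycB k w \<in> (\<lambda>i. cycB 1 (\<omega> \<up> int i)) ` {1..<p}"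
        proof (rule image_eqI)
          show "cycB k w = cycB 1 (\<omega> \<up> int (nat i))" using False k i by simp
          show "nat i \<in> {1..<p}" using \<open>i \<noteq> 0\<close> i by auto
        qed
        then have "cycB k w \<in> set order_p_list" by (simp add: order_p_list_def)
        then show ?thesis using a iso by auto
      qed
    next
      case 3
      have b: "p\<^sup>2 dvd q - 1" using root_p_cases(2)[OF w] 3 by blast
      obtain i :: int where i: "0 \<le> i" "w = \<omega>t \<up> i"
        using root_generated[OF \<omega>t_facts(1,2)[OF b] _ wU] p_gt_1 by auto
      have ndvd: "\<not> int p dvd i" using \<omega>t_power_root_p[OF b] 3 i(2) by simp
      show ?thesis
      proof (cases "k = 0")
        case True
        have "brace_isomorphic A (cycB 0 \<omega>t)"
          using brace_isomorphic_trans[OF iso] cycB0_iso_power[OF pq \<omega>t_facts(3)[OF b] ndvd] i(2) True by simp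
        moreover have "cycB 0 \<omega>t \<in> set order_p2_list" by (simp add: order_p2_list_def)
        ultimately show ?thesis using b by auto
      next
        case False
        \<comment> \<open>The exponent ranges over residues modulo p^2, but the isomorphism class
          depends on it only modulo p.\<close>
        let ?j = "nat (i mod int p)"
        have j0: "0 \<le> i mod int p" "i mod int p < int p" using p_gt_1 by simp_all
        then have j: "int ?j = i mod int p" by simp
        have "i mod int p \<noteq> 0" using ndvd by (simp add: dvd_eq_mod_eq_0)
        then have "?j \<in> {1..<p}" using j0 by auto
        then have "cycB 1 (\<omega>t \<up> int ?j) \<in> (\<lambda>i. cycB 1 (\<omega>t \<up> int i)) ` {1..<p}" by (rule imageI)
        then have "cycB 1 (\<omega>t \<up> int ?j) \<in> set order_p2_list" by (simp add: order_p2_list_def)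
        moreover have "brace_isomorphic A (cycB 1 (\<omega>t \<up> int ?j))"
        proof (rule brace_isomorphic_trans)
          show "brace_isomorphic A (cycB 1 (\<omega>t \<up> i))" using iso i(2) k False by simp
          show "brace_isomorphic (cycB 1 (\<omega>t \<up> i)) (cycB 1 (\<omega>t \<up> int ?j))"
            by (rule cycB1_iso_power[OF pq \<omega>t_facts(3)[OF b] ndvd]) (unfold j, simp add: cong_def)
        qed
        ultimately show ?thesis using b by auto
      qed
    qed
  next
    fix k w v assume k: "k \<in> {0, 1 :: int}" and wv: "unity_root p w" "unity_root p v"
      and iso: "brace_isomorphic A (elemB k w v)"
    show ?thesis
    proof (cases "w = 1 \<and> v = 1")
      case True
      then have "elemB k w v \<in> set trivial_list" using k by (auto simp: trivial_list_def)
      then show ?thesis using iso by blast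
    next
      case False
      have a: "p dvd q - 1"
        using root_p_cases(1)[OF root_p_p2[OF wv(1)]] root_p_cases(1)[OF root_p_p2[OF wv(2)]] False by blast
      note w = \<omega>_facts[OF a]
      have p0: "0 < p" using p_gt_1 by simp
      obtain i where i: "w = \<omega> \<up> (i :: int)" using root_generated[OF w(1,2) p0 rootD[OF wv(1)]] by blast
      obtain j where j: "v = \<omega> \<up> (j :: int)" using root_generated[OF w(1,2) p0 rootD[OF wv(2)]] by blast
      have ij: "\<not> int p dvd i \<or> \<not> int p dvd j" using False i j \<omega>_power_eq_1[OF a] by simp
      have iso: "brace_isomorphic A (elemB k (\<omega> \<up> i) (\<omega> \<up> j))" using iso i j by simp
      note tr = brace_isomorphic_trans[OF iso]
      have "\<exists>B \<in> set order_p_list. brace_isomorphic A B"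
      proof (cases "k = 0")
        case True
        then have "brace_isomorphic A (elemB 0 \<omega> 1)" using tr elemB0_normal[OF w(3) ij] by simp
        then show ?thesis by (simp add: order_p_list_def)
      next
        case False
        then have k1: "k = 1" using k by simp
        \<comment> \<open>Modulo p the first exponent is zero, a nonzero square, or the fixed
          nonresidue times a square: one case for each of the three braces of this family with
          nontrivial character.\<close>
        consider "int p dvd i" | d where "\<not> int p dvd i" "[i = 1 * (d * d)] (mod int p)"
          | d where "\<not> int p dvd i" "[i = \<eta> * (d * d)] (mod int p)"
        proof (cases "int p dvd i")
          case ndvd: False
          show ?thesis
          proof (cases "QuadRes (int p) i")
            case True
            then obtain d where "[i = 1 * (d * d)] (mod int p)"
              unfolding QuadRes_def power2_eq_square using cong_sym by auto
            then show ?thesis using that(2) ndvd by blast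
          next
            case False
            show ?thesis
              using nonresidue_quotient[OF p lt(1) False \<eta>_facts(1)[OF a]] that(3) ndvd by blast
          qed
        qed
        then show ?thesis
        proof cases
          case 1
          then have "brace_isomorphic A (elemB 1 1 \<omega>)" using tr[OF elemB1_normal_dvd[OF w(3) 1, of j, folded k1]] ij 1 k1 by simp
          then show ?thesis by (simp add: order_p_list_def)
        next
          case 2
          have "brace_isomorphic A (elemB 1 (\<omega> \<up> (1 :: int)) 1)"
            using tr elemB1_normal_coprime[OF w(3) 2, of j] k1 by simp
          then have "brace_isomorphic A (elemB 1 \<omega> 1)" using w(1) by simp
          then show ?thesis by (simp add: order_p_list_def)
        next
          case 3
          have "brace_isomorphic A (elemB 1 (\<omega> \<up> \<eta>) 1)"
            using tr elemB1_normal_coprime[OF w(3) 3, of j] k1 by simp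
          then show ?thesis by (simp add: order_p_list_def)
        qed
      qed
      then show ?thesis using a by auto
    qed
  qed
  moreover have "?L = set (named_braces p q \<omega> \<eta> \<omega>t)"
    unfolding named_braces_eq by (simp add: Un_assoc)
  ultimately show ?thesis by simp
qed

end

theorem theorem4:
  fixes p q :: nat and \<omega> \<eta> \<omega>t :: int
  assumes "Factorial_Ring.prime p" "Factorial_Ring.prime q" "2 < p" "p < q"
    and "p dvd q - 1 \<Longrightarrow> primitive_root_mod p q \<omega>"
    and "p dvd q - 1 \<Longrightarrow> quadratic_nonresidue p \<eta>"
    and "p\<^sup>2 dvd q - 1 \<Longrightarrow> primitive_root_mod (p\<^sup>2) q \<omega>t"
  shows "(\<forall>B \<in> set (named_braces p q \<omega> \<eta> \<omega>t). brace B \<and> order B = p\<^sup>2 * q)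
    \<and> (\<forall>i < length (named_braces p q \<omega> \<eta> \<omega>t). \<forall>j < length (named_braces p q \<omega> \<eta> \<omega>t).
         i \<noteq> j \<longrightarrow>
         \<not> brace_isomorphic (named_braces p q \<omega> \<eta> \<omega>t ! i) (named_braces p q \<omega> \<eta> \<omega>t ! j))
    \<and> (\<forall>A :: ('a, 'm) ring_scheme. brace A \<and> order A = p\<^sup>2 * q \<longrightarrow>
         (\<exists>!i. i < length (named_braces p q \<omega> \<eta> \<omega>t) \<and>
               brace_isomorphic A (named_braces p q \<omega> \<eta> \<omega>t ! i)))"
proof -
  interpret brace_list p q \<omega> \<eta> \<omega>t
    using assms prime_odd_nat[OF assms(1,3)] by unfold_locales
  let ?L = "named_braces p q \<omega> \<eta> \<omega>t"
  have ok: "brace (?L ! i) \<and> order (?L ! i) = p\<^sup>2 * q" if "i < length ?L" for i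
    by (rule named_braces_brace) (use that in simp)
  have noniso: "\<not> brace_isomorphic (?L ! i) (?L ! j)" if "i < length ?L" "j < length ?L" "i \<noteq> j" for i j
  proof (cases "i < j")
    case True
    then show ?thesis using sorted_wrt_nth_less[OF named_braces_pairwise True] that(2) by blast
  next
    case False
    \<comment> \<open>\<open>sorted_wrt\<close> covers only increasing pairs of indices; symmetry of
      isomorphism, valid since the entries are braces, gives the rest.\<close>
    then have "\<not> brace_isomorphic (?L ! j) (?L ! i)"
      using sorted_wrt_nth_less[OF named_braces_pairwise, of j i] that by simp
    then show ?thesis using brace_isomorphic_sym ok[OF that(1)] by blast
  qed
  have "\<exists>!i. i < length ?L \<and> brace_isomorphic A (?L ! i)"
    if A: "brace A \<and> order A = p\<^sup>2 * q" for A :: "('a, 'm) ring_scheme"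
  proof -
    obtain i where i: "i < length ?L" "brace_isomorphic A (?L ! i)"
      using named_braces_complete[of A] A by (metis in_set_conv_nth)
    show ?thesis
    proof (rule ex1I[of _ i])
      fix j assume j: "j < length ?L \<and> brace_isomorphic A (?L ! j)"
      have "brace_isomorphic (?L ! j) (?L ! i)"
        using brace_isomorphic_trans[OF brace_isomorphic_sym i(2)] A j by blast
      then show "j = i" using noniso j i(1) by blast
    qed (use i in simp)
  qed
  then show ?thesis using named_braces_brace noniso by blast
qed

end
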